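(* Let $S$ be either the dyadic square function $S_d$ on $\mathbb{R}^n$ or the intrinsic square function $G_\alpha$ on $\mathbb{R}^n$ for some $0<\alpha\le 1$. Then for any $3\le p\le r<\infty$ there is a constant $c(S,p,r,n)$, depending only on the operator, $p$, $r$ and $n$, such that for every weight $w$ on $\mathbb{R}^n$, $$\|S\|_{L^p(w)}\le c(S,p,r,n)\,\|w\|_{(A_p)^{\frac{1}{p-1}}(A_r)^{\frac12-\frac{1}{p-1}}}.$$
   Context: A weight is a non-negative locally integrable function $w$ on $\mathbb{R}^n$. $L^p(w)$ is the space with norm $\|f\|_{L^p(w)}=(\int_{\mathbb{R}^n}|f|^p w\,dx)^{1/p}$, and $\|S\|_{L^p(w)}$ denotes the least constant $C$ with $\|Sf\|_{L^p(w)}\le C\|f\|_{L^p(w)}$ for all $f\in L^p(w)$. For a cube $Q\subset\mathbb{R}^n$ and $1<p<\infty$, $$A_p(w;Q)=\Big(\frac{1}{|Q|}\int_Q w\Big)\Big(\frac{1}{|Q|}\int_Q w^{-\frac{1}{p-1}}\Big)^{p-1}.$$ For exponents $a,b$ and $1<p,r<\infty$, $$\|w\|_{(A_p)^{a}(A_r)^{b}}=\sup_{Q\subset\mathbb{R}^n}A_p(w;Q)^{a}A_r(w;Q)^{b},$$ where a single supremum is taken over all cubes $Q\subset\mathbb{R}^n$. The inequality is understood to have content only when this quantity is finite. Dyadic square function: $$S_df(x)=\Big(\sum_{Q\in\mathcal{D}}(f_Q-f_{\widehat Q})^2\chi_Q(x)\Big)^{1/2},$$ where $\mathcal{D}$ is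 the set of all dyadic cubes in $\mathbb{R}^n$, $f_Q=\frac{1}{|Q|}\int_Q f$, and $\widehat Q$ is the dyadic parent of $Q$ (the dyadic cube containing $Q$ with $|\widehat Q|=2^n|Q|$). Intrinsic square function: let $\mathbb{R}^{n+1}_+=\mathbb{R}^n\times\mathbb{R}_+$ and $\Gamma(x)=\{(y,t)\in\mathbb{R}^{n+1}_+:|y-x|<t\}$. For $0<\alpha\le1$ let $\mathcal{C}_\alpha$ be the family of functions $\varphi$ supported in $\{x:|x|\le1\}$ with $\int\varphi=0$ and $|\varphi(x)-\varphi(x')|\le|x-x'|^\alpha$ for all $x,x'$. For $f\in L^1_{\mathrm{loc}}(\mathbb{R}^n)$ and $(y,t)\in\mathbb{R}^{n+1}_+$ set $A_\alpha(f)(y,t)=\sup_{\varphi\in\mathcal{C}_\alpha}|f*\varphi_t(y)|$, where $\varphi_t(x)=t^{-n}\varphi(x/t)$. Then $$G_\alpha(f)(x)=\Big(\int_{\Gamma(x)}\big(A_\alpha(f)(y,t)\big)^2\frac{dy\,dt}{t^{n+1}}\Big)^{1/2}.$$ *)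

theory Defs
  imports "HOL-Analysis.Analysis"
begin

section \<open>Real powers of extended non-negative reals\<close>

text \<open>
  Conventions: \<open>x\<^sup>0 = 1\<close> for every \<open>x\<close>; if \<open>a > 0\<close> then \<open>0\<^sup>a = 0\<close> and \<open>\<infinity>\<^sup>a = \<infinity>\<close>; if \<open>a < 0\<close> then
  \<open>0\<^sup>a = \<infinity>\<close> and \<open>\<infinity>\<^sup>a = 0\<close>. In particular a weight that vanishes somewhere has
  \<open>w\<close> to a negative power equal to \<open>\<infinity>\<close> there, unlike with the real \<open>powr\<close>.
\<close>

definition ennreal_powr :: "ennreal \<Rightarrow> real \<Rightarrow> ennreal" where
  "ennreal_powr x a =
     (if a = 0 then 1
      else if x = 0 then (if a > 0 then 0 else \<infinity>)
      else if x = \<infinity> then (if a > 0 then \<infinity> else 0)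
      else ennreal (enn2real x powr a))"

section \<open>Cubes, averages and weights\<close>

definition cubes :: "(real ^ 'n) set set" where
  "cubes = {cbox a (\<chi> i. a $ i + l) | a l. 0 < l}"

definition nn_average :: "(real ^ 'n \<Rightarrow> ennreal) \<Rightarrow> (real ^ 'n) set \<Rightarrow> ennreal" where
  "nn_average g Q = (\<integral>\<^sup>+x\<in>Q. g x \<partial>lebesgue) / emeasure lebesgue Q"

definition average :: "(real ^ 'n \<Rightarrow> real) \<Rightarrow> (real ^ 'n) set \<Rightarrow> real" where
  "average f Q = (LINT x:Q|lebesgue. f x) / measure lebesgue Q"

definition weight :: "(real ^ 'n \<Rightarrow> real) \<Rightarrow> bool" where
  "weight w \<longleftrightarrow> (\<forall>x. 0 \<le> w x) \<and> (\<forall>K. compact K \<longrightarrow> set_integrable lebesgue K w)"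

definition Ap_cube :: "real \<Rightarrow> (real ^ 'n \<Rightarrow> real) \<Rightarrow> (real ^ 'n) set \<Rightarrow> ennreal" where
  "Ap_cube p w Q =
     nn_average (\<lambda>x. ennreal (w x)) Q *
     ennreal_powr (nn_average (\<lambda>x. ennreal_powr (ennreal (w x)) (- 1 / (p - 1))) Q) (p - 1)"

definition mixed_Ap_Ar :: "real \<Rightarrow> real \<Rightarrow> real \<Rightarrow> real \<Rightarrow> (real ^ 'n \<Rightarrow> real) \<Rightarrow> ennreal" where
  "mixed_Ap_Ar p a r b w =
     (SUP Q\<in>cubes. ennreal_powr (Ap_cube p w Q) a * ennreal_powr (Ap_cube r w Q) b)"

section \<open>Weighted Lebesgue spaces and operator norms\<close>

text \<open>
  The norm is defined for \<open>ennreal\<close>-valued functions, since a square function may be infinite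
  at some points.
\<close>

definition Lp_norm :: "real \<Rightarrow> (real ^ 'n \<Rightarrow> real) \<Rightarrow> (real ^ 'n \<Rightarrow> ennreal) \<Rightarrow> ennreal" where
  "Lp_norm p w g =
     ennreal_powr (\<integral>\<^sup>+x. ennreal_powr (g x) p * ennreal (w x) \<partial>lebesgue) (1 / p)"

definition Lp_space :: "real \<Rightarrow> (real ^ 'n \<Rightarrow> real) \<Rightarrow> (real ^ 'n \<Rightarrow> real) set" where
  "Lp_space p w =
     {f. f \<in> borel_measurable lebesgue \<and> Lp_norm p w (\<lambda>x. ennreal \<bar>f x\<bar>) < \<infinity>}"

definition op_norm ::
    "((real ^ 'n \<Rightarrow> real) \<Rightarrow> real ^ 'n \<Rightarrow> ennreal) \<Rightarrow> real \<Rightarrow> (real ^ 'n \<Rightarrow> real) \<Rightarrow> ennreal" where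
  "op_norm S p w =
     Inf {C. \<forall>f\<in>Lp_space p w. Lp_norm p w (S f) \<le> C * Lp_norm p w (\<lambda>x. ennreal \<bar>f x\<bar>)}"

section \<open>The dyadic square function\<close>

definition dyadic_cubes :: "(real ^ 'n) set set" where
  "dyadic_cubes =
     {{x. \<forall>i. of_int (k i) * 2 powi j \<le> x $ i \<and> x $ i < (of_int (k i) + 1) * 2 powi j}
       | (k :: 'n \<Rightarrow> int) (j :: int). True}"

definition dyadic_parent :: "(real ^ 'n) set \<Rightarrow> (real ^ 'n) set" where
  "dyadic_parent Q =
     (THE R. R \<in> dyadic_cubes \<and> Q \<subseteq> R \<and> measure lebesgue R = 2 ^ CARD('n) * measure lebesgue Q)"

definition dyadic_square :: "(real ^ 'n \<Rightarrow> real) \<Rightarrow> real ^ 'n \<Rightarrow> ennreal" where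
  "dyadic_square f x =
     ennreal_powr
       (\<Sum>\<^sub>\<infinity>Q\<in>dyadic_cubes.
          ennreal ((average f Q - average f (dyadic_parent Q))\<^sup>2) * indicator Q x)
       (1 / 2)"

section \<open>The intrinsic square function\<close>

definition cone :: "real ^ 'n \<Rightarrow> ((real ^ 'n) \<times> real) set" where
  "cone x = {(y, t). 0 < t \<and> norm (y - x) < t}"

definition C_alpha :: "real \<Rightarrow> (real ^ 'n \<Rightarrow> real) set" where
  "C_alpha \<alpha> =
     {\<phi>. (\<forall>x. 1 < norm x \<longrightarrow> \<phi> x = 0) \<and> (LINT x|lebesgue. \<phi> x) = 0 \<and>
          (\<forall>x x'. \<bar>\<phi> x - \<phi> x'\<bar> \<le> norm (x - x') powr \<alpha>)}"

definition dilate :: "(real ^ 'n \<Rightarrow> real) \<Rightarrow> real \<Rightarrow> real ^ 'n \<Rightarrow> real" where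
  "dilate \<phi> t x = \<phi> (x /\<^sub>R t) / t ^ CARD('n)"

definition convolve :: "(real ^ 'n \<Rightarrow> real) \<Rightarrow> (real ^ 'n \<Rightarrow> real) \<Rightarrow> real ^ 'n \<Rightarrow> real" where
  "convolve f g y = (LINT x|lebesgue. f x * g (y - x))"

definition A_alpha :: "real \<Rightarrow> (real ^ 'n \<Rightarrow> real) \<Rightarrow> real ^ 'n \<Rightarrow> real \<Rightarrow> ennreal" where
  "A_alpha \<alpha> f y t = (SUP \<phi>\<in>C_alpha \<alpha>. ennreal \<bar>convolve f (dilate \<phi> t) y\<bar>)"

definition intrinsic_square :: "real \<Rightarrow> (real ^ 'n \<Rightarrow> real) \<Rightarrow> real ^ 'n \<Rightarrow> ennreal" where
  "intrinsic_square \<alpha> f x =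
     ennreal_powr
       (\<integral>\<^sup>+z\<in>cone x. (A_alpha \<alpha> f (fst z) (snd z))\<^sup>2 * ennreal (1 / snd z ^ (CARD('n) + 1)) \<partial>lebesgue)
       (1 / 2)"

end

theory Submission
  imports Defs
begin

text \<open>
  Write \<open>w\<^sub>Q\<close> for the average of \<open>w\<close> over \<open>Q\<close>. For both operators the square is dominated pointwise
  by a sum of \<open>c\<^sub>k(x)^2\<close> over the scales \<open>2^k\<close>, taken on one dyadic grid or on finitely many of
  them. Here \<open>c\<^sub>k(x)\<close> is the largest pairing of \<open>f\<close> with a function on the cube of side \<open>2^k\<close>
  around \<open>x\<close> that has mean zero and is Hoelder continuous on the scale of the grid. The difference
  of two consecutive dyadic averages is such a pairing. For the intrinsic square function, the
  support of the kernel at a point of the cone over \<open>x\<close> lies in a ball around \<open>x\<close>, and such a ball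
  lies in a cube of comparable size of one of \<open>2^n\<close> shifted grids
  (\<open>average_child_diff_le\<close>, \<open>A_alpha_le_coef\<close>).

  To bound this dyadic operator one pairs its square \<open>T = \<Sum>\<^sub>k c\<^sub>k^2\<close> with a function
  \<open>\<Phi> = g w\<close> and selects cubes by a stopping time: starting from a cube, stop as soon as the
  average of \<open>|f|\<close> or of \<open>\<Phi>\<close> exceeds four times its value on that cube. Until then the stopped
  martingale of \<open>f\<close> is bounded, so orthogonality of martingale differences in \<open>L^2\<close> is all that is
  used, and the cubes between a selected cube \<open>Q\<close> and its successors contribute at most a constant
  times \<open>|f|\<^sub>Q^2 \<Phi>\<^sub>Q |Q|\<close> (\<open>stopped_square_sum\<close>). The successors cover at most half of \<open>Q\<close>;
  the remaining sets \<open>E\<^sub>Q\<close> are disjoint (\<open>stopping_time_bound\<close>).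

  The weight enters once, on a single cube. Put \<open>\<sigma> = w^(-1/(p-1))\<close>, \<open>\<rho> = w^(-1/(r-1))\<close> and
  \<open>\<delta> = (p-3)/(p-1)\<close>, which is non-negative because \<open>p \<ge> 3\<close>. As both characteristics are
  taken on the same cube, squaring their product gives
  \<open>w\<^sub>Q \<sigma>\<^sub>Q^2 \<rho>\<^sub>Q^((r-1)\<delta>) \<le> K^2\<close>, where \<open>K\<close> is the mixed characteristic. Hoelder's
  inequality on \<open>E\<^sub>Q\<close> gives \<open>|Q| \<le> c \<rho>\<^sub>Q^((r-1)\<delta>) w^\<delta>(E\<^sub>Q)\<close>, where \<open>w^\<delta>(E)\<close>
  is the integral of \<open>w^\<delta>\<close> over \<open>E\<close>. Hence \<open>\<sigma>\<^sub>Q^2 w\<^sub>Q |Q| \<le> c K^2 w^\<delta>(E\<^sub>Q)\<close>.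
  With \<open>f = h \<sigma>\<close> and the maximal functions \<open>M\<^sub>\<sigma>\<close>, \<open>M\<^sub>w\<close> of the measures with densities
  \<open>\<sigma>\<close> and \<open>w\<close>, summation over the selected cubes bounds the integral of \<open>T g w\<close> by
  \<open>c K^2\<close> times the integral of \<open>(M\<^sub>\<sigma> h)^2 (M\<^sub>w g) w^\<delta>\<close>. Since
  \<open>w^\<delta> = \<sigma>^(2/p) w^(1-2/p)\<close>, Hoelder's inequality and Doob's maximal inequality, whose
  constants do not depend on the measure, bound \<open>T\<close> in \<open>L^(p/2)(w)\<close> by a constant times \<open>K^2\<close>
  times the square of the norm of \<open>f\<close> in \<open>L^p(w)\<close> (\<open>weighted_bound\<close>).

  Between a smallest and a largest scale all integrals are finite sums over cells, and the argument
  is carried out in this form; monotone convergence then removes both scales (\<open>global_bound\<close>).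
\<close>

section \<open>Hoelder's inequality and averages\<close>

text \<open>
  Young's inequality for \<open>u/U\<close> and \<open>v/V\<close>, where \<open>U\<close> and
  \<open>V\<close> are the two integrals, is integrated. With exponents of sum one and no powers
  inside the integrals on the right, the same form serves for Hoelder's and for Jensen's inequality
  below.
\<close>

lemma Hoelder_geometric_mean:
  fixes u v :: "'a \<Rightarrow> real"
  assumes u: "integrable M u" and v: "integrable M v"
    and u0: "AE x in M. 0 \<le> u x" and v0: "AE x in M. 0 \<le> v x"
    and ab: "0 < a" "0 < b" "a + b = 1"
  shows "integrable M (\<lambda>x. u x powr a * v x powr b)"
    and "(\<integral>x. u x powr a * v x powr b \<partial>M) \<le> (\<integral>x. u x \<partial>M) powr a * (\<integral>x. v x \<partial>M) powr b"
proof -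
  define U V where "U = (\<integral>x. u x \<partial>M)" and "V = (\<integral>x. v x \<partial>M)"
  have UV: "0 \<le> U" "0 \<le> V" unfolding U_def V_def using u0 v0 by (auto intro: integral_nonneg_AE)
  have young: "s powr a * t powr b \<le> a * s + b * t" if "0 \<le> s" "0 \<le> t" for s t :: real
    using Youngs_inequality_0[of a b s t] ab that by (cases "s = 0 \<or> t = 0") auto
  have m: "(\<lambda>x. u x powr a * v x powr b) \<in> borel_measurable M"
    using borel_measurable_integrable[OF u] borel_measurable_integrable[OF v] by measurable
  show int: "integrable M (\<lambda>x. u x powr a * v x powr b)"
  proof (rule Bochner_Integration.integrable_bound[OF _ m])
    show "integrable M (\<lambda>x. a * u x + b * v x)" using u v by simp
    show "AE x in M. norm (u x powr a * v x powr b) \<le> norm (a * u x + b * v x)"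
      using u0 v0 by eventually_elim (use young ab in \<open>auto intro: order_trans[OF _ abs_ge_self]\<close>)
  qed
  show "(\<integral>x. u x powr a * v x powr b \<partial>M) \<le> (\<integral>x. u x \<partial>M) powr a * (\<integral>x. v x \<partial>M) powr b"
  proof (cases "U = 0 \<or> V = 0")
    case True
    then have "AE x in M. u x = 0 \<or> v x = 0"
      using integral_nonneg_eq_0_iff_AE[OF u u0] integral_nonneg_eq_0_iff_AE[OF v v0]
      by (auto simp: U_def V_def elim: eventually_mono)
    then have "AE x in M. u x powr a * v x powr b = 0" by eventually_elim auto
    then have "(\<integral>x. u x powr a * v x powr b \<partial>M) = 0" by (rule integral_eq_zero_AE)
    then show ?thesis by simp
  next
    case False
    then have UV: "0 < U" "0 < V" using UV by auto
    have "(\<integral>x. u x powr a * v x powr b \<partial>M)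
        \<le> (\<integral>x. U powr a * V powr b * (a / U * u x + b / V * v x) \<partial>M)"
    proof (rule integral_mono_AE[OF int])
      show "integrable M (\<lambda>x. U powr a * V powr b * (a / U * u x + b / V * v x))" using u v by simp
      show "AE x in M. u x powr a * v x powr b \<le> U powr a * V powr b * (a / U * u x + b / V * v x)"
        using u0 v0
      proof eventually_elim
        case (elim x)
        have "u x powr a * v x powr b = U powr a * V powr b * ((u x / U) powr a * (v x / V) powr b)"
          using UV elim by (simp add: powr_divide)
        also have "\<dots> \<le> U powr a * V powr b * (a * (u x / U) + b * (v x / V))"
          using UV elim by (intro mult_left_mono young) auto
        finally show ?case by simp
      qed
    qed
    also have "\<dots> = U powr a * V powr b * (a / U * U + b / V * V)"
      using u v by (simp add: U_def V_def)
    also have "\<dots> = U powr a * V powr b" using UV ab by simp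
    finally show ?thesis by (simp add: U_def V_def)
  qed
qed

lemma Hoelder_sum:
  fixes u v :: "'a \<Rightarrow> real"
  assumes "finite A" "\<And>x. x \<in> A \<Longrightarrow> 0 \<le> u x" "\<And>x. x \<in> A \<Longrightarrow> 0 \<le> v x" "0 < a" "0 < b" "a + b = 1"
  shows "(\<Sum>x\<in>A. u x powr a * v x powr b) \<le> sum u A powr a * sum v A powr b"
  using Hoelder_geometric_mean(2)[of "count_space A" u v a b] assms
  by (simp add: integrable_count_space AE_count_space lebesgue_integral_count_space_finite)

text \<open>
  Young's inequality for \<open>d * c^q\<close>. This is the source of the factor
  \<open>(q+1)/q\<close> in Doob's maximal inequality: \<open>d\<close> is the new value of a
  running maximum and \<open>c\<close> the old one.
\<close>

lemma powr_increment_le: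
  fixes c d q :: real
  assumes "0 \<le> c" "c \<le> d" "0 < q"
  shows "d powr (q + 1) - c powr (q + 1) \<le> (q + 1) / q * d * (d powr q - c powr q)"
proof -
  have y: "d * c powr q \<le> d powr (q + 1) / (q + 1) + (c powr q) powr ((q + 1) / q) / ((q + 1) / q)"
    by (rule Youngs_inequality) (use assms in \<open>auto simp: field_simps\<close>)
  have "(c powr q) powr ((q + 1) / q) = c powr (q + 1)" using assms by (simp add: powr_powr)
  then have "d * c powr q \<le> (d powr (q + 1) + q * c powr (q + 1)) / (q + 1)"
    using y unfolding add_divide_distrib[of _ _ "q + 1"] by (simp only: divide_divide_eq_right mult.commute)
  then have "(q + 1) * (d * c powr q) \<le> d powr (q + 1) + q * c powr (q + 1)"
    using assms by (simp add: pos_le_divide_eq mult.commute)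
  then have "q * (d powr (q + 1) - c powr (q + 1)) \<le> (q + 1) * (d powr (q + 1) - d * c powr q)"
    by (simp add: algebra_simps)
  moreover have "d powr (q + 1) - d * c powr q = d * (d powr q - c powr q)"
    using assms by (simp add: powr_mult_base add.commute right_diff_distrib)
  ultimately show ?thesis using assms by (simp add: pos_le_divide_eq mult_ac)
qed

lemma set_Hoelder:
  fixes u v :: "'a \<Rightarrow> real"
  assumes u: "set_integrable M A u" and v: "set_integrable M A v"
    and nonneg: "\<And>x. 0 \<le> u x" "\<And>x. 0 \<le> v x" and ab: "0 < a" "0 < b" "a + b = 1"
  shows "set_integrable M A (\<lambda>x. u x powr a * v x powr b)"
    and "(LINT x:A|M. u x powr a * v x powr b) \<le> (LINT x:A|M. u x) powr a * (LINT x:A|M. v x) powr b"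
proof -
  have e: "indicator A x *\<^sub>R (u x powr a * v x powr b)
      = (indicator A x *\<^sub>R u x) powr a * (indicator A x *\<^sub>R v x) powr b" for x
    by (simp add: indicator_def)
  note H = Hoelder_geometric_mean[OF u[unfolded set_integrable_def] v[unfolded set_integrable_def] _ _ ab]
  show "set_integrable M A (\<lambda>x. u x powr a * v x powr b)"
    unfolding set_integrable_def e by (rule H(1)) (use nonneg in auto)
  show "(LINT x:A|M. u x powr a * v x powr b) \<le> (LINT x:A|M. u x) powr a * (LINT x:A|M. v x) powr b"
    unfolding set_lebesgue_integral_def e by (rule H(2)) (use nonneg in auto)
qed

lemma average_Hoelder:
  fixes u v :: "real ^ 'n \<Rightarrow> real"
  assumes u: "set_integrable lebesgue A u" and v: "set_integrable lebesgue A v"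
    and nonneg: "\<And>x. 0 \<le> u x" "\<And>x. 0 \<le> v x" and ab: "0 < a" "0 < b" "a + b = 1"
    and A: "0 < measure lebesgue A"
  shows "average (\<lambda>x. u x powr a * v x powr b) A \<le> average u A powr a * average v A powr b"
proof -
  have n: "0 \<le> (LINT x:A|lebesgue. u x)" "0 \<le> (LINT x:A|lebesgue. v x)"
    unfolding set_lebesgue_integral_def using nonneg by (auto intro!: integral_nonneg_AE)
  have "measure lebesgue A powr a * measure lebesgue A powr b = measure lebesgue A"
    using A ab by (simp flip: powr_add)
  then have "average u A powr a * average v A powr b
      = (LINT x:A|lebesgue. u x) powr a * (LINT x:A|lebesgue. v x) powr b / measure lebesgue A"
    unfolding average_def using n A by (simp add: powr_divide)
  then show ?thesis
    unfolding average_def using set_Hoelder(2)[OF u v nonneg ab] A by (simp add: divide_right_mono)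
qed

lemma set_integrable_mult_bounded:
  fixes f g :: "'a \<Rightarrow> real"
  assumes "set_integrable M A f" "f \<in> borel_measurable M" "g \<in> borel_measurable M" "A \<in> sets M"
    and B: "\<And>x. x \<in> A \<Longrightarrow> \<bar>g x\<bar> \<le> B"
  shows "set_integrable M A (\<lambda>x. f x * g x)"
proof (rule set_integrable_bound)
  show "set_integrable M A (\<lambda>x. B * f x)" using assms by simp
  show "set_borel_measurable M A (\<lambda>x. f x * g x)" using assms by (auto simp: set_borel_measurable_def)
  show "AE x in M. x \<in> A \<longrightarrow> norm (f x * g x) \<le> norm (B * f x)"
  proof (rule AE_I2, rule impI)
    fix x assume x: "x \<in> A"
    then have "\<bar>g x\<bar> \<le> \<bar>B\<bar>" using B[OF x] by linarith
    then show "norm (f x * g x) \<le> norm (B * f x)"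
      using mult_left_mono[of "\<bar>g x\<bar>" "\<bar>B\<bar>" "\<bar>f x\<bar>"] by (simp add: abs_mult mult.commute)
  qed
qed

lemma set_integrable_bounded:
  fixes g :: "'a \<Rightarrow> real"
  assumes "A \<in> fmeasurable M" "g \<in> borel_measurable M" and B: "\<And>x. x \<in> A \<Longrightarrow> \<bar>g x\<bar> \<le> B"
  shows "set_integrable M A g"
proof -
  have "set_integrable M A (\<lambda>x. 1 * g x)"
    by (rule set_integrable_mult_bounded[OF _ _ _ _ B])
       (use assms in \<open>auto simp: set_integrable_def fmeasurable_def\<close>)
  then show ?thesis by simp
qed

lemma average_near:
  fixes g :: "real ^ 'n \<Rightarrow> real"
  assumes A: "A \<in> lmeasurable" "0 < measure lebesgue A" and g: "set_integrable lebesgue A g"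
    and near: "\<And>x. x \<in> A \<Longrightarrow> \<bar>g x - c\<bar> \<le> e"
  shows "\<bar>average g A - c\<bar> \<le> e"
proof -
  have const: "set_integrable lebesgue A (\<lambda>x. k :: real)" "(LINT x:A|lebesgue. k) = k * measure lebesgue A" for k
    using A by (auto simp: set_integrable_def set_lebesgue_integral_def fmeasurable_def)
  have "(LINT x:A|lebesgue. g x) \<le> (LINT x:A|lebesgue. c + e)"
    by (rule set_integral_mono[OF g const(1)]) (use near in force)
  moreover have "(LINT x:A|lebesgue. c - e) \<le> (LINT x:A|lebesgue. g x)"
    by (rule set_integral_mono[OF const(1) g]) (use near in force)
  ultimately have "average g A \<le> c + e" "c - e \<le> average g A"
    using A(2) by (simp_all only: const average_def pos_divide_le_eq pos_le_divide_eq)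
  then show ?thesis by linarith
qed

lemma geometric_sum_le:
  fixes \<theta> :: real
  assumes "0 \<le> \<theta>" "\<theta> < 1" "finite A"
  shows "(\<Sum>i\<in>A. \<theta> ^ i) \<le> 1 / (1 - \<theta>)"
proof -
  have "(\<Sum>i\<in>A. \<theta> ^ i) \<le> (\<Sum>i. \<theta> ^ i)"
    by (rule sum_le_suminf) (use assms in \<open>auto intro: summable_geometric\<close>)
  also have "\<dots> = 1 / (1 - \<theta>)" using assms by (intro suminf_geometric) auto
  finally show ?thesis .
qed

section \<open>Finite trees of cells\<close>

text \<open>
  \<open>X\<close> is the set of cells, that is, of cubes of the smallest scale, and
  \<open>C k x\<close> is the set of cells in the cube of generation \<open>k\<close> around the
  cell \<open>x\<close>. Generations count upwards from the cells, and \<open>D\<close> is the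
  number of children of a cube.
\<close>

locale dyadic_tree =
  fixes X :: "'a set" and C :: "nat \<Rightarrow> 'a \<Rightarrow> 'a set" and D :: nat
  assumes D_pos: "0 < D"
    and C_sub: "x \<in> X \<Longrightarrow> C k x \<subseteq> X"
    and C_self: "x \<in> X \<Longrightarrow> x \<in> C k x"
    and C_eq: "x \<in> X \<Longrightarrow> y \<in> C k x \<Longrightarrow> C k y = C k x"
    and C_Suc: "x \<in> X \<Longrightarrow> C k x \<subseteq> C (Suc k) x"
    and C_card: "x \<in> X \<Longrightarrow> card (C k x) = D ^ k"
begin

lemma C_finite: "x \<in> X \<Longrightarrow> finite (C k x)"
  using C_card[of x k] D_pos by (intro card_ge_0_finite) simp

lemma C_zero: "x \<in> X \<Longrightarrow> C 0 x = {x}"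
  using C_card[of x 0] C_self[of x 0] by (auto simp: card_Suc_eq)

lemma C_mono: "x \<in> X \<Longrightarrow> j \<le> k \<Longrightarrow> C j x \<subseteq> C k x"
  by (rule lift_Suc_mono_le[of "\<lambda>k. C k x"]) (auto dest: C_Suc)

lemma C_trans: "x \<in> X \<Longrightarrow> y \<in> C k x \<Longrightarrow> j \<le> k \<Longrightarrow> C j y \<subseteq> C k x"
  by (metis C_eq C_mono C_sub subsetD)

text \<open>
  The blocks \<open>C (l y) y\<close> are equal or disjoint because \<open>l\<close> is constant on
  each of them, so they partition \<open>S\<close>. Letting the generation vary with
  \<open>y\<close> makes this apply to the blocks selected by a stopping time.
\<close>

lemma sum_blocks_mono:
  fixes f g :: "'a \<Rightarrow> real"
  assumes fin: "finite S" and sub: "S \<subseteq> X"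
    and blk: "\<And>y. y \<in> S \<Longrightarrow> C (l y) y \<subseteq> S"
    and cst: "\<And>y z. y \<in> S \<Longrightarrow> z \<in> C (l y) y \<Longrightarrow> l z = l y"
    and le: "\<And>y. y \<in> S \<Longrightarrow> sum f (C (l y) y) \<le> sum g (C (l y) y)"
  shows "sum f S \<le> sum g S"
proof -
  let ?P = "(\<lambda>y. C (l y) y) ` S"
  have un: "\<Union>?P = S"
    using blk C_self sub by fastforce
  have disj: "A \<inter> B = {}" if "A \<in> ?P" "B \<in> ?P" "A \<noteq> B" for A B
  proof (rule ccontr)
    assume "A \<inter> B \<noteq> {}"
    then obtain z where z: "z \<in> A" "z \<in> B" by auto
    from that(1) obtain a where a: "a \<in> S" "A = C (l a) a" by auto
    from that(2) obtain b where b: "b \<in> S" "B = C (l b) b" by auto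
    have "l z = l a" by (rule cst[OF a(1)]) (use z a in simp)
    moreover have "l z = l b" by (rule cst[OF b(1)]) (use z b in simp)
    moreover have "C (l a) z = A" unfolding a(2) by (rule C_eq) (use a z sub in auto)
    moreover have "C (l b) z = B" unfolding b(2) by (rule C_eq) (use b z sub in auto)
    ultimately show False using that(3) by simp
  qed
  have fins: "\<forall>A\<in>?P. finite A" using C_finite sub by auto
  have s: "sum h S = (\<Sum>A\<in>?P. sum h A)" for h :: "'a \<Rightarrow> real"
    using sum.Union_disjoint[of ?P h] fins disj un by auto
  show ?thesis unfolding s by (rule sum_mono) (use le in auto)
qed

lemma sum_level_mono:
  fixes f g :: "'a \<Rightarrow> real"
  assumes "x \<in> X" "j \<le> k"
    and "\<And>y. y \<in> C k x \<Longrightarrow> sum f (C j y) \<le> sum g (C j y)"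
  shows "sum f (C k x) \<le> sum g (C k x)"
  by (rule sum_blocks_mono[where l="\<lambda>_. j"])
     (use assms C_finite C_sub C_trans in blast)+

lemma sum_level_eq:
  fixes f g :: "'a \<Rightarrow> real"
  assumes "x \<in> X" "j \<le> k"
    and "\<And>y. y \<in> C k x \<Longrightarrow> sum f (C j y) = sum g (C j y)"
  shows "sum f (C k x) = sum g (C k x)"
  by (intro antisym sum_level_mono[OF assms(1,2)]) (use assms(3) in auto)

definition avg :: "('a \<Rightarrow> real) \<Rightarrow> nat \<Rightarrow> 'a \<Rightarrow> real" where
  "avg g k x = sum g (C k x) / real D ^ k"

lemma D_pow_pos: "0 < real D ^ k" using D_pos by simp

lemma avg_zero: "x \<in> X \<Longrightarrow> avg g 0 x = g x"
  by (simp add: avg_def C_zero)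

lemma avg_cong_block: "x \<in> X \<Longrightarrow> y \<in> C k x \<Longrightarrow> avg g k y = avg g k x"
  unfolding avg_def by (metis C_eq)

lemma sum_eq_avg: "sum g (C k x) = real D ^ k * avg g k x"
  using D_pow_pos by (simp add: avg_def)

lemma avg_nonneg: "x \<in> X \<Longrightarrow> (\<And>y. y \<in> X \<Longrightarrow> 0 \<le> g y) \<Longrightarrow> 0 \<le> avg g k x"
  unfolding avg_def by (intro divide_nonneg_nonneg sum_nonneg) (use C_sub in auto)

lemma avg_mono: "x \<in> X \<Longrightarrow> (\<And>y. y \<in> X \<Longrightarrow> f y \<le> g y) \<Longrightarrow> avg f k x \<le> avg g k x"
  unfolding avg_def by (intro divide_right_mono sum_mono) (use C_sub in auto)

lemma avg_abs: "x \<in> X \<Longrightarrow> (\<And>y. y \<in> X \<Longrightarrow> \<bar>f y\<bar> \<le> g y) \<Longrightarrow> \<bar>avg f k x\<bar> \<le> avg g k x"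
  using avg_mono[of x f g k] avg_mono[of x "\<lambda>y. - f y" g k]
  by (force simp: avg_def sum_negf abs_le_iff)

text \<open>
  The tower property: \<open>avg g j\<close> is the conditional expectation of \<open>g\<close>
  given the generation \<open>j\<close>, and \<open>c\<close> is measurable for that generation.
\<close>

lemma sum_mult_avg:
  assumes "x \<in> X" "j \<le> k"
    and c: "\<And>y z. y \<in> X \<Longrightarrow> z \<in> C j y \<Longrightarrow> c z = c y"
  shows "(\<Sum>y\<in>C k x. c y * avg g j y) = (\<Sum>y\<in>C k x. c y * g y)"
proof (rule sum_level_eq[OF assms(1,2)])
  fix y assume "y \<in> C k x"
  then have y: "y \<in> X" using C_sub assms by blast
  have "(\<Sum>z\<in>C j y. c z * avg g j z) = (\<Sum>z\<in>C j y. c y * avg g j y)"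
    by (rule sum.cong) (use c y avg_cong_block in auto)
  also have "\<dots> = c y * sum g (C j y)"
    using D_pow_pos y by (simp add: C_card sum_eq_avg)
  also have "\<dots> = (\<Sum>z\<in>C j y. c z * g z)"
    unfolding sum_distrib_left by (rule sum.cong) (use c y in auto)
  finally show "(\<Sum>z\<in>C j y. c z * avg g j z) = (\<Sum>z\<in>C j y. c z * g z)" .
qed

lemma sum_avg: "x \<in> X \<Longrightarrow> j \<le> k \<Longrightarrow> (\<Sum>y\<in>C k x. avg g j y) = sum g (C k x)"
  using sum_mult_avg[of x j k "\<lambda>_. 1" g] by simp

lemma avg_le_parent:
  assumes "x \<in> X" and g: "\<And>y. y \<in> X \<Longrightarrow> 0 \<le> g y"
  shows "avg g k x \<le> real D * avg g (Suc k) x"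
proof -
  have "sum g (C k x) \<le> sum g (C (Suc k) x)"
    by (intro sum_mono2 C_finite C_Suc) (use assms C_sub in auto)
  then show ?thesis
    using D_pos D_pow_pos[of k] by (simp add: avg_def divide_simps mult_ac)
qed

lemma avg_square_le:
  assumes "x \<in> X"
  shows "(avg f k x)\<^sup>2 \<le> avg (\<lambda>y. (f y)\<^sup>2) k x"
proof -
  have "(sum f (C k x))\<^sup>2 \<le> real (card (C k x)) * (\<Sum>y\<in>C k x. (f y)\<^sup>2)"
    using Cauchy_Schwarz_ineq_sum[of "\<lambda>_. 1" f "C k x"] by simp
  then show ?thesis
    using D_pow_pos[of k] assms D_pos
    by (simp add: avg_def C_card divide_simps power2_eq_square mult_ac)
qed

text \<open>
  Induction on the generation: if the average over the whole block exceeds \<open>t\<close>, the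
  bound is Markov's inequality; otherwise the exceptional set splits over the blocks of the previous
  generation.
\<close>

lemma weak_type_maximal:
  assumes "x \<in> X" and g: "\<And>y. y \<in> X \<Longrightarrow> 0 \<le> g y" and "0 \<le> t"
  shows "t * card {y \<in> C k x. \<exists>j\<le>k. t < avg g j y} \<le> sum g (C k x)"
  using assms(1)
proof (induction k arbitrary: x)
  case 0
  have "{y \<in> C 0 x. \<exists>j\<le>0. t < avg g j y} = (if t < g x then {x} else {})"
    using 0 by (auto simp: C_zero avg_zero)
  then show ?case using g 0 by (simp add: C_zero)
next
  case (Suc k)
  have ind: "t * card {y \<in> A. P y} = (\<Sum>y\<in>A. if P y then t else 0)" if "finite A" for A P
    using that by (simp add: sum.If_cases Int_def mult.commute)
  show ?case
  proof (cases "t < avg g (Suc k) x")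
    case True
    have "t * card {y \<in> C (Suc k) x. \<exists>j\<le>Suc k. t < avg g j y} \<le> t * card (C (Suc k) x)"
      by (intro mult_left_mono of_nat_mono card_mono C_finite) (use assms Suc in auto)
    also have "\<dots> \<le> sum g (C (Suc k) x)"
      using True D_pow_pos[of "Suc k"] Suc.prems
      by (simp add: C_card sum_eq_avg mult.commute del: power_Suc)
    finally show ?thesis .
  next
    case False
    have eq: "(\<exists>j\<le>Suc k. t < avg g j y) \<longleftrightarrow> (\<exists>j\<le>k. t < avg g j y)" if "y \<in> C (Suc k) x" for y
      using False avg_cong_block[OF Suc.prems that, of g] by (auto simp: le_Suc_eq)
    have "t * card {y \<in> C (Suc k) x. \<exists>j\<le>Suc k. t < avg g j y}
        = (\<Sum>y\<in>C (Suc k) x. if \<exists>j\<le>k. t < avg g j y then t else 0)"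
      unfolding ind[OF C_finite[OF Suc.prems]] by (rule sum.cong) (use eq in auto)
    also have "\<dots> \<le> sum g (C (Suc k) x)"
    proof (rule sum_level_mono[OF Suc.prems, of k])
      fix y assume "y \<in> C (Suc k) x"
      then have y: "y \<in> X" using C_sub Suc.prems by blast
      show "(\<Sum>y\<in>C k y. if \<exists>j\<le>k. t < avg g j y then t else 0) \<le> sum g (C k y)"
        using Suc.IH[OF y] ind[OF C_finite[OF y], of k "\<lambda>y. \<exists>j\<le>k. t < avg g j y"] by simp
    qed simp
    finally show ?thesis .
  qed
qed


lemma sum_cancel:
  fixes \<psi> h :: "'a \<Rightarrow> real"
  assumes "x \<in> X" "j \<le> k"
    and osc: "\<And>y z. y \<in> C k x \<Longrightarrow> z \<in> C j y \<Longrightarrow> \<bar>\<psi> z - \<psi> y\<bar> \<le> \<epsilon>"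
    and zero: "\<And>y. y \<in> C k x \<Longrightarrow> sum h (C j y) = 0"
  shows "\<bar>\<Sum>y\<in>C k x. \<psi> y * h y\<bar> \<le> \<epsilon> * (\<Sum>y\<in>C k x. \<bar>h y\<bar>)"
proof -
  have key: "\<bar>\<Sum>z\<in>C j y. \<psi> z * h z\<bar> \<le> (\<Sum>z\<in>C j y. \<epsilon> * \<bar>h z\<bar>)" if y: "y \<in> C k x" for y
  proof -
    have "(\<Sum>z\<in>C j y. \<psi> z * h z) = (\<Sum>z\<in>C j y. (\<psi> z - \<psi> y) * h z)"
      using zero[OF y] by (simp add: left_diff_distrib sum_subtractf flip: sum_distrib_left)
    also have "\<bar>\<dots>\<bar> \<le> (\<Sum>z\<in>C j y. \<epsilon> * \<bar>h z\<bar>)"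
      by (rule order_trans[OF sum_abs sum_mono]) (use osc[OF y] in \<open>auto simp: abs_mult intro: mult_right_mono\<close>)
    finally show ?thesis .
  qed
  have "(\<Sum>y\<in>C k x. \<psi> y * h y) \<le> (\<Sum>y\<in>C k x. \<epsilon> * \<bar>h y\<bar>)"
    by (rule sum_level_mono[OF assms(1,2)]) (use key in fastforce)
  moreover have "(\<Sum>y\<in>C k x. - (\<psi> y * h y)) \<le> (\<Sum>y\<in>C k x. \<epsilon> * \<bar>h y\<bar>)"
    by (rule sum_level_mono[OF assms(1,2)]) (use key in \<open>fastforce simp: sum_negf\<close>)
  ultimately show ?thesis
    by (simp add: sum_negf abs_le_iff sum_distrib_left)
qed

text \<open>
  The discrete form of a Hoelder continuous bump of mean zero on a block: with each smaller
  generation the oscillation shrinks by the factor \<open>\<theta>\<close>. A Hoelder exponent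
  \<open>\<alpha>\<close> corresponds to \<open>\<theta> = 2^(-\<alpha>)\<close>.
\<close>

definition test_fun :: "real \<Rightarrow> nat \<Rightarrow> 'a \<Rightarrow> ('a \<Rightarrow> real) \<Rightarrow> bool" where
  "test_fun \<theta> k x \<psi> \<longleftrightarrow> sum \<psi> (C k x) = 0 \<and>
     (\<forall>j\<le>k. \<forall>y\<in>C k x. \<forall>z\<in>C j y. \<bar>\<psi> z - \<psi> y\<bar> \<le> \<theta> ^ (k - j) / real D ^ k)"

section \<open>Stopping times\<close>

text \<open>
  The predicate \<open>act j y\<close> says that the block of generation \<open>j\<close> around
  \<open>y\<close> has not been stopped; averages of \<open>G\<close> are at most
  \<open>\<Lambda>\<close> on such blocks. On a block, \<open>F\<close> minus its average is the sum
  of its martingale differences above the stopping blocks and of its remainders on the stopping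
  blocks. Each term has mean zero on the blocks of its own generation, so pairing it with a test
  function gains a power of \<open>\<theta>\<close> (\<open>sum_cancel\<close>), and the geometric
  series is summable. The differences are orthogonal, and the sum of their squares telescopes to at
  most the square of a function bounded by \<open>D \<Lambda>\<close>; the remainders have averages
  bounded by a multiple of \<open>D\<Lambda>\<close> and live on disjoint blocks.

  That \<open>a k y\<close> is at most a supremum of pairings is expressed through the upper bounds
  \<open>B\<close> of these pairings. The term with \<open>\<theta>^k\<close> accounts for the
  oscillation of the test function inside a single cell.
\<close>

lemma stopped_square_sum:
  fixes F G :: "'a \<Rightarrow> real" and a :: "nat \<Rightarrow> 'a \<Rightarrow> real" and \<theta> \<Lambda> :: real
  assumes x0: "x0 \<in> X" and \<theta>: "0 \<le> \<theta>" "\<theta> < 1"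
    and FG: "\<And>y. y \<in> X \<Longrightarrow> \<bar>F y\<bar> \<le> G y"
    and a0: "\<And>k y. 0 \<le> a k y"
    and a_le: "\<And>k y B. y \<in> X \<Longrightarrow> k \<le> k0 \<Longrightarrow>
        (\<And>\<psi>. test_fun \<theta> k y \<psi> \<Longrightarrow> \<bar>\<Sum>z\<in>C k y. \<psi> z * F z\<bar> + \<theta> ^ k * avg G k y \<le> B) \<Longrightarrow> a k y \<le> B"
    and act_block: "\<And>j y z. y \<in> X \<Longrightarrow> z \<in> C j y \<Longrightarrow> act j z = act j y"
    and act_up: "\<And>i j y. y \<in> X \<Longrightarrow> act j y \<Longrightarrow> j \<le> i \<Longrightarrow> i \<le> k0 \<Longrightarrow> act i y"
    and act_avg: "\<And>j y. y \<in> X \<Longrightarrow> act j y \<Longrightarrow> j \<le> k0 \<Longrightarrow> avg G j y \<le> \<Lambda>"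
    and act_top: "act k0 x0"
  shows "(\<Sum>y\<in>C k0 x0. \<Sum>k\<in>{k. k \<le> k0 \<and> act k y}. (a k y)\<^sup>2)
     \<le> 12 * (1 / (1 - \<theta>))\<^sup>2 * (real D)\<^sup>2 * \<Lambda>\<^sup>2 * real D ^ k0"
proof -
  let ?Q = "C k0 x0"
  define S where "S = 1 / (1 - \<theta>)"
  have S1: "1 \<le> S" using \<theta> by (simp add: S_def)
  have Q_X: "y \<in> X" if "y \<in> ?Q" for y using that C_sub x0 by blast
  have act_k0: "act k0 y" if "y \<in> ?Q" for y using act_block[OF x0 that] act_top by simp
  have G0: "0 \<le> G y" if "y \<in> X" for y using FG[OF that] by linarith
  have \<Lambda>0: "0 \<le> \<Lambda>"
    by (rule order_trans[OF avg_nonneg[where g=G and k=k0, OF x0 G0] act_avg[OF x0 act_top order_refl]])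
  have D1: "1 \<le> real D" using D_pos by simp
  (* l y is the generation of the stopping block around y, and l y = 0 if nothing above the cell of y
     is stopped. *)
  define l where "l y = (LEAST j. j = k0 \<or> act (Suc j) y)" for y
  have l_le: "l y \<le> k0" for y unfolding l_def by (rule Least_le) simp
  have l_prop: "l y = k0 \<or> act (Suc (l y)) y" for y
    unfolding l_def by (rule LeastI[of "\<lambda>j. j = k0 \<or> act (Suc j) y" k0]) simp
  have l_act: "l y < j \<longleftrightarrow> act j y" if "y \<in> X" "0 < j" "j \<le> k0" for y j
  proof
    assume "l y < j"
    then have "act (Suc (l y)) y" using l_prop[of y] that by linarith
    then show "act j y" by (rule act_up[OF that(1)]) (use \<open>l y < j\<close> that in linarith)+
  next
    assume "act j y"
    then have "l y \<le> j - 1" unfolding l_def by (intro Least_le) (use that in auto)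
    then show "l y < j" using that by linarith
  qed
  have l_lt_block: "l z < j \<longleftrightarrow> l y < j" if "y \<in> X" "z \<in> C j y" "j \<le> k0" for y z j
  proof (cases "j = 0")
    case False
    have "z \<in> X" using C_sub[OF that(1)] that(2) by (rule subsetD)
    then show ?thesis using l_act[of y j] l_act[of z j] act_block[OF that(1,2)] that(1,3) False by simp
  qed simp
  have l_le_block: "l z \<le> j \<longleftrightarrow> l y \<le> j" if "y \<in> X" "z \<in> C j y" "j \<le> k0" for y z j
  proof (cases "j = k0")
    case False
    then have "z \<in> C (Suc j) y" using C_Suc that by blast
    then show ?thesis using l_lt_block[where y=y and z=z and j="Suc j"] that False by (simp add: less_Suc_eq_le)
  qed (simp add: l_le)
  have l_eq_block: "l z = j \<longleftrightarrow> l y = j" if "y \<in> X" "z \<in> C j y" "j \<le> k0" for y z j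
    using l_lt_block[OF that] l_le_block[OF that] by linarith
  have avg_leaf: "avg G (l y) y \<le> real D * \<Lambda>" if y: "y \<in> X" "act k0 y" for y
  proof (cases "l y = k0")
    case True
    then have "avg G (l y) y \<le> \<Lambda>" using act_avg y by simp
    also have "\<dots> \<le> real D * \<Lambda>" using mult_right_mono[OF D1 \<Lambda>0] by simp
    finally show ?thesis .
  next
    case False
    then have "act (Suc (l y)) y" "Suc (l y) \<le> k0" using l_prop l_le[of y] by (auto simp: Suc_le_eq le_neq_trans)
    then have "avg G (Suc (l y)) y \<le> \<Lambda>" using act_avg y by auto
    then show ?thesis
      using avg_le_parent[where g=G and k="l y", OF y(1) G0] mult_left_mono[of "avg G (Suc (l y)) y" \<Lambda> "real D"] by simp
  qed
  (* h collects the martingale differences and the remainders. In e the absolute value of a remainder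
     is replaced by a bound for its average over the stopping block: its square need not be controlled. *)
  define h where "h j z = (if l z < j then avg F (j - 1) z - avg F j z
      else if l z = j then F z - avg F j z else 0)" for j z
  define e where "e j z = (if l z < j then \<bar>avg F (j - 1) z - avg F j z\<bar>
      else if l z = j then 2 * real D * \<Lambda> else 0)" for j z
  have h_zero: "sum (h j) (C j y) = 0" if y: "y \<in> X" "j \<le> k0" for y j
  proof -
    have c: "(\<Sum>z\<in>C j y. avg F j z) = sum F (C j y)" by (rule sum_avg) (use y in auto)
    consider "l y < j" | "l y = j" | "j < l y" by linarith
    then show ?thesis
    proof cases
      case 1
      have "sum (h j) (C j y) = (\<Sum>z\<in>C j y. avg F (j - 1) z - avg F j z)"
        by (rule sum.cong) (use 1 l_lt_block[OF y(1) _ y(2)] in \<open>simp_all add: h_def\<close>)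
      also have "\<dots> = 0" using sum_avg[of y "j - 1" j F] c y by (simp add: sum_subtractf)
      finally show ?thesis .
    next
      case 2
      have "sum (h j) (C j y) = (\<Sum>z\<in>C j y. F z - avg F j z)"
        by (rule sum.cong) (use 2 l_eq_block[OF y(1) _ y(2)] in \<open>simp_all add: h_def\<close>)
      also have "\<dots> = 0" using c by (simp add: sum_subtractf)
      finally show ?thesis .
    next
      case 3
      have "h j z = 0" if "z \<in> C j y" for z
        using l_le_block[where y=y and z=z and j=j] that 3 y by (auto simp: h_def)
      then show ?thesis by simp
    qed
  qed
  have h_sum: "(\<Sum>j\<le>k. h j z) = F z - avg F k z" if "l z \<le> k" for k z
    using that
  proof (induction k rule: dec_induct)
    case base
    have "(\<Sum>j\<le>l z. h j z) = (\<Sum>j\<in>{l z}. h j z)"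
      by (rule sum.mono_neutral_right) (auto simp: h_def)
    then show ?case by (simp add: h_def)
  next
    case (step k)
    then show ?case by (simp add: h_def)
  qed
  have h_e: "(\<Sum>z\<in>C k y. \<bar>h j z\<bar>) \<le> (\<Sum>z\<in>C k y. e j z)"
    if y: "y \<in> X" "act k y" "k \<le> k0" "j \<le> k" for k y j
  proof (rule sum_level_mono[OF y(1) y(4)])
    fix u assume u: "u \<in> C k y"
    then have uX: "u \<in> X" using C_sub y by blast
    have act: "act k0 u" using act_block[OF y(1) u] act_up[OF uX _ y(3)] y by auto
    have jk: "j \<le> k0" using y by simp
    show "(\<Sum>z\<in>C j u. \<bar>h j z\<bar>) \<le> (\<Sum>z\<in>C j u. e j z)"
    proof (cases "l u = j")
      case True
      have "(\<Sum>z\<in>C j u. \<bar>h j z\<bar>) \<le> (\<Sum>z\<in>C j u. G z + avg G j z)"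
      proof (rule sum_mono)
        fix z assume z: "z \<in> C j u"
        then have zX: "z \<in> X" using C_sub uX by blast
        have "l z = j" using l_eq_block[OF uX z jk] True by simp
        then show "\<bar>h j z\<bar> \<le> G z + avg G j z"
          using FG[OF zX] avg_abs[where f=F and g=G and k=j, OF zX FG] by (simp add: h_def)
      qed
      also have "\<dots> = 2 * sum G (C j u)" using sum_avg[of u j j G] uX by (simp add: sum.distrib)
      also have "\<dots> \<le> 2 * (real D ^ j * (real D * \<Lambda>))"
        using avg_leaf[OF uX act] D_pow_pos[of j] True by (simp add: sum_eq_avg)
      also have "\<dots> = (\<Sum>z\<in>C j u. 2 * real D * \<Lambda>)" using uX by (simp add: C_card)
      also have "\<dots> = (\<Sum>z\<in>C j u. e j z)"
        by (rule sum.cong) (use True l_eq_block[OF uX _ jk] in \<open>simp_all add: e_def\<close>)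
      finally show ?thesis .
    next
      case False
      show ?thesis
        by (rule sum_mono) (use False l_eq_block[OF uX _ jk] in \<open>simp add: h_def e_def\<close>)
    qed
  qed
  have a_bound: "a k y \<le> (\<Sum>j\<le>k. \<theta> ^ (k - j) * avg (e j) k y) + \<theta> ^ k * \<Lambda>"
    if y: "y \<in> X" "act k y" "k \<le> k0" for k y
  proof (rule a_le[OF y(1,3)])
    fix \<psi> assume t: "test_fun \<theta> k y \<psi>"
    have lz: "l z \<le> k" if "z \<in> C k y" for z
    proof (cases "k = k0")
      case False
      have zX: "z \<in> X" using C_sub y that by blast
      have "act (Suc k) z" using act_block[OF y(1) that] act_up[OF zX, of k "Suc k"] y False by auto
      then show ?thesis using l_act[OF zX, of "Suc k"] y False by auto
    qed (simp add: l_le)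
    have "(\<Sum>z\<in>C k y. \<psi> z * F z) = (\<Sum>z\<in>C k y. \<psi> z * (F z - avg F k z))"
    proof -
      have "(\<Sum>z\<in>C k y. \<psi> z * avg F k z) = (\<Sum>z\<in>C k y. \<psi> z * avg F k y)"
        by (rule sum.cong) (use avg_cong_block y in auto)
      also have "\<dots> = 0" using t by (simp add: test_fun_def flip: sum_distrib_right)
      finally show ?thesis by (simp add: right_diff_distrib sum_subtractf)
    qed
    also have "\<dots> = (\<Sum>z\<in>C k y. \<Sum>j\<le>k. \<psi> z * h j z)"
      by (rule sum.cong) (use h_sum lz in \<open>auto simp flip: sum_distrib_left\<close>)
    also have "\<dots> = (\<Sum>j\<le>k. \<Sum>z\<in>C k y. \<psi> z * h j z)" by (rule sum.swap)
    also have "\<bar>\<dots>\<bar> \<le> (\<Sum>j\<le>k. \<theta> ^ (k - j) * avg (e j) k y)"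
    proof (rule order_trans[OF sum_abs sum_mono])
      fix j assume "j \<in> {..k}"
      then have j: "j \<le> k" by simp
      have "\<bar>\<Sum>z\<in>C k y. \<psi> z * h j z\<bar> \<le> \<theta> ^ (k - j) / real D ^ k * (\<Sum>z\<in>C k y. \<bar>h j z\<bar>)"
      proof (rule sum_cancel[OF y(1) j])
        fix u assume "u \<in> C k y"
        then have "u \<in> X" using C_sub[OF y(1)] by blast
        then show "sum (h j) (C j u) = 0" by (rule h_zero) (use j y in simp)
      qed (use t j in \<open>simp add: test_fun_def\<close>)
      also have "\<dots> \<le> \<theta> ^ (k - j) / real D ^ k * (\<Sum>z\<in>C k y. e j z)"
        by (rule mult_left_mono[OF h_e]) (use y j \<theta> in auto)
      finally show "\<bar>\<Sum>z\<in>C k y. \<psi> z * h j z\<bar> \<le> \<theta> ^ (k - j) * avg (e j) k y"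
        by (simp add: avg_def)
    qed
    finally show "\<bar>\<Sum>z\<in>C k y. \<psi> z * F z\<bar> + \<theta> ^ k * avg G k y
        \<le> (\<Sum>j\<le>k. \<theta> ^ (k - j) * avg (e j) k y) + \<theta> ^ k * \<Lambda>"
      using act_avg[OF y] \<theta> by (intro add_mono mult_left_mono) auto
  qed
  have geo: "(\<Sum>j\<le>k. \<theta> ^ (k - j)) \<le> S" for k
    using geometric_sum_le[OF \<theta>, of "{..k}"] sum.nat_diff_reindex[of "\<lambda>i. \<theta> ^ i" "Suc k"]
    by (simp add: S_def lessThan_Suc_atMost)
  have geo': "(\<Sum>k\<in>{j..k0}. \<theta> ^ (k - j)) \<le> S" for j
  proof -
    have "(\<Sum>k\<in>{j..k0}. \<theta> ^ (k - j)) = (\<Sum>i\<in>(\<lambda>k. k - j) ` {j..k0}. \<theta> ^ i)"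
      by (subst sum.reindex) (auto simp: inj_on_def)
    also have "\<dots> \<le> S" unfolding S_def by (rule geometric_sum_le[OF \<theta>]) simp
    finally show ?thesis .
  qed
  have a_sq: "(a k y)\<^sup>2 \<le> 2 * (S * (\<Sum>j\<le>k. \<theta> ^ (k - j) * avg (\<lambda>z. (e j z)\<^sup>2) k y)) + 2 * (\<theta> ^ k * \<Lambda>\<^sup>2)"
    if y: "y \<in> X" "act k y" "k \<le> k0" for k y
  proof -
    let ?s = "\<Sum>j\<le>k. \<theta> ^ (k - j) * avg (e j) k y"
    have e0: "0 \<le> e j z" for j z using \<Lambda>0 by (simp add: e_def)
    have s0: "0 \<le> ?s" using \<theta> e0 by (intro sum_nonneg mult_nonneg_nonneg avg_nonneg y) auto
    have "(a k y)\<^sup>2 \<le> (?s + \<theta> ^ k * \<Lambda>)\<^sup>2"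
      by (rule power_mono[OF a_bound[OF y] a0])
    also have "\<dots> \<le> 2 * ?s\<^sup>2 + 2 * (\<theta> ^ k * \<Lambda>)\<^sup>2"
      using sum_squares_bound[of ?s "\<theta> ^ k * \<Lambda>"] by (simp add: power2_sum)
    also have "?s\<^sup>2 \<le> S * (\<Sum>j\<le>k. \<theta> ^ (k - j) * avg (\<lambda>z. (e j z)\<^sup>2) k y)"
    proof -
      have "?s\<^sup>2 = (\<Sum>j\<le>k. sqrt (\<theta> ^ (k - j)) * (sqrt (\<theta> ^ (k - j)) * avg (e j) k y))\<^sup>2"
        using \<theta> by (simp add: mult.assoc[symmetric])
      also have "\<dots> \<le> (\<Sum>j\<le>k. \<theta> ^ (k - j)) * (\<Sum>j\<le>k. \<theta> ^ (k - j) * (avg (e j) k y)\<^sup>2)"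
        using Cauchy_Schwarz_ineq_sum[of "\<lambda>j. sqrt (\<theta> ^ (k - j))" "\<lambda>j. sqrt (\<theta> ^ (k - j)) * avg (e j) k y" "{..k}"] \<theta>
        by (simp add: power_mult_distrib)
      also have "\<dots> \<le> S * (\<Sum>j\<le>k. \<theta> ^ (k - j) * avg (\<lambda>z. (e j z)\<^sup>2) k y)"
        using \<theta> S1 by (intro mult_mono geo sum_mono mult_left_mono avg_square_le y sum_nonneg) auto
      finally show ?thesis .
    qed
    also have "(\<theta> ^ k * \<Lambda>)\<^sup>2 \<le> \<theta> ^ k * \<Lambda>\<^sup>2"
    proof -
      have "\<theta> ^ k \<le> 1" using \<theta> by (simp add: power_le_one)
      then have "\<theta> ^ k * \<theta> ^ k \<le> \<theta> ^ k * 1" using \<theta> by (intro mult_left_mono) auto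
      then have "(\<theta> ^ k)\<^sup>2 * \<Lambda>\<^sup>2 \<le> \<theta> ^ k * \<Lambda>\<^sup>2"
        by (intro mult_right_mono) (auto simp: power2_eq_square)
      then show ?thesis by (simp add: power_mult_distrib)
    qed
    finally show ?thesis by simp
  qed
  have e_tot: "(\<Sum>y\<in>?Q. \<Sum>j\<le>k0. (e j y)\<^sup>2) \<le> 5 * (real D)\<^sup>2 * \<Lambda>\<^sup>2 * real D ^ k0"
  proof -
    define d where "d j z = (if l z < j then (avg F (j - 1) z)\<^sup>2 - (avg F j z)\<^sup>2 else 0)" for j z
    have orth: "(\<Sum>y\<in>?Q. if l y < j then (e j y)\<^sup>2 else 0) = (\<Sum>y\<in>?Q. d j y)" if j: "j \<le> k0" for j
    proof (rule sum_level_eq[OF x0 j])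
      fix u assume "u \<in> ?Q"
      then have u: "u \<in> X" by (rule Q_X)
      show "(\<Sum>y\<in>C j u. if l y < j then (e j y)\<^sup>2 else 0) = (\<Sum>y\<in>C j u. d j y)"
      proof (cases "l u < j")
        case True
        have lz: "l z < j" "avg F j z = avg F j u" if "z \<in> C j u" for z
          using l_lt_block[OF u that j] True avg_cong_block[OF u that] by auto
        have c: "(\<Sum>z\<in>C j u. avg F (j - 1) z) = (\<Sum>z\<in>C j u. avg F j u)"
          using sum_avg[OF u, of "j - 1" j F] u by (simp add: C_card sum_eq_avg)
        have "(\<Sum>y\<in>C j u. if l y < j then (e j y)\<^sup>2 else 0)
            = (\<Sum>z\<in>C j u. (avg F (j - 1) z - avg F j u)\<^sup>2)"
          by (rule sum.cong) (use lz in \<open>auto simp: e_def\<close>)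
        also have "\<dots> = (\<Sum>z\<in>C j u. (avg F (j - 1) z)\<^sup>2) + (\<Sum>z\<in>C j u. (avg F j u)\<^sup>2)
             - 2 * avg F j u * (\<Sum>z\<in>C j u. avg F (j - 1) z)"
          by (simp add: power2_diff sum.distrib sum_subtractf sum_distrib_left mult_ac)
        also have "\<dots> = (\<Sum>z\<in>C j u. (avg F (j - 1) z)\<^sup>2 - (avg F j u)\<^sup>2)"
          unfolding c by (simp add: sum_subtractf power2_eq_square)
        also have "\<dots> = (\<Sum>y\<in>C j u. d j y)"
          by (rule sum.cong) (use lz in \<open>auto simp: d_def\<close>)
        finally show ?thesis .
      next
        case False
        then have "\<not> l z < j" if "z \<in> C j u" for z using l_lt_block[OF u that j] by simp
        then show ?thesis by (simp add: d_def)
      qed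
    qed
    have tel: "(\<Sum>j\<le>k. d j z) = (avg F (l z) z)\<^sup>2 - (avg F k z)\<^sup>2" if "l z \<le> k" for k z
      using that
    proof (induction k rule: dec_induct)
      case base
      then show ?case by (simp add: d_def)
    next
      case (step k)
      then show ?case by (simp add: d_def)
    qed
    have "(\<Sum>y\<in>?Q. \<Sum>j\<le>k0. (e j y)\<^sup>2)
        = (\<Sum>y\<in>?Q. (\<Sum>j\<le>k0. if l y < j then (e j y)\<^sup>2 else 0) + (\<Sum>j\<le>k0. if l y = j then (2 * real D * \<Lambda>)\<^sup>2 else 0))"
      unfolding sum.distrib[symmetric] by (intro sum.cong) (auto simp: e_def)
    also have "\<dots> = (\<Sum>j\<le>k0. \<Sum>y\<in>?Q. if l y < j then (e j y)\<^sup>2 else 0) + (\<Sum>y\<in>?Q. (2 * real D * \<Lambda>)\<^sup>2)"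
      unfolding sum.distrib
      by (intro arg_cong2[of _ _ _ _ "(+)"] sum.swap sum.cong refl) (use l_le in simp)
    also have "(\<Sum>j\<le>k0. \<Sum>y\<in>?Q. if l y < j then (e j y)\<^sup>2 else 0) = (\<Sum>y\<in>?Q. \<Sum>j\<le>k0. d j y)"
      by (rule trans[OF sum.cong[OF refl orth] sum.swap]) simp
    also have "\<dots> \<le> (\<Sum>y\<in>?Q. (real D * \<Lambda>)\<^sup>2)"
    proof (rule sum_mono)
      fix y assume y: "y \<in> ?Q"
      have "\<bar>avg F (l y) y\<bar> \<le> real D * \<Lambda>"
        using avg_abs[where f=F and g=G and k="l y", OF Q_X[OF y] FG] avg_leaf[OF Q_X[OF y] act_k0[OF y]] by linarith
      then have "(avg F (l y) y)\<^sup>2 \<le> (real D * \<Lambda>)\<^sup>2" by (metis abs_ge_zero power2_abs power_mono)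
      then show "(\<Sum>j\<le>k0. d j y) \<le> (real D * \<Lambda>)\<^sup>2" using tel[OF l_le, of y] by (smt (verit) zero_le_power2)
    qed
    finally show ?thesis using x0 by (simp add: C_card power_mult_distrib algebra_simps)
  qed
  have lev: "(\<Sum>y\<in>?Q. avg (\<lambda>z. (e j z)\<^sup>2) k y) = (\<Sum>y\<in>?Q. (e j y)\<^sup>2)" if "k \<le> k0" for j k
    by (rule sum_avg[OF x0 that])
  have "(\<Sum>k\<le>k0. \<Sum>j\<le>k. \<theta> ^ (k - j) * (\<Sum>y\<in>?Q. avg (\<lambda>z. (e j z)\<^sup>2) k y))
      = (\<Sum>k\<le>k0. \<Sum>j\<le>k. \<theta> ^ (k - j) * (\<Sum>y\<in>?Q. (e j y)\<^sup>2))"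
    using lev by simp
  also have "\<dots> = (\<Sum>j\<le>k0. \<Sum>k\<in>{j..k0}. \<theta> ^ (k - j) * (\<Sum>y\<in>?Q. (e j y)\<^sup>2))"
    unfolding sum.Sigma[OF finite_atMost ballI[OF finite_atMost]] sum.Sigma[OF finite_atMost ballI[OF finite_atLeastAtMost]]
    by (rule sum.reindex_bij_witness[of _ "\<lambda>(j, k). (k, j)" "\<lambda>(j, k). (k, j)"]) auto
  also have "\<dots> \<le> (\<Sum>j\<le>k0. S * (\<Sum>y\<in>?Q. (e j y)\<^sup>2))"
    unfolding sum_distrib_right[symmetric]
    by (intro sum_mono mult_right_mono geo' sum_nonneg) auto
  also have "\<dots> = S * (\<Sum>y\<in>?Q. \<Sum>j\<le>k0. (e j y)\<^sup>2)"
    unfolding sum_distrib_left[symmetric] by (rule arg_cong[of _ _ "(*) S"], rule sum.swap)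
  also have "\<dots> \<le> S * (5 * (real D)\<^sup>2 * \<Lambda>\<^sup>2 * real D ^ k0)"
    using S1 e_tot by (intro mult_left_mono) auto
  finally have diff: "(\<Sum>k\<le>k0. \<Sum>j\<le>k. \<theta> ^ (k - j) * (\<Sum>y\<in>?Q. avg (\<lambda>z. (e j z)\<^sup>2) k y))
      \<le> S * (5 * (real D)\<^sup>2 * \<Lambda>\<^sup>2 * real D ^ k0)" .
  have top: "(\<Sum>k\<le>k0. \<theta> ^ k) \<le> S\<^sup>2 * (real D)\<^sup>2"
  proof -
    have "(\<Sum>k\<le>k0. \<theta> ^ k) \<le> S" unfolding S_def by (rule geometric_sum_le[OF \<theta>]) simp
    also have "\<dots> \<le> S * (S * (real D)\<^sup>2)"
    proof -
      have "1 * 1 \<le> S * (real D)\<^sup>2" using S1 D1 by (intro mult_mono) auto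
      then show ?thesis using S1 mult_left_mono[of 1 "S * (real D)\<^sup>2" S] by simp
    qed
    finally show ?thesis by (simp add: power2_eq_square mult_ac)
  qed
  have "(\<Sum>y\<in>?Q. \<Sum>k\<in>{k. k \<le> k0 \<and> act k y}. (a k y)\<^sup>2)
     \<le> (\<Sum>y\<in>?Q. \<Sum>k\<le>k0. 2 * (S * (\<Sum>j\<le>k. \<theta> ^ (k - j) * avg (\<lambda>z. (e j z)\<^sup>2) k y)) + 2 * (\<theta> ^ k * \<Lambda>\<^sup>2))"
    (is "_ \<le> (\<Sum>y\<in>?Q. \<Sum>k\<le>k0. ?R k y)")
  proof (rule sum_mono)
    fix y assume y: "y \<in> ?Q"
    have R0: "0 \<le> ?R k y" for k
      using S1 \<theta> by (intro add_nonneg_nonneg mult_nonneg_nonneg sum_nonneg avg_nonneg Q_X[OF y]) auto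
    have "(\<Sum>k\<in>{k. k \<le> k0 \<and> act k y}. (a k y)\<^sup>2) \<le> (\<Sum>k\<in>{k. k \<le> k0 \<and> act k y}. ?R k y)"
      by (rule sum_mono) (use a_sq Q_X[OF y] in auto)
    also have "\<dots> \<le> (\<Sum>k\<le>k0. ?R k y)"
      by (rule sum_mono2) (use R0 in auto)
    finally show "(\<Sum>k\<in>{k. k \<le> k0 \<and> act k y}. (a k y)\<^sup>2) \<le> (\<Sum>k\<le>k0. ?R k y)" .
  qed
  also have "\<dots> = 2 * S * (\<Sum>k\<le>k0. \<Sum>j\<le>k. \<theta> ^ (k - j) * (\<Sum>y\<in>?Q. avg (\<lambda>z. (e j z)\<^sup>2) k y))
      + real D ^ k0 * 2 * \<Lambda>\<^sup>2 * (\<Sum>k\<le>k0. \<theta> ^ k)"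
  proof -
    have "(\<Sum>y\<in>?Q. \<Sum>k\<le>k0. \<Sum>j\<le>k. \<theta> ^ (k - j) * avg (\<lambda>z. (e j z)\<^sup>2) k y)
        = (\<Sum>k\<le>k0. \<Sum>j\<le>k. \<theta> ^ (k - j) * (\<Sum>y\<in>?Q. avg (\<lambda>z. (e j z)\<^sup>2) k y))"
      unfolding sum_distrib_left
      by (subst sum.swap, rule sum.cong[OF refl], rule sum.swap)
    then show ?thesis
      using x0 by (simp add: sum.distrib C_card flip: sum_distrib_left sum_distrib_right)
  qed
  also have "\<dots> \<le> 2 * S * (S * (5 * (real D)\<^sup>2 * \<Lambda>\<^sup>2 * real D ^ k0))
      + real D ^ k0 * 2 * \<Lambda>\<^sup>2 * (S\<^sup>2 * (real D)\<^sup>2)"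
    using S1 by (intro add_mono mult_left_mono diff top) auto
  finally show ?thesis
    unfolding S_def[symmetric] by (simp add: power2_eq_square algebra_simps)
qed


text \<open>
  With the threshold four times the average, two functions together leave at least half of a block
  below both thresholds.
\<close>

lemma weak_type_four:
  assumes "x \<in> X" and g: "\<And>y. y \<in> X \<Longrightarrow> 0 \<le> g y"
  shows "4 * card {y \<in> C k x. \<exists>j\<le>k. 4 * avg g k x < avg g j y} \<le> card (C k x)"
proof -
  define B where "B = {y \<in> C k x. \<exists>j\<le>k. 4 * avg g k x < avg g j y}"
  have a0: "0 \<le> avg g k x" by (rule avg_nonneg) (use assms in auto)
  have w: "4 * avg g k x * card B \<le> avg g k x * real (card (C k x))"
    using weak_type_maximal[of x g "4 * avg g k x" k] assms a0
    by (simp add: B_def sum_eq_avg C_card mult_ac)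
  show ?thesis
  proof (cases "avg g k x = 0")
    case True
    then have "sum g (C k x) = 0" using D_pow_pos by (simp add: sum_eq_avg)
    then have z: "g y = 0" if "y \<in> C k x" for y
      using sum_nonneg_eq_0_iff[of "C k x" g] C_finite C_sub assms that by (metis subsetD)
    have "avg g j y = 0" if "y \<in> C k x" "j \<le> k" for j y
      unfolding avg_def using z C_trans[OF assms(1) that] by (simp add: subset_eq)
    then have "B = {}" using True by (auto simp: B_def)
    then show ?thesis unfolding B_def[symmetric] by simp
  next
    case False
    then have "4 * real (card B) \<le> real (card (C k x))" using w a0 by (simp add: mult.assoc mult_le_cancel_left)
    then show ?thesis unfolding B_def by linarith
  qed
qed

text \<open>
  Strong induction on the generation of the block \<open>Q\<close>. Call a block inside
  \<open>Q\<close> active if neither it nor a larger block inside \<open>Q\<close> has an average of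
  \<open>G\<close> or of \<open>\<Phi>\<close> above four times that over \<open>Q\<close>. On
  active blocks \<open>\<Phi>\<close> may be replaced by its average over \<open>Q\<close>, so they
  are bounded by \<open>stopped_square_sum\<close>, and the result is paid for by \<open>H\<close>
  on the set \<open>E\<close> of cells whose blocks are all active; \<open>E\<close> is at least
  half of \<open>Q\<close>. The inactive blocks lie in the maximal ones among them, which partition
  the complement of \<open>E\<close>, and the induction hypothesis applies to each of these.
\<close>

lemma stopping_time_bound:
  fixes F G \<Phi> H :: "'a \<Rightarrow> real" and a :: "nat \<Rightarrow> 'a \<Rightarrow> real" and \<theta> :: real
  assumes x0: "x0 \<in> X" and \<theta>: "0 \<le> \<theta>" "\<theta> < 1"
    and FG: "\<And>y. y \<in> X \<Longrightarrow> \<bar>F y\<bar> \<le> G y" and \<Phi>0: "\<And>y. y \<in> X \<Longrightarrow> 0 \<le> \<Phi> y"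
    and a0: "\<And>k y. 0 \<le> a k y"
    and a_block: "\<And>k y z. y \<in> X \<Longrightarrow> z \<in> C k y \<Longrightarrow> a k z = a k y"
    and a_le: "\<And>k y B. y \<in> X \<Longrightarrow> k \<le> N \<Longrightarrow>
        (\<And>\<psi>. test_fun \<theta> k y \<psi> \<Longrightarrow> \<bar>\<Sum>z\<in>C k y. \<psi> z * F z\<bar> + \<theta> ^ k * avg G k y \<le> B) \<Longrightarrow> a k y \<le> B"
    and H_le: "\<And>k x E. x \<in> X \<Longrightarrow> k \<le> N \<Longrightarrow> E \<subseteq> C k x \<Longrightarrow> card (C k x) \<le> 2 * card E \<Longrightarrow>
        (avg G k x)\<^sup>2 * avg \<Phi> k x * real D ^ k \<le> sum H E"
    and k0: "k0 \<le> N"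
  shows "(\<Sum>y\<in>C k0 x0. \<Phi> y * (\<Sum>k\<le>k0. (a k y)\<^sup>2))
     \<le> 768 * (1 / (1 - \<theta>))\<^sup>2 * (real D)\<^sup>2 * sum H (C k0 x0)"
  using k0 x0
proof (induction k0 arbitrary: x0 rule: less_induct)
  case (less k0 x0)
  note x0 = less.prems(2)
  let ?Q = "C k0 x0"
  let ?K = "768 * (1 / (1 - \<theta>))\<^sup>2 * (real D)\<^sup>2"
  define lam mu where "lam = avg G k0 x0" and "mu = avg \<Phi> k0 x0"
  have G0: "0 \<le> G y" if "y \<in> X" for y using FG[OF that] by linarith
  have l0: "0 \<le> lam" "0 \<le> mu" unfolding lam_def mu_def using avg_nonneg x0 G0 \<Phi>0 by auto
  have Q_X: "y \<in> X" if "y \<in> ?Q" for y using that C_sub x0 by blast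
  define act where "act j y \<longleftrightarrow> (\<forall>i. j \<le> i \<and> i \<le> k0 \<longrightarrow> avg G i y \<le> 4 * lam \<and> avg \<Phi> i y \<le> 4 * mu)" for j y
  have act_block: "act j z = act j y" if "y \<in> X" "z \<in> C j y" for j y z
  proof -
    have "avg g i z = avg g i y" if "j \<le> i" for g i
      using avg_cong_block C_mono \<open>y \<in> X\<close> \<open>z \<in> C j y\<close> that by blast
    then show ?thesis by (auto simp: act_def)
  qed
  have act_up: "act i y" if "act j y" "j \<le> i" for i j y using that by (auto simp: act_def)
  have act_top: "act k0 x0" using l0 by (auto simp: act_def lam_def mu_def)
  have act_k0: "act k0 y" if "y \<in> ?Q" for y using act_block[OF x0 that] act_top by simp
  (* E is the set of cells that lie in no stopped block. *)
  define E where "E = {y \<in> ?Q. act 0 y}"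
  have E_half: "card ?Q \<le> 2 * card E"
  proof -
    let ?B = "\<lambda>g. {y \<in> ?Q. \<exists>j\<le>k0. 4 * avg g k0 x0 < avg g j y}"
    have "?Q - E \<subseteq> ?B G \<union> ?B \<Phi>" by (auto simp: E_def act_def lam_def mu_def not_le)
    then have "card (?Q - E) \<le> card (?B G \<union> ?B \<Phi>)"
      by (rule card_mono[rotated]) (use C_finite x0 in auto)
    also have "\<dots> \<le> card (?B G) + card (?B \<Phi>)" by (rule card_Un_le)
    finally have "2 * card (?Q - E) \<le> card ?Q"
      using weak_type_four[where g=G and k=k0, OF x0 G0] weak_type_four[where g=\<Phi> and k=k0, OF x0 \<Phi>0]
      by linarith
    moreover have "card (?Q - E) = card ?Q - card E" "card E \<le> card ?Q"
      using C_finite[OF x0] by (auto simp: E_def intro: card_Diff_subset card_mono)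
    ultimately show ?thesis by linarith
  qed
  let ?A = "\<lambda>y. {k. k \<le> k0 \<and> act k y}" and ?I = "\<lambda>y. {k. k \<le> k0 \<and> \<not> act k y}"
  have split: "(\<Sum>y\<in>?Q. \<Phi> y * (\<Sum>k\<le>k0. (a k y)\<^sup>2))
     = (\<Sum>y\<in>?Q. \<Phi> y * (\<Sum>k\<in>?A y. (a k y)\<^sup>2)) + (\<Sum>y\<in>?Q. \<Phi> y * (\<Sum>k\<in>?I y. (a k y)\<^sup>2))"
    unfolding sum.distrib[symmetric] distrib_left[symmetric]
  proof (intro sum.cong refl arg_cong2[of _ _ _ _ "(*)"])
    fix y
    have "{..k0} = ?A y \<union> ?I y" by auto
    then show "(\<Sum>k\<le>k0. (a k y)\<^sup>2) = (\<Sum>k\<in>?A y. (a k y)\<^sup>2) + (\<Sum>k\<in>?I y. (a k y)\<^sup>2)"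
      by (simp only:, intro sum.union_disjoint) auto
  qed
  have "(\<Sum>y\<in>?Q. \<Phi> y * (\<Sum>k\<in>?A y. (a k y)\<^sup>2)) = (\<Sum>k\<le>k0. \<Sum>y\<in>?Q. (if act k y then (a k y)\<^sup>2 else 0) * \<Phi> y)"
  proof -
    have "(\<Sum>k\<in>?A y. (a k y)\<^sup>2) = (\<Sum>k\<le>k0. if act k y then (a k y)\<^sup>2 else 0)" for y
      by (simp add: sum.If_cases Int_def)
    then show ?thesis
      by (subst sum.swap) (simp add: sum_distrib_left mult.commute)
  qed
  also have "\<dots> = (\<Sum>k\<le>k0. \<Sum>y\<in>?Q. (if act k y then (a k y)\<^sup>2 else 0) * avg \<Phi> k y)"
    by (rule sum.cong[OF refl], rule sum_mult_avg[OF x0, symmetric]) (use act_block a_block in auto)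
  also have "\<dots> \<le> (\<Sum>k\<le>k0. \<Sum>y\<in>?Q. (if act k y then (a k y)\<^sup>2 else 0) * (4 * mu))"
    by (intro sum_mono) (auto simp: act_def intro: mult_left_mono)
  also have "\<dots> = 4 * mu * (\<Sum>y\<in>?Q. \<Sum>k\<in>?A y. (a k y)\<^sup>2)"
  proof -
    have "(\<Sum>k\<in>?A y. (a k y)\<^sup>2) = (\<Sum>k\<le>k0. if act k y then (a k y)\<^sup>2 else 0)" for y
      by (simp add: sum.If_cases Int_def)
    then show ?thesis
      by (subst sum.swap) (simp add: sum_distrib_left mult.commute)
  qed
  also have "\<dots> \<le> 4 * mu * (12 * (1 / (1 - \<theta>))\<^sup>2 * (real D)\<^sup>2 * (4 * lam)\<^sup>2 * real D ^ k0)"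
  proof (rule mult_left_mono[OF stopped_square_sum[OF x0 \<theta> FG a0]])
    show "a k y \<le> B" if "y \<in> X" "k \<le> k0"
      "\<And>\<psi>. test_fun \<theta> k y \<psi> \<Longrightarrow> \<bar>\<Sum>z\<in>C k y. \<psi> z * F z\<bar> + \<theta> ^ k * avg G k y \<le> B" for k y B
      by (rule a_le) (use that less.prems in auto)
    show "avg G j y \<le> 4 * lam" if "y \<in> X" "act j y" "j \<le> k0" for j y using that by (simp add: act_def)
  qed (use act_block act_up act_top l0 in auto)
  also have "\<dots> = ?K * (lam\<^sup>2 * mu * real D ^ k0)" by (simp add: power_mult_distrib)
  also have "\<dots> \<le> ?K * sum H E"
    unfolding lam_def mu_def by (intro mult_left_mono H_le x0 E_half less.prems) (auto simp: E_def)
  finally have active: "(\<Sum>y\<in>?Q. \<Phi> y * (\<Sum>k\<in>?A y. (a k y)\<^sup>2)) \<le> ?K * sum H E" .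
  (* tau y is the generation of the largest inactive block around y. *)
  define \<tau> where "\<tau> y = Max (?I y)" for y
  have \<tau>: "?I y = {..\<tau> y}" "\<tau> y < k0" if y: "y \<in> ?Q - E" for y
  proof -
    have ne: "?I y \<noteq> {}" "finite (?I y)" using y by (auto simp: E_def)
    then have m: "\<tau> y \<in> ?I y" unfolding \<tau>_def by (rule Max_in[rotated])
    show "?I y = {..\<tau> y}"
    proof (intro equalityI subsetI)
      show "k \<in> {..\<tau> y}" if "k \<in> ?I y" for k using Max_ge[OF ne(2) that] by (simp add: \<tau>_def)
      show "k \<in> ?I y" if "k \<in> {..\<tau> y}" for k using m that act_up[of k y "\<tau> y"] by auto
    qed
    show "\<tau> y < k0" using m act_k0[of y] y by (auto simp: le_less)
  qed
  have I_E: "?I y = {}" if "y \<in> E" for y using that act_up[of 0 y] by (auto simp: E_def)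
  have blk: "?I z = {..\<tau> y}" "z \<in> ?Q - E" if y: "y \<in> ?Q - E" and z: "z \<in> C (\<tau> y) y" for y z
  proof -
    have yX: "y \<in> X" using y Q_X by auto
    have same: "act j z = act j y" if "\<tau> y \<le> j" for j
      using act_block[OF yX] C_mono[OF yX that] z by blast
    have iff: "k \<le> k0 \<and> \<not> act k y \<longleftrightarrow> k \<le> \<tau> y" for k
      using \<tau>(1)[OF y] by (simp add: set_eq_iff)
    have na: "\<not> act (\<tau> y) z" using same[of "\<tau> y"] iff[of "\<tau> y"] by simp
    show "?I z = {..\<tau> y}"
    proof (intro equalityI subsetI)
      fix k assume "k \<in> ?I z"
      then show "k \<in> {..\<tau> y}" using same[of k] iff[of k] by (cases "\<tau> y \<le> k") simp_all
    next
      fix k assume "k \<in> {..\<tau> y}"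
      then show "k \<in> ?I z" using na act_up[of k z "\<tau> y"] \<tau>(2)[OF y] by auto
    qed
    have zE: "z \<notin> E" using na act_up[of 0 z "\<tau> y"] by (auto simp: E_def)
    have "z \<in> ?Q" using C_trans[OF x0, of y k0 "\<tau> y"] \<tau>(2)[OF y] y z by auto
    then show "z \<in> ?Q - E" using zE by blast
  qed
  have "(\<Sum>y\<in>?Q. \<Phi> y * (\<Sum>k\<in>?I y. (a k y)\<^sup>2)) = (\<Sum>y\<in>?Q - E. \<Phi> y * (\<Sum>k\<in>?I y. (a k y)\<^sup>2))"
  proof (rule sum.mono_neutral_right[OF C_finite[OF x0]])
    show "\<forall>y\<in>?Q - (?Q - E). \<Phi> y * (\<Sum>k\<in>?I y. (a k y)\<^sup>2) = 0"
    proof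
      fix y assume "y \<in> ?Q - (?Q - E)"
      then have "?I y = {}" using I_E by blast
      then show "\<Phi> y * (\<Sum>k\<in>?I y. (a k y)\<^sup>2) = 0" by (simp only: sum.empty mult_zero_right)
    qed
  qed auto
  also have "\<dots> \<le> (\<Sum>y\<in>?Q - E. ?K * H y)"
  proof (rule sum_blocks_mono[where l=\<tau>])
    show "finite (?Q - E)" "?Q - E \<subseteq> X" using C_finite x0 Q_X by auto
    fix y assume y: "y \<in> ?Q - E"
    show "C (\<tau> y) y \<subseteq> ?Q - E" using blk[OF y] by blast
    show "\<tau> z = \<tau> y" if "z \<in> C (\<tau> y) y" for z
      unfolding \<tau>_def[of z] blk(1)[OF y that] by (rule Max_eqI) auto
    have "(\<Sum>z\<in>C (\<tau> y) y. \<Phi> z * (\<Sum>k\<in>?I z. (a k z)\<^sup>2)) = (\<Sum>z\<in>C (\<tau> y) y. \<Phi> z * (\<Sum>k\<le>\<tau> y. (a k z)\<^sup>2))"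
      using blk(1)[OF y] by (intro sum.cong refl) simp
    also have "\<dots> \<le> ?K * sum H (C (\<tau> y) y)"
      by (rule less.IH) (use \<tau>(2)[OF y] y Q_X less.prems in auto)
    finally show "(\<Sum>z\<in>C (\<tau> y) y. \<Phi> z * (\<Sum>k\<in>?I z. (a k z)\<^sup>2)) \<le> (\<Sum>z\<in>C (\<tau> y) y. ?K * H z)"
      by (simp add: sum_distrib_left)
  qed
  finally have inactive: "(\<Sum>y\<in>?Q. \<Phi> y * (\<Sum>k\<in>?I y. (a k y)\<^sup>2)) \<le> ?K * sum H (?Q - E)"
    by (simp add: sum_distrib_left)
  have "sum H ?Q = sum H (?Q - E) + sum H E"
    by (rule sum.subset_diff) (use C_finite[OF x0] in \<open>auto simp: E_def\<close>)
  then show ?case using split active inactive by (simp add: distrib_left)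
qed

section \<open>The maximal function of a tree\<close>

definition wavg :: "('a \<Rightarrow> real) \<Rightarrow> ('a \<Rightarrow> real) \<Rightarrow> nat \<Rightarrow> 'a \<Rightarrow> real" where
  "wavg m f k x = (\<Sum>y\<in>C k x. f y * m y) / sum m (C k x)"

definition maximal :: "('a \<Rightarrow> real) \<Rightarrow> ('a \<Rightarrow> real) \<Rightarrow> nat \<Rightarrow> 'a \<Rightarrow> real" where
  "maximal m f k x = Max ((\<lambda>j. wavg m f j x) ` {..k})"

lemma wavg_block: "x \<in> X \<Longrightarrow> y \<in> C k x \<Longrightarrow> wavg m f k y = wavg m f k x"
  unfolding wavg_def by (metis C_eq)

lemma wavg_le_maximal: "j \<le> k \<Longrightarrow> wavg m f j x \<le> maximal m f k x"
  unfolding maximal_def by (rule Max_ge) auto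

lemma wavg_nonneg:
  assumes "x \<in> X" "\<And>y. y \<in> X \<Longrightarrow> 0 \<le> m y" "\<And>y. y \<in> X \<Longrightarrow> 0 \<le> f y"
  shows "0 \<le> wavg m f k x"
proof -
  have X: "y \<in> X" if "y \<in> C k x" for y using C_sub[OF assms(1)] that by blast
  show ?thesis
    unfolding wavg_def
    by (intro divide_nonneg_nonneg sum_nonneg mult_nonneg_nonneg) (simp_all add: X assms(2,3))
qed

lemma maximal_nonneg:
  assumes "x \<in> X" "\<And>y. y \<in> X \<Longrightarrow> 0 \<le> m y" "\<And>y. y \<in> X \<Longrightarrow> 0 \<le> f y"
  shows "0 \<le> maximal m f k x"
  by (rule order_trans[OF wavg_nonneg[where k=k, OF assms] wavg_le_maximal[OF order_refl]])

lemma maximal_Suc: "maximal m f (Suc k) x = max (wavg m f (Suc k) x) (maximal m f k x)"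
  unfolding maximal_def atMost_Suc image_insert by (rule Max_insert) auto

lemma sum_pos_block:
  fixes m :: "'a \<Rightarrow> real"
  assumes "x \<in> X" "\<And>y. y \<in> X \<Longrightarrow> 0 < m y"
  shows "0 < sum m (C k x)"
proof (rule sum_pos[OF C_finite[OF assms(1)]])
  show "C k x \<noteq> {}" using C_self[OF assms(1)] by blast
  show "0 < m y" if "y \<in> C k x" for y using C_sub[OF assms(1)] assms(2) that by blast
qed

text \<open>
  Doob's argument as an induction over the generations. The number \<open>c\<close> is the maximum
  of the averages over the larger blocks; when the average over the present block exceeds it,
  \<open>powr_increment_le\<close> applies.
\<close>

lemma maximal_running:
  fixes q c :: real
  assumes m: "\<And>y. y \<in> X \<Longrightarrow> 0 < m y" and f: "\<And>y. y \<in> X \<Longrightarrow> 0 \<le> f y" and q: "0 < q"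
    and "x \<in> X" "0 \<le> c"
  shows "(\<Sum>y\<in>C k x. (max c (maximal m f k y)) powr (q + 1) * m y)
     \<le> (\<Sum>y\<in>C k x. (q + 1) / q * (f y * ((max c (maximal m f k y)) powr q - c powr q) * m y) + c powr (q + 1) * m y)"
  using assms(4,5)
proof (induction k arbitrary: x c)
  case 0
  have M: "maximal m f 0 x = f x"
    using m[OF 0(1)] by (simp add: maximal_def wavg_def C_zero[OF 0(1)])
  have "max c (f x) powr (q + 1) - c powr (q + 1) \<le> (q + 1) / q * (f x * (max c (f x) powr q - c powr q))"
    using powr_increment_le[of c "f x" q] 0 q by (cases "c \<le> f x") (auto simp: max_def mult.assoc)
  from mult_right_mono[OF this, of "m x"] show ?case
    using m[OF 0(1)] by (simp add: C_zero[OF 0(1)] M algebra_simps)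
next
  case (Suc k)
  define d where "d = max c (wavg m f (Suc k) x)"
  have d: "0 \<le> d" "c \<le> d" using Suc.prems by (auto simp: d_def)
  let ?Q = "C (Suc k) x"
  have M: "max c (maximal m f (Suc k) y) = max d (maximal m f k y)" if "y \<in> ?Q" for y
    using wavg_block[OF Suc.prems(1) that] by (simp add: maximal_Suc d_def max.assoc)
  have s: "(\<Sum>y\<in>?Q. f y * m y) = wavg m f (Suc k) x * sum m ?Q"
    using sum_pos_block[where m=m and k="Suc k", OF Suc.prems(1) m] by (simp add: wavg_def)
  have inc: "d powr (q + 1) - c powr (q + 1) \<le> (q + 1) / q * wavg m f (Suc k) x * (d powr q - c powr q)"
    using powr_increment_le[of c d q] d Suc.prems q by (cases "c \<le> wavg m f (Suc k) x") (auto simp: d_def)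
  have "(\<Sum>y\<in>?Q. (max c (maximal m f (Suc k) y)) powr (q + 1) * m y)
      = (\<Sum>y\<in>?Q. (max d (maximal m f k y)) powr (q + 1) * m y)"
    by (rule sum.cong) (use M in auto)
  also have "\<dots> \<le> (\<Sum>y\<in>?Q. (q + 1) / q * (f y * ((max d (maximal m f k y)) powr q - d powr q) * m y) + d powr (q + 1) * m y)"
  proof (rule sum_level_mono[OF Suc.prems(1), of k])
    fix y assume "y \<in> ?Q"
    then have "y \<in> X" using C_sub[OF Suc.prems(1)] by blast
    from Suc.IH[OF this d(1)]
    show "(\<Sum>y\<in>C k y. (max d (maximal m f k y)) powr (q + 1) * m y)
      \<le> (\<Sum>y\<in>C k y. (q + 1) / q * (f y * ((max d (maximal m f k y)) powr q - d powr q) * m y) + d powr (q + 1) * m y)" .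
  qed simp
  also have "\<dots> = (\<Sum>y\<in>?Q. (q + 1) / q * (f y * ((max d (maximal m f k y)) powr q - c powr q) * m y) + c powr (q + 1) * m y)
      - (q + 1) / q * (d powr q - c powr q) * (\<Sum>y\<in>?Q. f y * m y) + (d powr (q + 1) - c powr (q + 1)) * sum m ?Q"
    unfolding sum_distrib_left sum_subtractf[symmetric] sum.distrib[symmetric]
    by (rule sum.cong) (simp_all add: algebra_simps)
  also have "\<dots> \<le> (\<Sum>y\<in>?Q. (q + 1) / q * (f y * ((max d (maximal m f k y)) powr q - c powr q) * m y) + c powr (q + 1) * m y)"
    using mult_right_mono[OF inc, of "sum m ?Q"] sum_pos_block[where m=m and k="Suc k", OF Suc.prems(1) m] unfolding s
    by (simp add: mult_ac)
  also have "\<dots> = (\<Sum>y\<in>?Q. (q + 1) / q * (f y * ((max c (maximal m f (Suc k) y)) powr q - c powr q) * m y) + c powr (q + 1) * m y)"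
    by (rule sum.cong) (use M in auto)
  finally show ?case .
qed

text \<open>
  Doob's maximal inequality for an arbitrary measure \<open>m\<close> on the cells. The bound from
  \<open>maximal_running\<close> is linear in \<open>f\<close>; Hoelder's inequality then lets one
  divide by a power of the left-hand side, which is a finite sum.
\<close>

lemma maximal_Lp:
  fixes p :: real
  assumes m: "\<And>y. y \<in> X \<Longrightarrow> 0 < m y" and f: "\<And>y. y \<in> X \<Longrightarrow> 0 \<le> f y" and p: "1 < p" and x: "x \<in> X"
  shows "(\<Sum>y\<in>C k x. maximal m f k y powr p * m y) \<le> (p / (p - 1)) powr p * (\<Sum>y\<in>C k x. f y powr p * m y)"
proof -
  let ?Q = "C k x" and ?M = "maximal m f k"
  define A B where "A = (\<Sum>y\<in>?Q. ?M y powr p * m y)" and "B = (\<Sum>y\<in>?Q. f y powr p * m y)"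
  have Q: "y \<in> X" if "y \<in> ?Q" for y using that C_sub x by blast
  have M0: "0 \<le> ?M y" if "y \<in> X" for y
    by (rule maximal_nonneg[OF that]) (use m f less_imp_le in auto)
  have A0: "0 \<le> A" unfolding A_def by (intro sum_nonneg mult_nonneg_nonneg) (use m Q less_imp_le in auto)
  have B0: "0 \<le> B" unfolding B_def by (intro sum_nonneg mult_nonneg_nonneg) (use m Q less_imp_le in auto)
  have A1: "A \<le> p / (p - 1) * (\<Sum>y\<in>?Q. f y * ?M y powr (p - 1) * m y)"
  proof -
    have "A = (\<Sum>y\<in>?Q. (max 0 (?M y)) powr (p - 1 + 1) * m y)"
      unfolding A_def by (rule sum.cong) (use M0 Q in \<open>auto simp: max_def\<close>)
    also have "\<dots> \<le> (\<Sum>y\<in>?Q. (p - 1 + 1) / (p - 1) * (f y * ((max 0 (?M y)) powr (p - 1) - 0 powr (p - 1)) * m y) + 0 powr (p - 1 + 1) * m y)"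
      by (rule maximal_running[where c=0, OF m f _ x]) (use p in auto)
    also have "\<dots> = p / (p - 1) * (\<Sum>y\<in>?Q. f y * ?M y powr (p - 1) * m y)"
      unfolding sum_distrib_left by (rule sum.cong) (use M0 Q in \<open>auto simp: max_def\<close>)
    finally show ?thesis .
  qed
  have "(\<Sum>y\<in>?Q. f y * ?M y powr (p - 1) * m y)
      = (\<Sum>y\<in>?Q. (f y powr p * m y) powr (1 / p) * (?M y powr p * m y) powr (1 - 1 / p))"
  proof (rule sum.cong[OF refl])
    fix y assume "y \<in> ?Q"
    then have y: "0 \<le> f y" "0 \<le> ?M y" "0 < m y" using Q f m M0 by auto
    have "(f y powr p * m y) powr (1 / p) * (?M y powr p * m y) powr (1 - 1 / p)
      = f y * ?M y powr (p * (1 - 1 / p)) * (m y powr (1 / p) * m y powr (1 - 1 / p))"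
      using y p by (simp add: powr_mult powr_powr mult_ac)
    also have "p * (1 - 1 / p) = p - 1" using p by (simp add: field_simps)
    also have "m y powr (1 / p) * m y powr (1 - 1 / p) = m y" using y by (simp flip: powr_add)
    finally show "f y * ?M y powr (p - 1) * m y
       = (f y powr p * m y) powr (1 / p) * (?M y powr p * m y) powr (1 - 1 / p)" by simp
  qed
  also have "\<dots> \<le> B powr (1 / p) * A powr (1 - 1 / p)"
    unfolding A_def B_def by (rule Hoelder_sum) (use p m[OF Q] C_finite[OF x] in \<open>auto intro!: mult_nonneg_nonneg simp: less_imp_le\<close>)
  finally have "p / (p - 1) * (\<Sum>y\<in>?Q. f y * ?M y powr (p - 1) * m y)
      \<le> p / (p - 1) * (B powr (1 / p) * A powr (1 - 1 / p))"
    using p by (intro mult_left_mono) auto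
  with A1 have le: "A \<le> p / (p - 1) * (B powr (1 / p) * A powr (1 - 1 / p))" by (rule order_trans)
  show ?thesis
  proof (cases "A = 0")
    case True
    then show ?thesis using B0 unfolding A_def B_def by simp
  next
    case False
    then have A: "0 < A" using A0 by simp
    have "A = A powr (1 / p) * A powr (1 - 1 / p)" using A by (simp flip: powr_add)
    then have "A powr (1 / p) * A powr (1 - 1 / p) \<le> (p / (p - 1) * B powr (1 / p)) * A powr (1 - 1 / p)"
      using le by (simp add: mult.assoc)
    then have "A powr (1 / p) \<le> p / (p - 1) * B powr (1 / p)"
      by (rule mult_right_le_imp_le) (use A in simp)
    then have "(A powr (1 / p)) powr p \<le> (p / (p - 1) * B powr (1 / p)) powr p"
      using p by (intro powr_mono2) auto
    moreover have "(p / (p - 1) * B powr (1 / p)) powr p = (p / (p - 1)) powr p * B"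
      by (subst powr_mult) (use B0 p in \<open>auto simp: powr_powr\<close>)
    ultimately show ?thesis unfolding A_def[symmetric] B_def[symmetric]
      using A p by (simp add: powr_powr)
  qed
qed

section \<open>The weighted bound on a tree\<close>

text \<open>
  Write \<open>G = h \<sigma>\<close> and \<open>\<Phi> = g w\<close>. On a block the product of
  averages in \<open>stopping_time_bound\<close> factors into
  \<open>\<sigma>\<^sub>Q^2 w\<^sub>Q\<close> and averages of \<open>h\<close> and \<open>g\<close>
  with respect to \<open>\<sigma>\<close> and \<open>w\<close>. The latter are below the maximal
  functions at every point of \<open>E\<close>, and hypothesis \<open>L\<close> handles the former.
\<close>

lemma weighted_bound:
  fixes F G w \<sigma> v :: "'a \<Rightarrow> real" and a :: "nat \<Rightarrow> 'a \<Rightarrow> real" and \<theta> p L :: real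
  assumes x0: "x0 \<in> X" and \<theta>: "0 \<le> \<theta>" "\<theta> < 1" and p: "2 < p"
    and FG: "\<And>y. y \<in> X \<Longrightarrow> \<bar>F y\<bar> \<le> G y"
    and a0: "\<And>k y. 0 \<le> a k y"
    and a_block: "\<And>k y z. y \<in> X \<Longrightarrow> z \<in> C k y \<Longrightarrow> a k z = a k y"
    and a_le: "\<And>k y B. y \<in> X \<Longrightarrow> k \<le> N \<Longrightarrow>
        (\<And>\<psi>. test_fun \<theta> k y \<psi> \<Longrightarrow> \<bar>\<Sum>z\<in>C k y. \<psi> z * F z\<bar> + \<theta> ^ k * avg G k y \<le> B) \<Longrightarrow> a k y \<le> B"
    and w: "\<And>y. y \<in> X \<Longrightarrow> 0 < w y" and \<sigma>: "\<And>y. y \<in> X \<Longrightarrow> 0 < \<sigma> y" and v: "\<And>y. y \<in> X \<Longrightarrow> 0 \<le> v y"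
    and v_le: "\<And>y. y \<in> X \<Longrightarrow> v y \<le> \<sigma> y powr (2 / p) * w y powr (1 - 2 / p)"
    and L0: "0 \<le> L"
    and L: "\<And>k x E. x \<in> X \<Longrightarrow> k \<le> N \<Longrightarrow> E \<subseteq> C k x \<Longrightarrow> card (C k x) \<le> 2 * card E \<Longrightarrow>
        (avg \<sigma> k x)\<^sup>2 * avg w k x * real D ^ k \<le> L * sum v E"
  shows "(\<Sum>y\<in>C N x0. (\<Sum>k\<le>N. (a k y)\<^sup>2) powr (p / 2) * w y)
     \<le> (768 * (1 / (1 - \<theta>))\<^sup>2 * (real D)\<^sup>2 * (p / (p - 1))\<^sup>2 * (p / 2) * L) powr (p / 2)
        * (\<Sum>y\<in>C N x0. (G y / \<sigma> y) powr p * \<sigma> y)"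
proof -
  let ?Q = "C N x0"
  define T where "T y = (\<Sum>k\<le>N. (a k y)\<^sup>2)" for y
  (* g is the extremal function for the norm of T in L^(p/2)(w): the pairing of T with g w is the
     integral of T^(p/2) w. *)
  define g h where "g y = T y powr (p / 2 - 1)" and "h y = G y / \<sigma> y" for y
  define \<Phi> where "\<Phi> y = g y * w y" for y
  define H where "H y = L * ((maximal \<sigma> h N y)\<^sup>2 * maximal w g N y * v y)" for y
  define K where "K = 768 * (1 / (1 - \<theta>))\<^sup>2 * (real D)\<^sup>2"
  have K0: "0 \<le> K" by (simp add: K_def)
  have Q: "y \<in> X" if "y \<in> ?Q" for y using that C_sub x0 by blast
  have T0: "0 \<le> T y" for y by (simp add: T_def sum_nonneg)
  have g0: "0 \<le> g y" for y by (simp add: g_def)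
  have h0: "0 \<le> h y" if "y \<in> X" for y using FG[OF that] \<sigma>[OF that] by (simp add: h_def)
  have w0: "0 \<le> w y" and \<sigma>0: "0 \<le> \<sigma> y" if "y \<in> X" for y using w \<sigma> that by (auto intro: less_imp_le)
  have Mg0: "0 \<le> maximal w g N y" if "y \<in> X" for y by (rule maximal_nonneg[OF that w0 g0])
  have Mh0: "0 \<le> maximal \<sigma> h N y" if "y \<in> X" for y by (rule maximal_nonneg[OF that \<sigma>0 h0])
  have H_le: "(avg G k x)\<^sup>2 * avg \<Phi> k x * real D ^ k \<le> sum H E"
    if E: "x \<in> X" "k \<le> N" "E \<subseteq> C k x" "card (C k x) \<le> 2 * card E" for k x E
  proof -
    have X: "y \<in> X" if "y \<in> C k x" for y using that C_sub E by blast
    have "sum G (C k x) = (\<Sum>y\<in>C k x. h y * \<sigma> y)"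
    proof (rule sum.cong[OF refl])
      show "G y = h y * \<sigma> y" if "y \<in> C k x" for y using \<sigma>[OF X[OF that]] by (simp add: h_def)
    qed
    then have G: "avg G k x = avg \<sigma> k x * wavg \<sigma> h k x"
      using sum_pos_block[where m=\<sigma> and k=k, OF E(1) \<sigma>] by (simp add: avg_def wavg_def)
    have P: "avg \<Phi> k x = avg w k x * wavg w g k x"
      using sum_pos_block[where m=w and k=k, OF E(1) w] by (simp add: avg_def wavg_def \<Phi>_def)
    have wh0: "0 \<le> wavg \<sigma> h k x" and wg0: "0 \<le> wavg w g k x"
      by (rule wavg_nonneg[OF E(1)], use w0 \<sigma>0 g0 h0 in auto)+
    have "(avg G k x)\<^sup>2 * avg \<Phi> k x * real D ^ k
        = ((avg \<sigma> k x)\<^sup>2 * avg w k x * real D ^ k) * ((wavg \<sigma> h k x)\<^sup>2 * wavg w g k x)"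
      by (simp add: G P power_mult_distrib)
    also have "\<dots> \<le> (L * sum v E) * ((wavg \<sigma> h k x)\<^sup>2 * wavg w g k x)"
      by (rule mult_right_mono[OF L[OF E]]) (use wg0 in auto)
    also have "\<dots> = (\<Sum>y\<in>E. L * ((wavg \<sigma> h k x)\<^sup>2 * wavg w g k x * v y))"
      by (simp add: sum_distrib_left sum_distrib_right mult_ac)
    also have "\<dots> \<le> sum H E"
      unfolding H_def
    proof (rule sum_mono)
      fix y assume "y \<in> E"
      then have y: "y \<in> C k x" "y \<in> X" using E X by auto
      have "wavg \<sigma> h k x \<le> maximal \<sigma> h N y"
        using wavg_le_maximal[OF E(2), of \<sigma> h y] wavg_block[OF E(1) y(1), of \<sigma> h] by simp
      moreover have "wavg w g k x \<le> maximal w g N y"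
        using wavg_le_maximal[OF E(2), of w g y] wavg_block[OF E(1) y(1), of w g] by simp
      ultimately show "L * ((wavg \<sigma> h k x)\<^sup>2 * wavg w g k x * v y) \<le> L * ((maximal \<sigma> h N y)\<^sup>2 * maximal w g N y * v y)"
        using wh0 wg0 v[OF y(2)] L0 by (intro mult_left_mono mult_right_mono mult_mono power_mono) auto
    qed
    finally show ?thesis .
  qed
  define U P where "U = (\<Sum>y\<in>?Q. T y powr (p / 2) * w y)" and "P = (\<Sum>y\<in>?Q. h y powr p * \<sigma> y)"
  have P0: "0 \<le> P" unfolding P_def by (intro sum_nonneg mult_nonneg_nonneg) (use \<sigma>0 Q in auto)
  have U0: "0 \<le> U" unfolding U_def by (intro sum_nonneg mult_nonneg_nonneg) (use w0 Q in auto)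
  (* q is conjugate to p/2, and g^q = T^(p/2). *)
  define q where "q = p / (p - 2)"
  have q: "1 < q" "q / (q - 1) = p / 2" "(p / 2 - 1) * q = p / 2" "q * (1 - 2 / p) = 1"
    using p by (auto simp: q_def field_simps)
  have "U = (\<Sum>y\<in>?Q. \<Phi> y * T y)"
    unfolding U_def \<Phi>_def g_def
  proof (rule sum.cong[OF refl])
    fix y
    have "T y powr (p / 2) = T y * T y powr (p / 2 - 1)" using powr_mult_base[OF T0, of y "p / 2 - 1"] by simp
    then show "T y powr (p / 2) * w y = T y powr (p / 2 - 1) * w y * T y" by simp
  qed
  also have "\<dots> \<le> K * sum H ?Q"
    unfolding T_def K_def
    by (rule stopping_time_bound[where F=F and G=G and H=H and N=N, OF x0 \<theta> FG _ a0 a_block a_le H_le])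
       (use g0 w0 in \<open>auto simp: \<Phi>_def\<close>)
  finally have UH: "U \<le> K * sum H ?Q" .
  have HL: "sum H ?Q \<le> L * (\<Sum>y\<in>?Q. (maximal \<sigma> h N y powr p * \<sigma> y) powr (2 / p) * (maximal w g N y powr q * w y) powr (1 - 2 / p))"
    unfolding H_def sum_distrib_left[symmetric]
  proof (intro mult_left_mono[OF sum_mono L0])
    fix y assume "y \<in> ?Q"
    then have y: "y \<in> X" by (rule Q)
    have "(maximal \<sigma> h N y powr p * \<sigma> y) powr (2 / p) * (maximal w g N y powr q * w y) powr (1 - 2 / p)
        = (maximal \<sigma> h N y powr 2 * \<sigma> y powr (2 / p)) * (maximal w g N y powr 1 * w y powr (1 - 2 / p))"
      using Mg0[OF y] Mh0[OF y] \<sigma>0[OF y] w0[OF y] p q by (simp add: powr_mult powr_powr)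
    also have "\<dots> = (maximal \<sigma> h N y)\<^sup>2 * maximal w g N y * (\<sigma> y powr (2 / p) * w y powr (1 - 2 / p))"
      using Mg0[OF y] Mh0[OF y] by (simp add: powr_numeral mult_ac)
    finally show "(maximal \<sigma> h N y)\<^sup>2 * maximal w g N y * v y
      \<le> (maximal \<sigma> h N y powr p * \<sigma> y) powr (2 / p) * (maximal w g N y powr q * w y) powr (1 - 2 / p)"
      using v_le[OF y] Mg0[OF y] by (simp add: mult_left_mono)
  qed
  have "(\<Sum>y\<in>?Q. (maximal \<sigma> h N y powr p * \<sigma> y) powr (2 / p) * (maximal w g N y powr q * w y) powr (1 - 2 / p))
     \<le> (\<Sum>y\<in>?Q. maximal \<sigma> h N y powr p * \<sigma> y) powr (2 / p) * (\<Sum>y\<in>?Q. maximal w g N y powr q * w y) powr (1 - 2 / p)"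
    by (rule Hoelder_sum) (use p C_finite x0 w0 \<sigma>0 Q in auto)
  also have "\<dots> \<le> ((p / (p - 1)) powr p * P) powr (2 / p) * ((p / 2) powr q * U) powr (1 - 2 / p)"
  proof (intro mult_mono powr_mono2)
    show "(\<Sum>y\<in>?Q. maximal \<sigma> h N y powr p * \<sigma> y) \<le> (p / (p - 1)) powr p * P"
      unfolding P_def by (rule maximal_Lp[OF \<sigma> h0 _ x0]) (use p in auto)
    have "(\<Sum>y\<in>?Q. maximal w g N y powr q * w y) \<le> (q / (q - 1)) powr q * (\<Sum>y\<in>?Q. g y powr q * w y)"
      by (rule maximal_Lp[OF w g0 q(1) x0])
    also have "(\<Sum>y\<in>?Q. g y powr q * w y) = U"
      unfolding U_def g_def by (simp add: powr_powr q)
    finally show "(\<Sum>y\<in>?Q. maximal w g N y powr q * w y) \<le> (p / 2) powr q * U" by (simp add: q)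
  qed (use p w0 \<sigma>0 Q in \<open>auto intro!: sum_nonneg mult_nonneg_nonneg\<close>)
  also have "\<dots> = (p / (p - 1))\<^sup>2 * (p / 2) * P powr (2 / p) * U powr (1 - 2 / p)"
    using p P0 U0 q by (simp add: powr_mult powr_powr powr_numeral mult_ac)
  finally have "K * (L * (\<Sum>y\<in>?Q. (maximal \<sigma> h N y powr p * \<sigma> y) powr (2 / p) * (maximal w g N y powr q * w y) powr (1 - 2 / p)))
      \<le> K * (L * ((p / (p - 1))\<^sup>2 * (p / 2) * P powr (2 / p) * U powr (1 - 2 / p)))"
    using K0 L0 by (intro mult_left_mono)
  then have le: "U \<le> (K * (p / (p - 1))\<^sup>2 * (p / 2) * L) * P powr (2 / p) * U powr (1 - 2 / p)"
    using UH mult_left_mono[OF HL K0] by (simp add: mult_ac)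
  define R where "R = K * (p / (p - 1))\<^sup>2 * (p / 2) * L"
  have R0: "0 \<le> R" using K0 L0 p by (simp add: R_def)
  have "U \<le> R powr (p / 2) * P"
  proof (cases "U = 0")
    case True
    then show ?thesis using P0 by simp
  next
    case False
    then have U: "0 < U" using U0 by simp
    have "U = U powr (2 / p) * U powr (1 - 2 / p)" using U by (simp flip: powr_add)
    then have "U powr (2 / p) * U powr (1 - 2 / p) \<le> (R * P powr (2 / p)) * U powr (1 - 2 / p)"
      using le by (simp add: R_def)
    then have "U powr (2 / p) \<le> R * P powr (2 / p)"
      by (rule mult_right_le_imp_le) (use U in simp)
    then have "(U powr (2 / p)) powr (p / 2) \<le> (R * P powr (2 / p)) powr (p / 2)"
      using p by (intro powr_mono2) auto
    moreover have "(R * P powr (2 / p)) powr (p / 2) = R powr (p / 2) * P"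
      by (subst powr_mult) (use P0 R0 p in \<open>auto simp: powr_powr\<close>)
    ultimately show ?thesis using U p by (simp add: powr_powr)
  qed
  then show ?thesis unfolding U_def P_def R_def K_def T_def h_def .
qed

end

section \<open>Dyadic grids\<close>

text \<open>
  The shift of the cubes may depend on the scale, as long as the grids of consecutive scales are
  nested.
\<close>

locale dyadic_grid =
  fixes s :: "int \<Rightarrow> real ^ 'n"
  assumes shift: "\<exists>m::int. s (k + 1) $ i - s k $ i = of_int m * 2 powi k"
begin

definition coord :: "int \<Rightarrow> real ^ 'n \<Rightarrow> 'n \<Rightarrow> int" where
  "coord k x i = \<lfloor>(x $ i - s k $ i) / 2 powi k\<rfloor>"

definition cube :: "int \<Rightarrow> real ^ 'n \<Rightarrow> (real ^ 'n) set" where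
  "cube k x = {y. coord k y = coord k x}"

lemma cube_self: "x \<in> cube k x" by (simp add: cube_def)

lemma cube_eq: "y \<in> cube k x \<Longrightarrow> cube k y = cube k x" by (simp add: cube_def)

lemma cube_Suc: "cube k x \<subseteq> cube (k + 1) x"
proof
  fix y assume "y \<in> cube k x"
  then have y: "coord k y i = coord k x i" for i by (simp add: cube_def)
  have "coord (k + 1) y i = coord (k + 1) x i" for i
  proof -
    obtain m :: int where m: "s (k + 1) $ i - s k $ i = of_int m * 2 powi k" using shift by blast
    have c: "coord (k + 1) z i = (coord k z i - m) div 2" for z
    proof -
      have e: "z $ i - s (k + 1) $ i = (z $ i - s k $ i) - of_int m * 2 powi k" using m by simp
      have "(z $ i - s (k + 1) $ i) / 2 powi (k + 1) = ((z $ i - s k $ i) / 2 powi k - of_int m) / of_int 2"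
        unfolding e by (simp add: power_int_add diff_divide_distrib)
      then show ?thesis
        unfolding coord_def by (simp only: floor_divide_real_eq_div) (simp add: floor_diff_of_int)
    qed
    show ?thesis unfolding c y ..
  qed
  then show "y \<in> cube (k + 1) x" by (auto simp: cube_def)
qed

lemma cube_mono: "j \<le> k \<Longrightarrow> cube j x \<subseteq> cube k x"
  by (induction k rule: int_ge_induct) (use cube_Suc in blast)+

lemma cube_mono': "j \<le> k \<Longrightarrow> y \<in> cube k x \<Longrightarrow> cube j y \<subseteq> cube k x"
  using cube_mono cube_eq by blast

definition corner :: "int \<Rightarrow> real ^ 'n \<Rightarrow> real ^ 'n" where
  "corner k x = (\<chi> i. s k $ i + of_int (coord k x i) * 2 powi k)"

lemma mem_cube:
  "y \<in> cube k x \<longleftrightarrow> (\<forall>i. corner k x $ i \<le> y $ i \<and> y $ i < corner k x $ i + 2 powi k)"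
proof -
  have "coord k y i = c \<longleftrightarrow> s k $ i + of_int c * 2 powi k \<le> y $ i \<and> y $ i < s k $ i + of_int c * 2 powi k + 2 powi k" for c i
    by (simp add: coord_def floor_eq_iff pos_le_divide_eq pos_divide_less_eq algebra_simps)
  then show ?thesis by (simp add: cube_def corner_def fun_eq_iff)
qed

abbreviation closed_cube :: "int \<Rightarrow> real ^ 'n \<Rightarrow> (real ^ 'n) set" where
  "closed_cube k x \<equiv> cbox (corner k x) (\<chi> i. corner k x $ i + 2 powi k)"

lemma closed_cube_in_cubes: "closed_cube k x \<in> cubes"
  unfolding cubes_def by (intro CollectI exI conjI) (rule refl, simp)

lemma cube_subset_closed: "cube k x \<subseteq> closed_cube k x"
  by (auto simp: mem_cube mem_box_cart less_imp_le)

lemma negligible_closed_cube_diff: "negligible (closed_cube k x - cube k x)"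
proof (rule negligible_subset[OF negligible_frontier_interval])
  show "closed_cube k x - cube k x \<subseteq> closed_cube k x - box (corner k x) (\<chi> i. corner k x $ i + 2 powi k)"
    by (auto simp: mem_cube mem_box_cart less_imp_le)
qed

lemma cube_lmeasurable: "cube k x \<in> lmeasurable"
proof -
  have "cube k x = closed_cube k x - (closed_cube k x - cube k x)" using cube_subset_closed by auto
  moreover have "closed_cube k x - cube k x \<in> lmeasurable"
    using negligible_closed_cube_diff by (rule negligible_imp_measurable)
  ultimately show ?thesis by (metis fmeasurable.Diff lmeasurable_cbox)
qed

lemma cube_sets: "cube k x \<in> sets lebesgue" using cube_lmeasurable by (rule fmeasurableD)

lemma measure_cube: "measure lebesgue (cube k x) = (2 powi k) ^ CARD('n)"
proof -
  have "measure lebesgue (cube k x) = measure lebesgue (closed_cube k x)"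
    by (rule measure_negligible_symdiff) 
       (use negligible_closed_cube_diff cube_subset_closed in \<open>auto intro: negligible_subset\<close>)
  also have "\<dots> = (\<Prod>i\<in>(UNIV :: 'n set). 2 powi k)"
    using content_cbox_cart[of "corner k x" "\<chi> i. corner k x $ i + 2 powi k"]
    by (auto simp: interval_ne_empty_cart)
  finally show ?thesis by simp
qed

lemma measure_cube_pos: "0 < measure lebesgue (cube k x)" by (simp add: measure_cube)

lemma measure_cube_add: "measure lebesgue (cube (k + int j) x) = (2 ^ CARD('n)) ^ j * measure lebesgue (cube k y)"
  by (simp add: measure_cube power_int_add power_mult_distrib flip: power_mult)

lemma cubes_countable: "countable (range (cube k))"
proof -
  have "range (cube k) \<subseteq> range (\<lambda>g. {y. coord k y = g})" by (auto simp: cube_def)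
  then show ?thesis by (rule countable_subset) simp
qed

lemma cubes_disjoint: "A \<in> range (cube k) \<Longrightarrow> B \<in> range (cube k) \<Longrightarrow> A \<noteq> B \<Longrightarrow> disjnt A B"
  unfolding disjnt_def by (auto simp: cube_def)

text \<open>
  For a cell \<open>R\<close> the union is the single cube of side \<open>2^(b+j)\<close> around
  \<open>R\<close>. Writing it as a union makes the block a function of the set \<open>R\<close>
  without choosing a point of it.
\<close>

definition subcubes :: "int \<Rightarrow> nat \<Rightarrow> (real ^ 'n) set \<Rightarrow> (real ^ 'n) set set" where
  "subcubes b j R = cube b ` (\<Union>x\<in>R. cube (b + int j) x)"

lemma subcubes_cube: "subcubes b j (cube b x) = cube b ` cube (b + int j) x"
proof -
  have "(\<Union>y\<in>cube b x. cube (b + int j) y) = cube (b + int j) x"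
  proof -
    have "cube (b + int j) y = cube (b + int j) x" if "y \<in> cube b x" for y
      by (rule cube_eq) (use cube_mono[of b "b + int j" x] that in auto)
    then have "(\<Union>y\<in>cube b x. cube (b + int j) y) = (\<Union>y\<in>cube b x. cube (b + int j) x)" by simp
    then show ?thesis using cube_self by blast
  qed
  then show ?thesis by (simp add: subcubes_def)
qed

lemma Union_subcubes: "\<Union>(cube b ` cube (b + int j) x) = cube (b + int j) x"
proof (intro equalityI subsetI)
  fix z assume "z \<in> \<Union>(cube b ` cube (b + int j) x)"
  then obtain y where y: "y \<in> cube (b + int j) x" "z \<in> cube b y" by auto
  show "z \<in> cube (b + int j) x" using cube_mono'[of b "b + int j" y x] y by auto
next
  fix z assume "z \<in> cube (b + int j) x"
  then show "z \<in> \<Union>(cube b ` cube (b + int j) x)" using cube_self by blast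
qed

lemma measure_finite_subcubes:
  assumes "finite A" "A \<subseteq> range (cube b)"
  shows "measure lebesgue (\<Union>A) = real (card A) * (2 powi b) ^ CARD('n)"
proof -
  have "measure lebesgue (\<Union>A) = (\<Sum>R\<in>A. measure lebesgue R)"
  proof (rule measure_Union'[OF assms(1)])
    show "R \<in> lmeasurable" if "R \<in> A" for R using that assms(2) cube_lmeasurable by auto
    show "pairwise disjnt A"
      by (rule pairwiseI) (rule cubes_disjoint[of _ b], use assms(2) in auto)
  qed
  also have "\<dots> = (\<Sum>R\<in>A. (2 powi b) ^ CARD('n))"
  proof (rule sum.cong[OF refl])
    fix R assume "R \<in> A"
    then obtain x where "R = cube b x" using assms(2) by blast
    then show "measure lebesgue R = (2 powi b) ^ CARD('n)" by (simp add: measure_cube)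
  qed
  finally show ?thesis by simp
qed

lemma finite_subcubes: "finite (cube b ` cube (b + int j) x)"
proof (rule ccontr)
  assume "\<not> ?thesis"
  then obtain A where A: "finite A" "card A = Suc ((2 ^ CARD('n)) ^ j)" "A \<subseteq> cube b ` cube (b + int j) x"
    using infinite_arbitrarily_large[of "cube b ` cube (b + int j) x" "Suc ((2 ^ CARD('n)) ^ j)"] by metis
  have "measure lebesgue (\<Union>A) \<le> measure lebesgue (cube (b + int j) x)"
  proof (rule measure_mono_fmeasurable[OF _ _ cube_lmeasurable])
    show "\<Union>A \<subseteq> cube (b + int j) x" using A(3) Union_subcubes[of b j x] by blast
    show "\<Union>A \<in> sets lebesgue" using A cube_sets by (intro sets.finite_Union) auto
  qed
  moreover have "measure lebesgue (\<Union>A) = real (card A) * (2 powi b) ^ CARD('n)"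
    by (rule measure_finite_subcubes) (use A in auto)
  moreover have "measure lebesgue (cube (b + int j) x) = (2 ^ CARD('n)) ^ j * (2 powi b) ^ CARD('n)"
    using measure_cube_add[of b j x x] unfolding measure_cube[of b] .
  ultimately have "real (card A) * (2 powi b) ^ CARD('n) \<le> (2 ^ CARD('n)) ^ j * (2 powi b) ^ CARD('n)"
    by simp
  then have "real (card A) \<le> (2 ^ CARD('n)) ^ j" by (rule mult_right_le_imp_le) simp
  then have "card A \<le> (2 ^ CARD('n)) ^ j" 
    using of_nat_le_iff[where 'a=real, of "card A" "(2 ^ CARD('n)) ^ j"] by simp
  then show False using A by simp
qed

lemma card_subcubes: "card (cube b ` cube (b + int j) x) = (2 ^ CARD('n)) ^ j"
proof -
  have "real (card (cube b ` cube (b + int j) x)) * (2 powi b) ^ CARD('n) = (2 ^ CARD('n)) ^ j * (2 powi b) ^ CARD('n)"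
    using measure_finite_subcubes[OF finite_subcubes[of b j x] image_mono[OF subset_UNIV]]
      measure_cube_add[of b j x x] unfolding Union_subcubes measure_cube[of b] by simp
  then have "real (card (cube b ` cube (b + int j) x)) = (2 ^ CARD('n)) ^ j" by simp
  then show ?thesis 
    using of_nat_eq_iff[where 'a=real, of "card (cube b ` cube (b + int j) x)" "(2 ^ CARD('n)) ^ j"] by simp
qed

lemma dyadic_tree_subcubes: "dyadic_tree (range (cube b)) (subcubes b) (2 ^ CARD('n))"
proof
  fix R k assume "R \<in> range (cube b)"
  then obtain x where R: "R = cube b x" by auto
  show "subcubes b k R \<subseteq> range (cube b)" by (auto simp: subcubes_def)
  show "R \<in> subcubes b k R" unfolding R subcubes_cube using cube_self by blast
  show "subcubes b k R \<subseteq> subcubes b (Suc k) R"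
    unfolding R subcubes_cube using cube_Suc[of "b + int k" x] by (auto simp: algebra_simps)
  show "card (subcubes b k R) = (2 ^ CARD('n)) ^ k" unfolding R subcubes_cube by (rule card_subcubes)
  show "subcubes b k R' = subcubes b k R" if "R' \<in> subcubes b k R" for R'
  proof -
    obtain y where y: "y \<in> cube (b + int k) x" "R' = cube b y" using \<open>R' \<in> subcubes b k R\<close> unfolding R subcubes_cube by auto
    show ?thesis unfolding R y(2) subcubes_cube cube_eq[OF y(1)] ..
  qed
qed simp

lemma sum_set_integral_subcubes:
  fixes f :: "real ^ 'n \<Rightarrow> real"
  assumes "set_integrable lebesgue (cube (b + int j) x) f"
  shows "(\<Sum>R\<in>cube b ` cube (b + int j) x. LINT y:R|lebesgue. f y) = (LINT y:cube (b + int j) x|lebesgue. f y)"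
proof -
  let ?A = "cube b ` cube (b + int j) x"
  have "(LINT y:(\<Union>R\<in>?A. R)|lebesgue. f y) = (\<Sum>R\<in>?A. LINT y:R|lebesgue. f y)"
  proof (rule set_integral_finite_Union)
    show "disjoint_family_on (\<lambda>R. R) ?A"
      by (auto simp: disjoint_family_on_def cube_def)
    fix R assume R: "R \<in> ?A"
    show "R \<in> sets lebesgue" using R cube_sets by auto
    then show "set_integrable lebesgue R f"
      by (rule set_integrable_subset[OF assms]) (use R Union_subcubes[of b j x] in blast)
  qed (rule finite_subcubes)
  then show ?thesis by (simp add: Union_subcubes)
qed

end

section \<open>Test functions and coefficients\<close>

context dyadic_grid
begin

text \<open>
  The exponent of \<open>\<theta>\<close> counts the scales between the cube of side
  \<open>2^k\<close> and its subcube of side \<open>2^j\<close>. Only oscillation on cubes of the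
  grid is restricted, so a function that is constant on the children of the cube qualifies although
  it jumps between them.
\<close>

definition test_function :: "real \<Rightarrow> int \<Rightarrow> real ^ 'n \<Rightarrow> (real ^ 'n \<Rightarrow> real) \<Rightarrow> bool" where
  "test_function \<theta> k x \<psi> \<longleftrightarrow> \<psi> \<in> borel_measurable lebesgue \<and> (LINT y:cube k x|lebesgue. \<psi> y) = 0 \<and>
     (\<forall>j\<le>k. \<forall>y\<in>cube k x. \<forall>z\<in>cube j y. \<bar>\<psi> z - \<psi> y\<bar> \<le> \<theta> ^ nat (k - j) / measure lebesgue (cube k x))"

definition coef :: "real \<Rightarrow> (real ^ 'n \<Rightarrow> real) \<Rightarrow> int \<Rightarrow> real ^ 'n \<Rightarrow> real" where
  "coef \<theta> f k x = (SUP \<psi>\<in>{\<psi>. test_function \<theta> k x \<psi>}. \<bar>LINT y:cube k x|lebesgue. f y * \<psi> y\<bar>)"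

lemma coef_cube: "y \<in> cube k x \<Longrightarrow> coef \<theta> f k y = coef \<theta> f k x"
  unfolding coef_def test_function_def using cube_eq[of y k x] by simp

lemma test_function_integrable:
  assumes "test_function \<theta> k x \<psi>"
  shows "set_integrable lebesgue (cube k x) \<psi>"
proof (rule set_integrable_bounded[OF cube_lmeasurable])
  show "\<psi> \<in> borel_measurable lebesgue" using assms by (simp add: test_function_def)
  fix z assume "z \<in> cube k x"
  then have "\<bar>\<psi> z - \<psi> x\<bar> \<le> 1 / measure lebesgue (cube k x)"
    using assms cube_self[of x k] unfolding test_function_def by force
  then show "\<bar>\<psi> z\<bar> \<le> \<bar>\<psi> x\<bar> + 1 / measure lebesgue (cube k x)" by linarith
qed

lemma test_function_bound:
  assumes t: "test_function \<theta> k x \<psi>" and y: "y \<in> cube k x"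
  shows "\<bar>\<psi> y\<bar> \<le> 1 / measure lebesgue (cube k x)"
proof -
  have "\<bar>average \<psi> (cube k x) - \<psi> y\<bar> \<le> 1 / measure lebesgue (cube k x)"
    by (rule average_near[OF cube_lmeasurable measure_cube_pos test_function_integrable[OF t]])
       (use t y cube_eq[OF y] in \<open>force simp: test_function_def\<close>)
  then show ?thesis using t by (simp add: average_def test_function_def)
qed

lemma test_function_pairing_integrable:
  assumes "test_function \<theta> k x \<psi>" "f \<in> borel_measurable lebesgue" "set_integrable lebesgue (cube k x) f"
  shows "set_integrable lebesgue (cube k x) (\<lambda>y. f y * \<psi> y)"
  by (rule set_integrable_mult_bounded[OF _ _ _ cube_sets test_function_bound])
     (use assms in \<open>auto simp: test_function_def\<close>)

lemma test_function_pairing_le: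
  assumes t: "test_function \<theta> k x \<psi>" and f: "f \<in> borel_measurable lebesgue" "set_integrable lebesgue (cube k x) f"
  shows "\<bar>LINT y:cube k x|lebesgue. f y * \<psi> y\<bar> \<le> (LINT y:cube k x|lebesgue. \<bar>f y\<bar> / measure lebesgue (cube k x))"
proof -
  have "\<bar>LINT y:cube k x|lebesgue. f y * \<psi> y\<bar> \<le> (LINT y:cube k x|lebesgue. \<bar>f y * \<psi> y\<bar>)"
    unfolding set_lebesgue_integral_def
    by (rule order_trans[OF integral_abs_bound]) (simp add: abs_mult)
  also have "\<dots> \<le> (LINT y:cube k x|lebesgue. \<bar>f y\<bar> / measure lebesgue (cube k x))"
  proof (rule set_integral_mono)
    show "set_integrable lebesgue (cube k x) (\<lambda>y. \<bar>f y * \<psi> y\<bar>)"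
      by (rule set_integrable_abs[OF test_function_pairing_integrable[OF t f]])
    show "set_integrable lebesgue (cube k x) (\<lambda>y. \<bar>f y\<bar> / measure lebesgue (cube k x))"
      using set_integrable_abs[OF f(2)] by simp
    fix y assume "y \<in> cube k x"
    then show "\<bar>f y * \<psi> y\<bar> \<le> \<bar>f y\<bar> / measure lebesgue (cube k x)"
      using mult_left_mono[OF test_function_bound[OF t, of y], of "\<bar>f y\<bar>"] by (simp add: abs_mult)
  qed
  finally show ?thesis .
qed

lemma coef_upper:
  assumes "test_function \<theta> k x \<psi>" "f \<in> borel_measurable lebesgue" "set_integrable lebesgue (cube k x) f"
  shows "\<bar>LINT y:cube k x|lebesgue. f y * \<psi> y\<bar> \<le> coef \<theta> f k x"
  unfolding coef_def
  by (rule cSUP_upper) (use assms test_function_pairing_le in \<open>auto intro!: bdd_aboveI\<close>)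

lemma test_function_zero: "0 \<le> \<theta> \<Longrightarrow> test_function \<theta> k x (\<lambda>_. 0)"
  by (simp add: test_function_def set_lebesgue_integral_def)

lemma coef_nonneg:
  assumes "0 \<le> \<theta>" "f \<in> borel_measurable lebesgue" "set_integrable lebesgue (cube k x) f"
  shows "0 \<le> coef \<theta> f k x"
  using coef_upper[OF test_function_zero assms(2,3)] assms(1) by (simp add: set_lebesgue_integral_def)

lemma coef_le:
  assumes "0 \<le> \<theta>" "\<And>\<psi>. test_function \<theta> k x \<psi> \<Longrightarrow> \<bar>LINT y:cube k x|lebesgue. f y * \<psi> y\<bar> \<le> B"
  shows "coef \<theta> f k x \<le> B"
  unfolding coef_def by (rule cSUP_least) (use assms test_function_zero[OF assms(1)] in auto)

lemma measure_subcube: "R \<in> range (cube b) \<Longrightarrow> measure lebesgue R = (2 powi b) ^ CARD('n)"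
  using measure_cube by auto

lemma tree_avg_average:
  fixes g :: "real ^ 'n \<Rightarrow> real"
  assumes g: "set_integrable lebesgue (cube (b + int k) x) g"
  shows "dyadic_tree.avg (subcubes b) (2 ^ CARD('n)) (average g) k (cube b x) = average g (cube (b + int k) x)"
proof -
  interpret T: dyadic_tree "range (cube b)" "subcubes b" "2 ^ CARD('n)" by (rule dyadic_tree_subcubes)
  have "(\<Sum>R\<in>subcubes b k (cube b x). average g R)
      = (\<Sum>R\<in>subcubes b k (cube b x). (LINT y:R|lebesgue. g y) / (2 powi b) ^ CARD('n))"
    unfolding average_def by (rule sum.cong[OF refl]) (use measure_subcube in \<open>auto simp: subcubes_cube\<close>)
  also have "\<dots> = (LINT y:cube (b + int k) x|lebesgue. g y) / (2 powi b) ^ CARD('n)"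
    by (simp add: subcubes_cube sum_set_integral_subcubes[OF g] flip: sum_divide_distrib)
  finally show ?thesis
    using measure_cube_add[of b k x x] by (simp add: T.avg_def average_def measure_cube[of b])
qed

text \<open>
  Replacing \<open>\<psi>\<close> by its averages over the cells of side \<open>2^b\<close>
  preserves the mean and the oscillation, and it changes the pairing with \<open>f\<close> by at
  most the oscillation of \<open>\<psi>\<close> on a cell times the integral of \<open>|f|\<close>.
\<close>

lemma discretise_pairing:
  fixes f \<psi> :: "real ^ 'n \<Rightarrow> real"
  assumes t: "test_function \<theta> (b + int k) x \<psi>" and \<theta>: "0 \<le> \<theta>"
    and f: "f \<in> borel_measurable lebesgue" "set_integrable lebesgue (cube (b + int k) x) f"
  defines "\<Psi> \<equiv> \<lambda>R. (2 powi b) ^ CARD('n) * average \<psi> R"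
  shows "dyadic_tree.test_fun (subcubes b) (2 ^ CARD('n)) \<theta> k (cube b x) \<Psi>"
    and "\<bar>LINT y:cube (b + int k) x|lebesgue. f y * \<psi> y\<bar>
      \<le> \<bar>\<Sum>R\<in>subcubes b k (cube b x). \<Psi> R * average f R\<bar>
        + \<theta> ^ k * average (\<lambda>y. \<bar>f y\<bar>) (cube (b + int k) x)"
proof -
  interpret T: dyadic_tree "range (cube b)" "subcubes b" "2 ^ CARD('n)" by (rule dyadic_tree_subcubes)
  let ?Q = "cube (b + int k) x" and ?S = "subcubes b k (cube b x)" and ?c = "(2 powi b :: real) ^ CARD('n)"
  have c: "0 < ?c" by simp
  have cell: "R \<in> range (cube b)" "R \<subseteq> ?Q" "R \<in> sets lebesgue" "R \<in> lmeasurable"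
    "measure lebesgue R = ?c" "0 < measure lebesgue R" if RS: "R \<in> ?S" for R
  proof -
    obtain y where y: "y \<in> ?Q" "R = cube b y" using RS by (auto simp: subcubes_cube)
    show "R \<in> range (cube b)" "R \<subseteq> ?Q" "R \<in> sets lebesgue" "R \<in> lmeasurable"
      "measure lebesgue R = ?c" "0 < measure lebesgue R"
      using y cube_mono'[of b "b + int k" y x] cube_sets cube_lmeasurable by (auto simp: measure_cube)
  qed
  note \<psi>_int = test_function_integrable[OF t]
  have \<psi>_cell: "set_integrable lebesgue R \<psi>" if "R \<in> ?S" for R
    by (rule set_integrable_subset[OF \<psi>_int]) (use cell that in auto)
  have osc: "\<bar>\<psi> z - \<psi> y\<bar> \<le> \<theta> ^ (k - j) / measure lebesgue ?Q"
    if "j \<le> k" "y \<in> ?Q" "z \<in> cube (b + int j) y" for j y z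
  proof -
    have "nat (b + int k - (b + int j)) = k - j" using that by simp
    moreover have "b + int j \<le> b + int k" using that by simp
    ultimately show ?thesis using t that unfolding test_function_def by metis
  qed
  have mQ: "measure lebesgue ?Q = (2 ^ CARD('n)) ^ k * ?c"
    using measure_cube_add[of b k x x] by (simp add: measure_cube[of b])
  show "T.test_fun \<theta> k (cube b x) \<Psi>"
    unfolding T.test_fun_def
  proof (intro conjI allI impI ballI)
    have "sum \<Psi> ?S = (\<Sum>R\<in>?S. LINT y:R|lebesgue. \<psi> y)"
      unfolding \<Psi>_def average_def by (rule sum.cong[OF refl]) (use cell(5) in simp)
    also have "\<dots> = 0"
      using t by (simp add: subcubes_cube sum_set_integral_subcubes[OF \<psi>_int] test_function_def)
    finally show "sum \<Psi> ?S = 0" .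
  next
    fix j R R' assume j: "j \<le> k" and R: "R \<in> ?S" and R': "R' \<in> subcubes b j R"
    obtain y where y: "y \<in> ?Q" "R = cube b y" using R by (auto simp: subcubes_cube)
    obtain z where z: "z \<in> cube (b + int j) y" "R' = cube b z" using R' y by (auto simp: subcubes_cube)
    have R'S: "R' \<in> ?S" using z cube_mono'[of "b + int j" "b + int k" y x] y j by (auto simp: subcubes_cube)
    let ?e = "\<theta> ^ (k - j) / measure lebesgue ?Q"
    have "\<bar>average \<psi> R' - average \<psi> R\<bar> \<le> ?e"
    proof (rule average_near[OF cell(4,6)[OF R'S] \<psi>_cell[OF R'S]])
      fix u assume u: "u \<in> R'"
      have uy: "u \<in> cube (b + int j) y" using u z cube_mono'[of b "b + int j" z y] by auto
      have "\<bar>average \<psi> R - \<psi> u\<bar> \<le> ?e"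
      proof (rule average_near[OF cell(4,6)[OF R] \<psi>_cell[OF R]])
        fix v assume v: "v \<in> R"
        have "v \<in> cube (b + int j) u"
          using v y(2) cube_mono[of b "b + int j" y] cube_eq[OF uy] by auto
        then show "\<bar>\<psi> v - \<psi> u\<bar> \<le> ?e" using osc[OF j, of u v] cell(2)[OF R'S] u by auto
      qed
      then show "\<bar>\<psi> u - average \<psi> R\<bar> \<le> ?e" by linarith
    qed
    then have "?c * \<bar>average \<psi> R' - average \<psi> R\<bar> \<le> ?c * ?e" using c by (intro mult_left_mono) auto
    also have "?c * ?e = \<theta> ^ (k - j) / real (2 ^ CARD('n)) ^ k" using c by (simp add: mQ)
    finally show "\<bar>\<Psi> R' - \<Psi> R\<bar> \<le> \<theta> ^ (k - j) / real (2 ^ CARD('n)) ^ k"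
      using c by (simp add: \<Psi>_def abs_mult flip: right_diff_distrib)
  qed
  note p_int = test_function_pairing_integrable[OF t f]
  have cellbound: "\<bar>(LINT y:R|lebesgue. f y * \<psi> y) - \<Psi> R * average f R\<bar>
      \<le> \<theta> ^ k / measure lebesgue ?Q * (LINT y:R|lebesgue. \<bar>f y\<bar>)" if R: "R \<in> ?S" for R
  proof -
    let ?e = "\<theta> ^ k / measure lebesgue ?Q"
    have fR: "set_integrable lebesgue R f" and pR: "set_integrable lebesgue R (\<lambda>y. f y * \<psi> y)"
      using set_integrable_subset[OF f(2)] set_integrable_subset[OF p_int] cell[OF R] by auto
    have dR: "set_integrable lebesgue R (\<lambda>y. f y * \<psi> y - average \<psi> R * f y)"
      using fR pR by (intro set_integral_diff) auto
    have "(LINT y:R|lebesgue. f y * \<psi> y) - \<Psi> R * average f R = (LINT y:R|lebesgue. f y * \<psi> y - average \<psi> R * f y)"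
      using fR pR cell(5)[OF R] c by (simp add: \<Psi>_def average_def[of f] mult_ac)
    also have "\<bar>\<dots>\<bar> \<le> (LINT y:R|lebesgue. \<bar>f y * \<psi> y - average \<psi> R * f y\<bar>)"
      unfolding set_lebesgue_integral_def by (rule order_trans[OF integral_abs_bound]) (simp add: abs_mult)
    also have "\<dots> \<le> (LINT y:R|lebesgue. ?e * \<bar>f y\<bar>)"
    proof (rule set_integral_mono)
      fix y assume y: "y \<in> R"
      have "\<bar>average \<psi> R - \<psi> y\<bar> \<le> ?e"
      proof (rule average_near[OF cell(4,6)[OF R] \<psi>_cell[OF R]])
        fix v assume v: "v \<in> R"
        have "v \<in> cube b y" using cell(1)[OF R] y v by (auto simp: cube_def)
        then show "\<bar>\<psi> v - \<psi> y\<bar> \<le> ?e" using osc[of 0 y v] cell(2)[OF R] y by auto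
      qed
      then have "\<bar>f y\<bar> * \<bar>\<psi> y - average \<psi> R\<bar> \<le> \<bar>f y\<bar> * ?e" by (intro mult_left_mono) auto
      then show "\<bar>f y * \<psi> y - average \<psi> R * f y\<bar> \<le> ?e * \<bar>f y\<bar>"
        by (simp add: abs_mult[symmetric] algebra_simps)
    qed (use set_integrable_abs[OF dR] set_integrable_abs[OF fR] in auto)
    finally show ?thesis by simp
  qed
  have "(LINT y:?Q|lebesgue. f y * \<psi> y) = (\<Sum>R\<in>?S. LINT y:R|lebesgue. f y * \<psi> y)"
    by (simp add: subcubes_cube sum_set_integral_subcubes[OF p_int])
  then have "\<bar>(LINT y:?Q|lebesgue. f y * \<psi> y) - (\<Sum>R\<in>?S. \<Psi> R * average f R)\<bar>
      = \<bar>\<Sum>R\<in>?S. (LINT y:R|lebesgue. f y * \<psi> y) - \<Psi> R * average f R\<bar>"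
    by (simp add: sum_subtractf)
  also have "\<dots> \<le> (\<Sum>R\<in>?S. \<theta> ^ k / measure lebesgue ?Q * (LINT y:R|lebesgue. \<bar>f y\<bar>))"
    by (rule order_trans[OF sum_abs sum_mono]) (rule cellbound)
  also have "\<dots> = \<theta> ^ k * average (\<lambda>y. \<bar>f y\<bar>) ?Q"
    unfolding sum_distrib_left[symmetric] subcubes_cube
      sum_set_integral_subcubes[OF set_integrable_abs[OF f(2)]] average_def by simp
  finally show "\<bar>LINT y:?Q|lebesgue. f y * \<psi> y\<bar> \<le> \<bar>\<Sum>R\<in>?S. \<Psi> R * average f R\<bar> + \<theta> ^ k * average (\<lambda>y. \<bar>f y\<bar>) ?Q"
    by linarith
qed

end

section \<open>The weighted bound on a grid\<close>

definition bound_const :: "nat \<Rightarrow> real \<Rightarrow> real \<Rightarrow> real \<Rightarrow> real" where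
  "bound_const n \<theta> p L =
     (768 * (1 / (1 - \<theta>))\<^sup>2 * (2 ^ n)\<^sup>2 * (p / (p - 1))\<^sup>2 * (p / 2) * L) powr (p / 2)"

text \<open>
  The characteristic of the weight enters through \<open>half_bound\<close>, with \<open>L\<close> a
  multiple of its square. The factorisation \<open>f_eq\<close> of \<open>f\<close> comes from
  \<open>\<sigma> = w^(-1/(p-1))\<close> at the points where \<open>w\<close> is positive, hence
  almost everywhere.
\<close>

locale weighted_grid = dyadic_grid s for s :: "int \<Rightarrow> real ^ 'n" +
  fixes w \<sigma> v f :: "real ^ 'n \<Rightarrow> real" and \<theta> p L :: real
  assumes theta: "0 \<le> \<theta>" "\<theta> < 1" and p: "2 < p"
    and nonneg: "\<And>y. 0 \<le> w y" "\<And>y. 0 \<le> \<sigma> y" "\<And>y. 0 \<le> v y"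
    and w_int: "\<And>k x. set_integrable lebesgue (cube k x) w"
    and \<sigma>_int: "\<And>k x. set_integrable lebesgue (cube k x) \<sigma>"
    and w_pos: "\<And>k x. 0 < average w (cube k x)"
    and \<sigma>_pos: "\<And>k x. 0 < average \<sigma> (cube k x)"
    and v_eq: "\<And>y. v y = \<sigma> y powr (2 / p) * w y powr (1 - 2 / p)"
    and f_meas: "f \<in> borel_measurable lebesgue"
    and fp_int: "\<And>k x. set_integrable lebesgue (cube k x) (\<lambda>y. \<bar>f y\<bar> powr p * w y)"
    and f_eq: "AE y in lebesgue. \<bar>f y\<bar> = (\<bar>f y\<bar> powr p * w y) powr (1 / p) * \<sigma> y powr (1 - 1 / p)"
    and L_nonneg: "0 \<le> L"
    and half_bound: "\<And>k x E. E \<in> sets lebesgue \<Longrightarrow> E \<subseteq> cube k x \<Longrightarrow>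
        measure lebesgue (cube k x) \<le> 2 * measure lebesgue E \<Longrightarrow>
        (average \<sigma> (cube k x))\<^sup>2 * average w (cube k x) * measure lebesgue (cube k x) \<le> L * (LINT y:E|lebesgue. v y)"
begin

lemma v_int: "set_integrable lebesgue (cube k x) v"
  unfolding v_eq by (rule set_Hoelder(1)[OF \<sigma>_int w_int nonneg(2,1)]) (use p in auto)

lemma average_v_le:
  "average v (cube k x) \<le> average \<sigma> (cube k x) powr (2 / p) * average w (cube k x) powr (1 - 2 / p)"
  unfolding v_eq by (rule average_Hoelder[OF \<sigma>_int w_int nonneg(2,1)]) (use p measure_cube_pos in auto)

lemma f_prod_int:
  "set_integrable lebesgue (cube k x) (\<lambda>y. (\<bar>f y\<bar> powr p * w y) powr (1 / p) * \<sigma> y powr (1 - 1 / p))"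
  by (rule set_Hoelder(1)[OF fp_int \<sigma>_int _ nonneg(2)]) (use p nonneg in auto)

lemma f_int: "set_integrable lebesgue (cube k x) f"
proof (rule set_integrable_bound[OF f_prod_int])
  show "set_borel_measurable lebesgue (cube k x) f"
    using f_meas cube_sets by (auto simp: set_borel_measurable_def)
  show "AE y in lebesgue. y \<in> cube k x \<longrightarrow>
      norm (f y) \<le> norm ((\<bar>f y\<bar> powr p * w y) powr (1 / p) * \<sigma> y powr (1 - 1 / p))"
    using f_eq by eventually_elim auto
qed

lemma average_f_le:
  "average (\<lambda>y. \<bar>f y\<bar>) (cube k x)
    \<le> average (\<lambda>y. \<bar>f y\<bar> powr p * w y) (cube k x) powr (1 / p) * average \<sigma> (cube k x) powr (1 - 1 / p)"
proof -
  have "(LINT y:cube k x|lebesgue. \<bar>f y\<bar>)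
      \<le> (LINT y:cube k x|lebesgue. (\<bar>f y\<bar> powr p * w y) powr (1 / p) * \<sigma> y powr (1 - 1 / p))"
    by (rule set_integral_mono_AE[OF set_integrable_abs[OF f_int] f_prod_int])
       (use f_eq in \<open>eventually_elim, auto\<close>)
  then have "average (\<lambda>y. \<bar>f y\<bar>) (cube k x)
      \<le> average (\<lambda>y. (\<bar>f y\<bar> powr p * w y) powr (1 / p) * \<sigma> y powr (1 - 1 / p)) (cube k x)"
    unfolding average_def by (intro divide_right_mono) auto
  also have "\<dots> \<le> average (\<lambda>y. \<bar>f y\<bar> powr p * w y) (cube k x) powr (1 / p) * average \<sigma> (cube k x) powr (1 - 1 / p)"
    by (rule average_Hoelder[OF fp_int \<sigma>_int _ nonneg(2)]) (use p nonneg measure_cube_pos in auto)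
  finally show ?thesis .
qed

lemma average_nonneg: "(\<And>y. 0 \<le> g y) \<Longrightarrow> 0 \<le> average g A"
  unfolding average_def set_lebesgue_integral_def
  by (intro divide_nonneg_nonneg integral_nonneg_AE) auto

abbreviation "square_sum b N y \<equiv> (\<Sum>j\<le>N. (coef \<theta> f (b + int j) y)\<^sup>2)"

lemma square_sum_cell:
  assumes "y \<in> cube b z"
  shows "square_sum b N y = square_sum b N z"
proof (rule sum.cong[OF refl])
  fix j
  have "y \<in> cube (b + int j) z" using assms cube_mono[of b "b + int j" z] by auto
  then show "(coef \<theta> f (b + int j) y)\<^sup>2 = (coef \<theta> f (b + int j) z)\<^sup>2" by (simp add: coef_cube)
qed

text \<open>
  The tree of cells of side \<open>2^b\<close> in a cube, with every function replaced by its
  averages over the cells; Hoelder's inequality on a single cell controls the averages of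
  \<open>|f|\<close> and of \<open>v\<close>.
\<close>

lemma discrete_bound:
  "(\<Sum>R\<in>cube b ` cube (b + int N) x. square_sum b N (SOME z. z \<in> R) powr (p / 2) * average w R)
    \<le> bound_const CARD('n) \<theta> p L * (\<Sum>R\<in>cube b ` cube (b + int N) x. average (\<lambda>y. \<bar>f y\<bar> powr p * w y) R)"
proof -
  let ?D = "2 ^ CARD('n)" and ?X = "range (cube b)" and ?c = "(2 powi b :: real) ^ CARD('n)"
  interpret T: dyadic_tree ?X "subcubes b" ?D by (rule dyadic_tree_subcubes)
  define pt where "pt R = (SOME z. z \<in> R)" for R :: "(real ^ 'n) set"
  have pt: "pt R \<in> R" "R = cube b (pt R)" if RX: "R \<in> ?X" for R
  proof -
    obtain y where y: "R = cube b y" using RX by auto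
    show "pt R \<in> R" unfolding pt_def by (rule someI[of _ y]) (use y cube_self in auto)
    then show "R = cube b (pt R)" using cube_eq y by auto
  qed
  let ?G = "average (\<lambda>y. \<bar>f y\<bar>)" and ?W = "average (\<lambda>y. \<bar>f y\<bar> powr p * w y)"
  define a where "a k R = coef \<theta> f (b + int k) (pt R)" for k R
  have c: "0 < ?c" by simp
  have Q: "cube b x \<in> ?X" by simp
  have avgT: "T.avg (average g) k R = average g (cube (b + int k) (pt R))"
    if "\<And>k x. set_integrable lebesgue (cube k x) g" "R \<in> ?X" for g k R
    using tree_avg_average[OF that(1), of b k "pt R"] pt(2)[OF that(2)] by simp
  have "(\<Sum>R\<in>subcubes b N (cube b x). (\<Sum>k\<le>N. (a k R)\<^sup>2) powr (p / 2) * average w R)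
     \<le> (768 * (1 / (1 - \<theta>))\<^sup>2 * (real ?D)\<^sup>2 * (p / (p - 1))\<^sup>2 * (p / 2) * L) powr (p / 2)
        * (\<Sum>R\<in>subcubes b N (cube b x). (?G R / average \<sigma> R) powr p * average \<sigma> R)"
  proof (rule T.weighted_bound[where F="average f" and v="average v", OF Q theta p])
    fix R assume R: "R \<in> ?X"
    obtain z where z: "R = cube b z" using R by auto
    show "\<bar>average f R\<bar> \<le> ?G R"
    proof -
      have "\<bar>LINT y:R|lebesgue. f y\<bar> \<le> (LINT y:R|lebesgue. \<bar>f y\<bar>)"
        unfolding set_lebesgue_integral_def by (rule order_trans[OF integral_abs_bound]) (simp add: abs_mult)
      then show ?thesis unfolding average_def by (simp add: divide_right_mono)
    qed
    show "0 < average w R" "0 < average \<sigma> R" "0 \<le> average v R"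
      unfolding z by (rule w_pos, rule \<sigma>_pos, rule average_nonneg, rule nonneg(3))
    show "average v R \<le> average \<sigma> R powr (2 / p) * average w R powr (1 - 2 / p)"
      unfolding z by (rule average_v_le)
    show "a k R' = a k R" if "R' \<in> subcubes b k R" for k R'
    proof -
      have "R' \<in> ?X" using that T.C_sub R by blast
      moreover have "R' \<subseteq> cube (b + int k) z"
        using that Union_subcubes[of b k z] unfolding z subcubes_cube by blast
      ultimately have R': "pt R' \<in> cube (b + int k) z" using pt(1) by blast
      have "pt R \<in> cube (b + int k) z" using pt(1)[OF R] z cube_mono[of b "b + int k" z] by auto
      then show ?thesis unfolding a_def using coef_cube R' by simp
    qed
    fix k B
    assume B: "\<And>\<psi>. T.test_fun \<theta> k R \<psi> \<Longrightarrow> \<bar>\<Sum>z\<in>subcubes b k R. \<psi> z * average f z\<bar> + \<theta> ^ k * T.avg ?G k R \<le> B"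
    show "a k R \<le> B"
      unfolding a_def
    proof (rule coef_le[OF theta(1)])
      fix \<psi> assume t: "test_function \<theta> (b + int k) (pt R) \<psi>"
      note d = discretise_pairing[OF t theta(1) f_meas f_int, folded pt(2)[OF R]]
      show "\<bar>LINT y:cube (b + int k) (pt R)|lebesgue. f y * \<psi> y\<bar> \<le> B"
        using d(2) B[OF d(1)] unfolding avgT[OF set_integrable_abs[OF f_int] R, of k] by (rule order_trans)
    qed
  next
    fix k R E assume R: "R \<in> ?X" and E: "E \<subseteq> subcubes b k R" "card (subcubes b k R) \<le> 2 * card E"
    let ?Q = "cube (b + int k) (pt R)"
    have sub: "subcubes b k R = cube b ` ?Q" using subcubes_cube[of b k "pt R"] pt(2)[OF R] by simp
    have EX: "E \<subseteq> ?X" using E(1) sub by auto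
    have finE: "finite E" by (rule finite_subset[OF E(1)]) (simp add: sub finite_subcubes)
    have setsE: "R \<in> sets lebesgue" if "R \<in> E" for R using that EX cube_sets by auto
    have mE: "measure lebesgue (\<Union>E) = real (card E) * ?c" by (rule measure_finite_subcubes[OF finE EX])
    have mQ: "measure lebesgue ?Q = real (card (subcubes b k R)) * ?c"
      using measure_finite_subcubes[OF finite_subcubes[of b k "pt R"] image_mono[OF subset_UNIV]]
      unfolding Union_subcubes sub .
    have UE: "\<Union>E \<subseteq> ?Q" using E(1) sub Union_subcubes[of b k "pt R"] by blast
    have "(average \<sigma> ?Q)\<^sup>2 * average w ?Q * measure lebesgue ?Q \<le> L * (LINT y:\<Union>E|lebesgue. v y)"
    proof (rule half_bound[OF _ UE])
      show "\<Union>E \<in> sets lebesgue" using finE setsE by (intro sets.finite_Union) auto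
      have "real (card (subcubes b k R)) * ?c \<le> real (2 * card E) * ?c"
        by (intro mult_right_mono) (use E(2) in auto)
      then show "measure lebesgue ?Q \<le> 2 * measure lebesgue (\<Union>E)" unfolding mE mQ by simp
    qed
    also have "(LINT y:\<Union>E|lebesgue. v y) = (\<Sum>R\<in>E. LINT y:R|lebesgue. v y)"
    proof -
      have "(LINT y:(\<Union>R\<in>E. R)|lebesgue. v y) = (\<Sum>R\<in>E. LINT y:R|lebesgue. v y)"
      proof (rule set_integral_finite_Union[OF finE])
        show "disjoint_family_on (\<lambda>R. R) E"
          unfolding disjoint_family_on_def disjnt_def[symmetric]
          by (intro ballI impI) (rule cubes_disjoint[of _ b], use EX in auto)
        show "set_integrable lebesgue R v" if "R \<in> E" for R using that EX v_int by auto
      qed (rule setsE)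
      then show ?thesis by simp
    qed
    also have "\<dots> = (\<Sum>R\<in>E. average v R * ?c)"
    proof (rule sum.cong[OF refl])
      fix R assume "R \<in> E"
      then have "measure lebesgue R = ?c" using EX measure_subcube by blast
      then show "(LINT y:R|lebesgue. v y) = average v R * ?c" using c by (simp add: average_def)
    qed
    finally have "((average \<sigma> ?Q)\<^sup>2 * average w ?Q * real ?D ^ k) * ?c \<le> (L * sum (average v) E) * ?c"
      using T.C_card[OF R] by (simp add: mQ mult_ac flip: sum_distrib_right)
    then have "(average \<sigma> ?Q)\<^sup>2 * average w ?Q * real ?D ^ k \<le> L * sum (average v) E"
      by (rule mult_right_le_imp_le) (rule c)
    then show "(T.avg (average \<sigma>) k R)\<^sup>2 * T.avg (average w) k R * real ?D ^ k \<le> L * sum (average v) E"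
      by (simp only: avgT[OF \<sigma>_int R] avgT[OF w_int R])
  next
    show "0 \<le> a k R" for k R unfolding a_def by (rule coef_nonneg[OF theta(1) f_meas f_int])
  qed (rule L_nonneg)
  also have "\<dots> \<le> (768 * (1 / (1 - \<theta>))\<^sup>2 * (real ?D)\<^sup>2 * (p / (p - 1))\<^sup>2 * (p / 2) * L) powr (p / 2)
        * (\<Sum>R\<in>subcubes b N (cube b x). ?W R)"
  proof (intro mult_left_mono sum_mono)
    fix R assume "R \<in> subcubes b N (cube b x)"
    then obtain z where z: "R = cube b z" by (auto simp: subcubes_cube)
    let ?S = "average \<sigma> R"
    have S: "0 < ?S" using \<sigma>_pos z by simp
    have W0: "0 \<le> ?W R" by (rule average_nonneg) (use nonneg in auto)
    have G0: "0 \<le> ?G R" by (rule average_nonneg) auto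
    have "?G R powr p \<le> (?W R powr (1 / p) * ?S powr (1 - 1 / p)) powr p"
      using average_f_le[of b z] z G0 p by (intro powr_mono2) auto
    also have "\<dots> = ?W R * ?S powr (p - 1)"
    proof -
      have e: "(1 - 1 / p) * p = p - 1" using p by (simp add: field_simps)
      show ?thesis using W0 S p by (subst powr_mult) (auto simp: powr_powr e)
    qed
    finally have "?G R powr p \<le> ?W R * ?S powr (p - 1)" .
    then have "?G R powr p * (?S powr (1 - p)) \<le> ?W R * ?S powr (p - 1) * (?S powr (1 - p))"
      by (rule mult_right_mono) simp
    also have "\<dots> = ?W R" using S by (simp add: mult.assoc flip: powr_add)
    also have "?G R powr p * (?S powr (1 - p)) = (?G R / ?S) powr p * ?S"
      using S G0 by (simp add: powr_divide powr_diff)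
    finally show "(?G R / ?S) powr p * ?S \<le> ?W R" .
  qed simp
  finally show ?thesis
    unfolding subcubes_cube a_def pt_def bound_const_def by simp
qed

lemma local_bound:
  shows "set_integrable lebesgue (cube (b + int N) x) (\<lambda>y. square_sum b N y powr (p / 2) * w y)"
    and "(LINT y:cube (b + int N) x|lebesgue. square_sum b N y powr (p / 2) * w y)
      \<le> bound_const CARD('n) \<theta> p L * (LINT y:cube (b + int N) x|lebesgue. \<bar>f y\<bar> powr p * w y)"
proof -
  let ?Q = "cube (b + int N) x" and ?S = "cube b ` cube (b + int N) x" and ?c = "(2 powi b :: real) ^ CARD('n)"
  let ?g = "\<lambda>y. square_sum b N y powr (p / 2) * w y"
  have cell: "set_integrable lebesgue R ?g"
    "(LINT y:R|lebesgue. ?g y) = ?c * (square_sum b N (SOME z. z \<in> R) powr (p / 2) * average w R)" if R: "R \<in> ?S" for R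
  proof -
    obtain y where y: "R = cube b y" using R by auto
    have "(SOME z. z \<in> R) \<in> R" by (rule someI[of _ y]) (use y cube_self in auto)
    then have t: "square_sum b N z = square_sum b N (SOME z. z \<in> R)" if "z \<in> R" for z
      using square_sum_cell[of z b y] square_sum_cell[of "SOME z. z \<in> R" b y] that unfolding y by metis
    have e: "indicator R z *\<^sub>R ?g z = indicator R z *\<^sub>R (square_sum b N (SOME z. z \<in> R) powr (p / 2) * w z)" for z
      using t[of z] by (cases "z \<in> R") (auto simp: indicator_def)
    have "set_integrable lebesgue R w" using w_int[of b y] y by simp
    then have "set_integrable lebesgue R (\<lambda>z. square_sum b N (SOME z. z \<in> R) powr (p / 2) * w z)" by simp
    then show "set_integrable lebesgue R ?g" unfolding set_integrable_def e .
    have "(LINT y:R|lebesgue. ?g y) = (LINT z:R|lebesgue. square_sum b N (SOME z. z \<in> R) powr (p / 2) * w z)"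
      unfolding set_lebesgue_integral_def e ..
    then show "(LINT y:R|lebesgue. ?g y) = ?c * (square_sum b N (SOME z. z \<in> R) powr (p / 2) * average w R)"
      by (simp add: average_def y measure_cube)
  qed
  have "set_integrable lebesgue (\<Union>R\<in>?S. R) ?g"
    by (rule set_integrable_UN) (use finite_subcubes cell cube_sets in auto)
  then show int: "set_integrable lebesgue ?Q ?g" by (simp add: Union_subcubes)
  have "(LINT y:?Q|lebesgue. ?g y) = (\<Sum>R\<in>?S. LINT y:R|lebesgue. ?g y)"
    by (rule sum_set_integral_subcubes[OF int, symmetric])
  also have "\<dots> = ?c * (\<Sum>R\<in>?S. square_sum b N (SOME z. z \<in> R) powr (p / 2) * average w R)"
    using cell(2) by (simp add: sum_distrib_left)
  also have "\<dots> \<le> ?c * (bound_const CARD('n) \<theta> p L * (\<Sum>R\<in>?S. average (\<lambda>y. \<bar>f y\<bar> powr p * w y) R))"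
    by (rule mult_left_mono[OF discrete_bound]) simp
  also have "\<dots> = bound_const CARD('n) \<theta> p L * (\<Sum>R\<in>?S. ?c * average (\<lambda>y. \<bar>f y\<bar> powr p * w y) R)"
    by (simp add: sum_distrib_left mult_ac)
  also have "(\<Sum>R\<in>?S. ?c * average (\<lambda>y. \<bar>f y\<bar> powr p * w y) R) = (\<Sum>R\<in>?S. LINT y:R|lebesgue. \<bar>f y\<bar> powr p * w y)"
    by (rule sum.cong[OF refl]) (auto simp: average_def measure_cube)
  also have "\<dots> = (LINT y:?Q|lebesgue. \<bar>f y\<bar> powr p * w y)"
    by (rule sum_set_integral_subcubes[OF fp_int])
  finally show "(LINT y:?Q|lebesgue. ?g y) \<le> bound_const CARD('n) \<theta> p L * (LINT y:?Q|lebesgue. \<bar>f y\<bar> powr p * w y)" .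
qed

end

lemma nn_set_integral_eq_LINT:
  fixes g :: "'a \<Rightarrow> real"
  assumes "set_integrable M A g" "\<And>x. 0 \<le> g x"
  shows "(\<integral>\<^sup>+x\<in>A. ennreal (g x) \<partial>M) = ennreal (LINT x:A|M. g x)"
proof -
  have "(\<integral>\<^sup>+x\<in>A. ennreal (g x) \<partial>M) = (\<integral>\<^sup>+x. ennreal (indicator A x *\<^sub>R g x) \<partial>M)"
    by (rule nn_integral_cong) (simp add: indicator_def)
  also have "\<dots> = ennreal (LINT x:A|M. g x)"
    unfolding set_lebesgue_integral_def
    by (rule nn_integral_eq_integral) (use assms in \<open>auto simp: set_integrable_def\<close>)
  finally show ?thesis .
qed

context dyadic_grid
begin

lemma measurable_of_cubes:
  fixes g :: "real ^ 'n \<Rightarrow> 'b :: topological_space"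
  assumes "\<And>x y. y \<in> cube k x \<Longrightarrow> g y = g x"
  shows "g \<in> borel_measurable lebesgue"
proof (rule measurableI)
  fix S :: "'b set" assume "S \<in> sets borel"
  have "g -` S \<inter> space lebesgue = \<Union>{R \<in> range (cube k). R \<subseteq> g -` S}"
  proof (intro equalityI subsetI)
    fix x assume "x \<in> g -` S \<inter> space lebesgue"
    then have "cube k x \<subseteq> g -` S" using assms[of _ x] by auto
    then show "x \<in> \<Union>{R \<in> range (cube k). R \<subseteq> g -` S}" using cube_self by blast
  qed auto
  also have "\<dots> \<in> sets lebesgue"
  proof (rule sets.countable_Union)
    show "countable {R \<in> range (cube k). R \<subseteq> g -` S}"
      by (rule countable_subset[OF _ cubes_countable[of k]]) auto
  qed (use cube_sets in auto)
  finally show "g -` S \<inter> space lebesgue \<in> sets lebesgue" .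
qed simp

lemma nn_integral_cubes_mono:
  assumes [measurable]: "g \<in> borel_measurable lebesgue" "h \<in> borel_measurable lebesgue"
    and le: "\<And>x. (\<integral>\<^sup>+y\<in>cube k x. g y \<partial>lebesgue) \<le> C * (\<integral>\<^sup>+y\<in>cube k x. h y \<partial>lebesgue)"
  shows "(\<integral>\<^sup>+y. g y \<partial>lebesgue) \<le> C * (\<integral>\<^sup>+y. h y \<partial>lebesgue)"
proof -
  have tot: "(\<integral>\<^sup>+y. q y \<partial>lebesgue) = (\<integral>\<^sup>+R. (\<integral>\<^sup>+y\<in>R. q y \<partial>lebesgue) \<partial>count_space (range (cube k)))"
    if [measurable]: "q \<in> borel_measurable lebesgue" for q
  proof -
    have U: "(\<Union>R\<in>range (cube k). R) = UNIV" using cube_self by auto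
    have "(\<integral>\<^sup>+y. q y \<partial>lebesgue) = emeasure (density lebesgue q) (\<Union>R\<in>range (cube k). R)"
      unfolding U by (simp add: emeasure_density)
    also have "\<dots> = (\<integral>\<^sup>+R. emeasure (density lebesgue q) R \<partial>count_space (range (cube k)))"
    proof (rule emeasure_UN_countable[OF _ cubes_countable])
      show "disjoint_family_on (\<lambda>R. R) (range (cube k))" by (auto simp: disjoint_family_on_def cube_def)
    qed (use cube_sets in auto)
    also have "\<dots> = (\<integral>\<^sup>+R. (\<integral>\<^sup>+y\<in>R. q y \<partial>lebesgue) \<partial>count_space (range (cube k)))"
      by (rule nn_integral_cong) (use cube_sets in \<open>auto simp: emeasure_density\<close>)
    finally show ?thesis .
  qed
  have "(\<integral>\<^sup>+y. g y \<partial>lebesgue) \<le> (\<integral>\<^sup>+R. C * (\<integral>\<^sup>+y\<in>R. h y \<partial>lebesgue) \<partial>count_space (range (cube k)))"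
    unfolding tot[OF assms(1)] by (rule nn_integral_mono) (use le in auto)
  also have "\<dots> = C * (\<integral>\<^sup>+y. h y \<partial>lebesgue)"
    unfolding tot[OF assms(2)] by (rule nn_integral_cmult) simp
  finally show ?thesis .
qed

definition coef_sum :: "real \<Rightarrow> (real ^ 'n \<Rightarrow> real) \<Rightarrow> nat \<Rightarrow> real ^ 'n \<Rightarrow> real" where
  "coef_sum \<theta> f m y = (\<Sum>k\<in>{- int m..int m}. (coef \<theta> f k y)\<^sup>2)"

lemma coef_measurable: "coef \<theta> f k \<in> borel_measurable lebesgue"
  by (rule measurable_of_cubes[of k]) (rule coef_cube)

lemma coef_sum_measurable [measurable]: "coef_sum \<theta> f m \<in> borel_measurable lebesgue"
  unfolding coef_sum_def using coef_measurable by measurable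

lemma coef_sum_nonneg: "0 \<le> coef_sum \<theta> f m y"
  by (simp add: coef_sum_def sum_nonneg)

lemma coef_sum_mono: "m \<le> m' \<Longrightarrow> coef_sum \<theta> f m y \<le> coef_sum \<theta> f m' y"
  unfolding coef_sum_def by (rule sum_mono2) auto

end

context weighted_grid
begin

lemma coef_sum_eq: "coef_sum \<theta> f m y = square_sum (- int m) (2 * m) y"
  unfolding coef_sum_def
  by (rule sum.reindex_bij_witness[of _ "\<lambda>j. - int m + int j" "\<lambda>k. nat (k + int m)"]) auto

lemma truncated_bound:
  assumes [measurable]: "w \<in> borel_measurable lebesgue"
  shows "(\<integral>\<^sup>+y. ennreal (coef_sum \<theta> f m y powr (p / 2) * w y) \<partial>lebesgue)
    \<le> ennreal (bound_const CARD('n) \<theta> p L) * (\<integral>\<^sup>+y. ennreal (\<bar>f y\<bar> powr p * w y) \<partial>lebesgue)"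
proof (rule nn_integral_cubes_mono[of _ _ "- int m + int (2 * m)"])
  note [measurable] = f_meas
  show "(\<lambda>y. ennreal (\<bar>f y\<bar> powr p * w y)) \<in> borel_measurable lebesgue" by measurable
  fix x
  let ?Q = "cube (- int m + int (2 * m)) x"
  have "(\<integral>\<^sup>+y\<in>?Q. ennreal (coef_sum \<theta> f m y powr (p / 2) * w y) \<partial>lebesgue)
      = ennreal (LINT y:?Q|lebesgue. square_sum (- int m) (2 * m) y powr (p / 2) * w y)"
    unfolding coef_sum_eq by (rule nn_set_integral_eq_LINT[OF local_bound(1)]) (use nonneg in auto)
  also have "\<dots> \<le> ennreal (bound_const CARD('n) \<theta> p L * (LINT y:?Q|lebesgue. \<bar>f y\<bar> powr p * w y))"
    by (intro ennreal_leI local_bound(2))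
  also have "\<dots> = ennreal (bound_const CARD('n) \<theta> p L) * (\<integral>\<^sup>+y\<in>?Q. ennreal (\<bar>f y\<bar> powr p * w y) \<partial>lebesgue)"
    using nonneg by (subst nn_set_integral_eq_LINT[OF fp_int]) (auto simp: ennreal_mult' bound_const_def)
  finally show "(\<integral>\<^sup>+y\<in>?Q. ennreal (coef_sum \<theta> f m y powr (p / 2) * w y) \<partial>lebesgue)
     \<le> ennreal (bound_const CARD('n) \<theta> p L) * (\<integral>\<^sup>+y\<in>?Q. ennreal (\<bar>f y\<bar> powr p * w y) \<partial>lebesgue)" .
qed simp

text \<open>
  The cubes of side \<open>2^m\<close> partition the space and the bound on each of them does not
  depend on \<open>m\<close>, so the finite range of scales can be exhausted by monotone
  convergence.
\<close>

lemma global_bound: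
  assumes [measurable]: "w \<in> borel_measurable lebesgue"
  shows "(\<integral>\<^sup>+y. (SUP m. ennreal (coef_sum \<theta> f m y powr (p / 2) * w y)) \<partial>lebesgue)
    \<le> ennreal (bound_const CARD('n) \<theta> p L) * (\<integral>\<^sup>+y. ennreal (\<bar>f y\<bar> powr p * w y) \<partial>lebesgue)"
proof -
  have "(\<integral>\<^sup>+y. (SUP m. ennreal (coef_sum \<theta> f m y powr (p / 2) * w y)) \<partial>lebesgue)
      = (SUP m. \<integral>\<^sup>+y. ennreal (coef_sum \<theta> f m y powr (p / 2) * w y) \<partial>lebesgue)"
  proof (rule nn_integral_monotone_convergence_SUP)
    show "incseq (\<lambda>m y. ennreal (coef_sum \<theta> f m y powr (p / 2) * w y))"
      unfolding incseq_def le_fun_def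
      by (intro allI impI ennreal_leI mult_right_mono powr_mono2 coef_sum_mono coef_sum_nonneg nonneg)
         (use p in auto)
  qed measurable
  also have "\<dots> \<le> ennreal (bound_const CARD('n) \<theta> p L) * (\<integral>\<^sup>+y. ennreal (\<bar>f y\<bar> powr p * w y) \<partial>lebesgue)"
    by (rule SUP_least) (rule truncated_bound[OF assms])
  finally show ?thesis .
qed

end

section \<open>Powers of extended non-negative reals\<close>

lemma ennreal_powr_ennreal:
  assumes "0 \<le> x" "0 < a"
  shows "ennreal_powr (ennreal x) a = ennreal (x powr a)"
  using assms by (auto simp: ennreal_powr_def)

lemma ennreal_powr_mono:
  assumes "x \<le> y" "0 < a"
  shows "ennreal_powr x a \<le> ennreal_powr y a"
proof (cases "y = \<infinity>")
  case True
  then show ?thesis using assms by (simp add: ennreal_powr_def)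
next
  case False
  then have "x \<noteq> \<infinity>" using assms by (auto simp: top_unique)
  with False obtain s t where st: "x = ennreal s" "0 \<le> s" "y = ennreal t" "0 \<le> t"
    by (cases x; cases y) auto
  then have "s \<le> t" using assms by simp
  then show ?thesis using st assms by (simp add: ennreal_powr_ennreal ennreal_leI powr_mono2)
qed

lemma ennreal_powr_powr:
  assumes "0 < a" "0 < b"
  shows "ennreal_powr (ennreal_powr x a) b = ennreal_powr x (a * b)"
proof (cases "x = \<infinity>")
  case False
  then obtain s where "x = ennreal s" "0 \<le> s" by (cases x) auto
  then show ?thesis using assms by (simp add: ennreal_powr_ennreal powr_powr)
qed (use assms in \<open>simp add: ennreal_powr_def\<close>)

text \<open>
  Continuity of the power from below, in the direction in which a square function is estimated by
  its truncations.
\<close>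

lemma ennreal_powr_SUP_le:
  assumes "0 < q" "z \<le> (SUP m. ennreal (t m))" "\<And>m. 0 \<le> t m" "\<And>m. ennreal (t m powr q) \<le> V"
  shows "ennreal_powr z q \<le> V"
proof (cases "V = \<infinity>")
  case False
  then obtain v where v: "V = ennreal v" "0 \<le> v" by (cases V) auto
  have "t m \<le> v powr (1 / q)" for m
  proof -
    have "t m powr q \<le> v" using assms(4)[of m] v by simp
    then have "(t m powr q) powr (1 / q) \<le> v powr (1 / q)" using assms(1) by (intro powr_mono2) auto
    then show ?thesis using assms(1,3) by (simp add: powr_powr)
  qed
  then have "(SUP m. ennreal (t m)) \<le> ennreal (v powr (1 / q))"
    by (intro SUP_least ennreal_leI)
  then have "z \<le> ennreal (v powr (1 / q))" using assms(2) by (rule order_trans[rotated])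
  then have "ennreal_powr z q \<le> ennreal_powr (ennreal (v powr (1 / q))) q"
    by (rule ennreal_powr_mono) (rule assms(1))
  also have "\<dots> = V" using v assms(1) by (simp add: ennreal_powr_ennreal powr_powr)
  finally show ?thesis .
qed simp

lemma powr_sum_le:
  fixes t :: "'u \<Rightarrow> real"
  assumes U: "finite U" and t: "\<And>u. u \<in> U \<Longrightarrow> 0 \<le> t u" and q: "0 < q"
  shows "(\<Sum>u\<in>U. t u) powr q \<le> real (card U) powr q * (\<Sum>u\<in>U. t u powr q)"
proof (cases "U = {}")
  case False
  define M where "M = Max (t ` U)"
  have M: "M \<in> t ` U" unfolding M_def by (rule Max_in) (use U False in auto)
  then obtain u where u: "u \<in> U" "M = t u" by auto
  have "(\<Sum>u\<in>U. t u) \<le> real (card U) * M"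
    by (rule sum_bounded_above) (use U in \<open>simp add: M_def\<close>)
  then have "(\<Sum>u\<in>U. t u) powr q \<le> (real (card U) * M) powr q"
    using t q by (intro powr_mono2 sum_nonneg) auto
  also have "\<dots> = real (card U) powr q * t u powr q" using u t by (simp add: powr_mult)
  also have "\<dots> \<le> real (card U) powr q * (\<Sum>u\<in>U. t u powr q)"
    by (intro mult_left_mono member_le_sum) (use u U in auto)
  finally show ?thesis .
qed simp

section \<open>Weights of finite mixed characteristic\<close>

lemma cubesE:
  assumes "Q \<in> cubes"
  obtains a l where "Q = cbox a (\<chi> i. a $ i + l)" "0 < l"
  using assms unfolding cubes_def by blast

lemma
  assumes "Q \<in> cubes"
  shows cubes_compact: "compact Q" and cubes_lmeasurable: "Q \<in> lmeasurable"
    and cubes_sets: "Q \<in> sets lebesgue" and cubes_measure_pos: "0 < measure lebesgue Q"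
    and cubes_emeasure: "emeasure lebesgue Q = ennreal (measure lebesgue Q)"
proof -
  obtain a l where Q: "Q = cbox a (\<chi> i. a $ i + l)" "0 < l" using assms by (rule cubesE)
  show "compact Q" "Q \<in> lmeasurable" "Q \<in> sets lebesgue" using Q by auto
  then show "emeasure lebesgue Q = ennreal (measure lebesgue Q)" by (intro emeasure_eq_measure2) auto
  have "cbox a (\<chi> i. a $ i + l) \<noteq> {}" using Q by (auto simp: interval_ne_empty_cart)
  then show "0 < measure lebesgue Q" using Q by (simp add: content_cbox_cart)
qed

lemma nn_average_eq_average:
  assumes Q: "Q \<in> cubes" and h: "set_integrable lebesgue Q h" "\<And>x. 0 \<le> h x"
    and eq: "AE x in lebesgue. g x = ennreal (h x)"
  shows "nn_average g Q = ennreal (average h Q)"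
proof -
  have "(\<integral>\<^sup>+x\<in>Q. g x \<partial>lebesgue) = (\<integral>\<^sup>+x\<in>Q. ennreal (h x) \<partial>lebesgue)"
    by (rule nn_integral_cong_AE) (use eq in \<open>eventually_elim, auto\<close>)
  also have "\<dots> = ennreal (LINT x:Q|lebesgue. h x)" by (rule nn_set_integral_eq_LINT[OF h])
  finally show ?thesis
    using cubes_measure_pos[OF Q] h
    by (simp add: nn_average_def average_def cubes_emeasure[OF Q] divide_ennreal set_lebesgue_integral_def
        integral_nonneg_AE)
qed

lemma average_positive:
  assumes A: "A \<in> sets lebesgue" "0 < measure lebesgue A" and h: "set_integrable lebesgue A h" "\<And>x. 0 \<le> h x"
    and pos: "AE x in lebesgue. 0 < h x"
  shows "0 < average h A"
proof -
  have "0 \<le> (LINT x:A|lebesgue. h x)"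
    unfolding set_lebesgue_integral_def using h by (auto intro!: integral_nonneg_AE)
  moreover have "(LINT x:A|lebesgue. h x) \<noteq> 0"
  proof
    assume "(LINT x:A|lebesgue. h x) = 0"
    then have "AE x in lebesgue. indicator A x *\<^sub>R h x = 0"
      unfolding set_lebesgue_integral_def
      by (subst (asm) integral_nonneg_eq_0_iff_AE) (use h in \<open>auto simp: set_integrable_def\<close>)
    with pos have "AE x in lebesgue. x \<notin> A" by eventually_elim (auto simp: indicator_def split: if_splits)
    then have "emeasure lebesgue A = 0" using A AE_iff_measurable[of A lebesgue "\<lambda>x. x \<notin> A"] by auto
    then show False using A by (simp add: measure_def)
  qed
  ultimately show ?thesis using A by (simp add: average_def)
qed

lemma weight_measurable:
  assumes "weight w"
  shows "w \<in> borel_measurable lebesgue"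
proof (rule borel_measurable_LIMSEQ_real)
  fix x
  show "(\<lambda>m. indicator (cball 0 (real m)) x *\<^sub>R w x) \<longlonglongrightarrow> w x"
  proof (rule tendsto_eventually)
    obtain m0 :: nat where "norm x \<le> real m0" using real_arch_simple by blast
    then show "\<forall>\<^sub>F m in sequentially. indicator (cball 0 (real m)) x *\<^sub>R w x = w x"
      by (intro eventually_sequentiallyI[of m0]) (auto simp: indicator_def)
  qed
next
  fix m :: nat
  have "set_integrable lebesgue (cball 0 (real m)) w" using assms by (simp add: weight_def)
  then show "(\<lambda>x. indicator (cball 0 (real m)) x *\<^sub>R w x) \<in> borel_measurable lebesgue"
    unfolding set_integrable_def by (rule borel_measurable_integrable)
qed

lemma ennreal_powr_neg_measurable:
  assumes [measurable]: "w \<in> borel_measurable lebesgue" and "\<And>x. 0 \<le> w x" "c < 0"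
  shows "(\<lambda>x. ennreal_powr (ennreal (w x)) c) \<in> borel_measurable lebesgue"
proof -
  have "(\<lambda>x. ennreal_powr (ennreal (w x)) c) = (\<lambda>x. if w x = 0 then \<infinity> else ennreal (w x powr c))"
    using assms by (auto simp: ennreal_powr_def fun_eq_iff)
  also have "\<dots> \<in> borel_measurable lebesgue" by measurable
  finally show ?thesis .
qed

lemma ennreal_powr_neq_0:
  assumes "x \<noteq> 0" "0 \<le> a"
  shows "ennreal_powr x a \<noteq> 0"
proof (cases "x = \<infinity>")
  case False
  then obtain t where t: "x = ennreal t" "0 \<le> t" by (cases x) auto
  then have "0 < t" using assms(1) by (cases "t = 0") auto
  then show ?thesis using t by (simp add: ennreal_powr_def)
qed (use assms(2) in \<open>auto simp: ennreal_powr_def\<close>)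

lemma ennreal_powr_infinity: "0 < a \<Longrightarrow> ennreal_powr \<infinity> a = \<infinity>"
  by (simp add: ennreal_powr_def)

lemma ennreal_powr_neg_neq_0: "0 \<le> x \<Longrightarrow> a < 0 \<Longrightarrow> ennreal_powr (ennreal x) a \<noteq> 0"
  by (auto simp: ennreal_powr_def)

definition big_cube :: "nat \<Rightarrow> (real ^ 'n) set" where
  "big_cube m = cbox (\<chi> i. - real (Suc m)) (\<chi> i. real (Suc m))"

lemma big_cube_in_cubes: "big_cube m \<in> cubes"
  unfolding cubes_def big_cube_def
  by (intro CollectI exI[of _ "\<chi> i. - real (Suc m)"] exI[of _ "2 * real (Suc m)"]) (auto simp: vec_eq_iff)

lemma big_cube_mono: "m \<le> m' \<Longrightarrow> big_cube m \<subseteq> big_cube m'"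
  by (auto simp: big_cube_def mem_box_cart) (smt (verit) of_nat_mono)+

lemma big_cube_cover: "\<exists>m. x \<in> big_cube m"
proof -
  obtain m :: nat where m: "norm x \<le> real m" using real_arch_simple by blast
  have "- real (Suc m) \<le> x $ i \<and> x $ i \<le> real (Suc m)" for i
    using component_le_norm_cart[of x i] m by (simp add: abs_le_iff)
  then have "x \<in> big_cube m" unfolding big_cube_def mem_box_cart by simp
  then show ?thesis by blast
qed

text \<open>
  Hoelder's inequality for the factorisation \<open>one\<close> bounds the measure of
  \<open>E\<close> by integrals of \<open>\<rho>\<close> and \<open>v\<close> over \<open>E\<close>;
  the integral of \<open>\<rho>\<close> may be extended to \<open>Q\<close>, and the measure of
  \<open>E\<close> is at least half of that of \<open>Q\<close>.
\<close>

lemma half_measure_bound: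
  fixes \<rho> v :: "real ^ 'n \<Rightarrow> real"
  assumes Q: "Q \<in> sets lebesgue" "0 < measure lebesgue Q"
    and E: "E \<in> lmeasurable" "E \<subseteq> Q" "measure lebesgue Q \<le> 2 * measure lebesgue E"
    and \<rho>: "set_integrable lebesgue Q \<rho>" "\<And>x. 0 \<le> \<rho> x"
    and v: "set_integrable lebesgue Q v" "\<And>x. 0 \<le> v x"
    and meas: "\<rho> \<in> borel_measurable lebesgue" "v \<in> borel_measurable lebesgue"
    and pos: "0 < average \<rho> Q" and s: "0 \<le> s"
    and one: "AE x in lebesgue. \<rho> x powr (s / (1 + s)) * v x powr (1 / (1 + s)) = 1"
  shows "measure lebesgue Q \<le> 2 powr (1 + s) * average \<rho> Q powr s * (LINT x:E|lebesgue. v x)"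
proof -
  let ?q = "measure lebesgue Q" and ?e = "measure lebesgue E"
  define R V where "R = (LINT x:E|lebesgue. \<rho> x)" and "V = (LINT x:E|lebesgue. v x)"
  have \<rho>E: "set_integrable lebesgue E \<rho>" and vE: "set_integrable lebesgue E v"
    using set_integrable_subset[OF \<rho>(1)] set_integrable_subset[OF v(1)] E fmeasurableD by auto
  have Es: "E \<in> sets lebesgue" using E by auto
  have V0: "0 \<le> V" unfolding V_def set_lebesgue_integral_def using v by (auto intro!: integral_nonneg_AE)
  have R0: "0 \<le> R" unfolding R_def set_lebesgue_integral_def using \<rho> by (auto intro!: integral_nonneg_AE)
  have "R \<le> (LINT x:Q|lebesgue. \<rho> x)"
    unfolding R_def set_lebesgue_integral_def
  proof (rule integral_mono_AE)
    show "AE x in lebesgue. indicator E x *\<^sub>R \<rho> x \<le> indicator Q x *\<^sub>R \<rho> x"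
      using E(2) \<rho>(2) by (auto simp: indicator_def)
  qed (use \<rho>E \<rho>(1) in \<open>simp_all only: set_integrable_def\<close>)
  then have RQ: "R \<le> average \<rho> Q * ?q" using Q by (simp add: average_def)
  have one_E: "?e = (LINT x:E|lebesgue. 1)" using E(1) Es by (simp add: set_lebesgue_integral_def)
  have eV: "?e powr (1 + s) \<le> R powr s * V"
  proof (cases "s = 0")
    case True
    have "?e = (LINT x:E|lebesgue. v x)"
      unfolding one_E
    proof (rule set_lebesgue_integral_cong_AE[OF Es])
      have "AE x in lebesgue. 1 = v x" using one by eventually_elim (use True v(2) in \<open>auto split: if_splits\<close>)
      then show "AE x\<in>E in lebesgue. 1 = v x" by eventually_elim simp
    qed (use meas in auto)
    moreover have "R \<noteq> 0"
    proof
      assume "R = 0"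
      then have "AE x in lebesgue. indicator E x *\<^sub>R \<rho> x = 0"
        unfolding R_def set_lebesgue_integral_def
        by (subst (asm) integral_nonneg_eq_0_iff_AE) (use \<rho>E \<rho>(2) in \<open>auto simp: set_integrable_def\<close>)
      with one have "AE x in lebesgue. x \<notin> E" by eventually_elim (use True in \<open>auto simp: indicator_def split: if_splits\<close>)
      then have "emeasure lebesgue E = 0" using Es AE_iff_measurable[of E lebesgue "\<lambda>x. x \<notin> E"] by auto
      then show False using E(3) Q(2) by (simp add: measure_def)
    qed
    ultimately show ?thesis using True R0 V0 by (simp add: V_def)
  next
    case False
    then have s: "0 < s" using s by simp
    define a b where "a = s / (1 + s)" and "b = 1 / (1 + s)"
    have ab: "0 < a" "0 < b" "a + b = 1" "a * (1 + s) = s" "b * (1 + s) = 1"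
      using s by (auto simp: a_def b_def simp flip: add_divide_distrib)
    have "?e = (LINT x:E|lebesgue. \<rho> x powr a * v x powr b)"
      unfolding one_E
    proof (rule set_lebesgue_integral_cong_AE[OF Es])
      show "AE x\<in>E in lebesgue. 1 = \<rho> x powr a * v x powr b"
        using one unfolding a_def b_def by eventually_elim simp
    qed (use meas in auto)
    also have "\<dots> \<le> R powr a * V powr b"
      unfolding R_def V_def by (rule set_Hoelder(2)[OF \<rho>E vE \<rho>(2) v(2) ab(1-3)])
    finally have "?e powr (1 + s) \<le> (R powr a * V powr b) powr (1 + s)"
      using s by (intro powr_mono2) auto
    also have "\<dots> = R powr s * V" using R0 V0 by (simp add: powr_mult powr_powr ab)
    finally show ?thesis .
  qed
  have "?q powr (1 + s) \<le> (2 * ?e) powr (1 + s)" using E(3) s by (intro powr_mono2) auto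
  also have "\<dots> = 2 powr (1 + s) * ?e powr (1 + s)" by (simp add: powr_mult)
  also have "\<dots> \<le> 2 powr (1 + s) * (R powr s * V)" by (intro mult_left_mono eV) simp
  also have "\<dots> \<le> 2 powr (1 + s) * ((average \<rho> Q * ?q) powr s * V)"
    by (intro mult_left_mono mult_right_mono powr_mono2 RQ R0 V0 s) simp
  also have "\<dots> = (2 powr (1 + s) * average \<rho> Q powr s * V) * ?q powr s"
    using pos by (simp add: powr_mult mult_ac)
  finally have "?q * ?q powr s \<le> (2 powr (1 + s) * average \<rho> Q powr s * V) * ?q powr s"
    using Q(2) by (simp add: powr_add)
  then show ?thesis unfolding V_def by (rule mult_right_le_imp_le) (use Q(2) in simp)
qed

text \<open>
  If \<open>w\<close> vanishes almost everywhere, its characteristic is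
  \<open>0 * \<infinity> = 0\<close> on every cube. This case is excluded; the remaining weights
  turn out to be positive almost everywhere.
\<close>

locale finite_mixed_weight =
  fixes w :: "real ^ 'n \<Rightarrow> real" and p r :: real
  assumes weight: "weight w" and p3: "3 \<le> p" and pr: "p \<le> r"
    and finite_mixed: "mixed_Ap_Ar p (1 / (p - 1)) r (1 / 2 - 1 / (p - 1)) w < \<infinity>"
    and nontrivial: "\<not> (AE x in lebesgue. w x = 0)"
begin

definition "\<sigma> x = w x powr (- 1 / (p - 1))"
definition "\<rho> x = w x powr (- 1 / (r - 1))"
definition "\<delta> = (p - 3) / (p - 1)"
definition "K = enn2real (mixed_Ap_Ar p (1 / (p - 1)) r (1 / 2 - 1 / (p - 1)) w)"

lemma w_meas [measurable]: "w \<in> borel_measurable lebesgue" by (rule weight_measurable[OF weight])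

lemma w_nonneg: "0 \<le> w x" using weight by (simp add: weight_def)

lemma w_integrable: "Q \<in> cubes \<Longrightarrow> set_integrable lebesgue Q w"
  using weight cubes_compact unfolding weight_def by blast

lemma \<sigma>_meas [measurable]: "\<sigma> \<in> borel_measurable lebesgue" unfolding \<sigma>_def by measurable

lemma \<rho>_meas [measurable]: "\<rho> \<in> borel_measurable lebesgue" unfolding \<rho>_def by measurable

text \<open>
  If \<open>w\<close> is not trivial on \<open>Q\<close>, neither factor of the characteristic of
  \<open>Q\<close> can vanish, so the finiteness of their product passes to the dual average.
\<close>

lemma dual_integral_finite:
  assumes Q: "Q \<in> cubes" and nz: "(\<integral>\<^sup>+x\<in>Q. ennreal (w x) \<partial>lebesgue) \<noteq> 0"
  shows "(\<integral>\<^sup>+x\<in>Q. ennreal_powr (ennreal (w x)) (- 1 / (p - 1)) \<partial>lebesgue) \<noteq> \<infinity>"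
proof -
  have eQ: "emeasure lebesgue Q \<noteq> \<infinity>" "emeasure lebesgue Q \<noteq> 0"
    using cubes_emeasure[OF Q] cubes_measure_pos[OF Q] by auto
  let ?W = "nn_average (\<lambda>x. ennreal (w x)) Q"
  let ?S = "nn_average (\<lambda>x. ennreal_powr (ennreal (w x)) (- 1 / (p - 1))) Q"
  let ?R = "nn_average (\<lambda>x. ennreal_powr (ennreal (w x)) (- 1 / (r - 1))) Q"
  have W: "?W \<noteq> 0" using nz eQ by (simp add: nn_average_def ennreal_divide_eq_0_iff)
  have "(\<integral>\<^sup>+x\<in>Q. ennreal_powr (ennreal (w x)) (- 1 / (r - 1)) \<partial>lebesgue) \<noteq> 0"
  proof
    assume z: "(\<integral>\<^sup>+x\<in>Q. ennreal_powr (ennreal (w x)) (- 1 / (r - 1)) \<partial>lebesgue) = 0"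
    have [measurable]: "(\<lambda>x. ennreal_powr (ennreal (w x)) (- 1 / (r - 1))) \<in> borel_measurable lebesgue"
      by (rule ennreal_powr_neg_measurable) (use p3 pr w_nonneg in \<open>auto intro: divide_neg_pos\<close>)
    note [measurable] = cubes_sets[OF Q]
    have "AE x in lebesgue. ennreal_powr (ennreal (w x)) (- 1 / (r - 1)) * indicator Q x = 0"
    proof -
      have "(\<lambda>x. ennreal_powr (ennreal (w x)) (- 1 / (r - 1)) * indicator Q x) \<in> borel_measurable lebesgue"
        by measurable
      from iffD1[OF nn_integral_0_iff_AE[OF this] z] show ?thesis .
    qed
    then have "AE x in lebesgue. x \<notin> Q"
      by eventually_elim (use ennreal_powr_neg_neq_0[OF w_nonneg, of "- 1 / (r - 1)"] p3 pr in \<open>auto simp: indicator_def split: if_splits\<close>)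
    then show False using eQ AE_iff_measurable[of Q lebesgue "\<lambda>x. x \<notin> Q"] cubes_sets[OF Q] by auto
  qed
  then have R: "?R \<noteq> 0" using eQ by (simp add: nn_average_def ennreal_divide_eq_0_iff)
  let ?A = "Ap_cube p w Q" and ?B = "Ap_cube r w Q"
  have b: "0 \<le> 1 / 2 - 1 / (p - 1)" using p3 by (simp add: field_simps)
  have "?B \<noteq> 0" unfolding Ap_cube_def using W ennreal_powr_neq_0[OF R, of "r - 1"] p3 pr by simp
  then have B: "ennreal_powr ?B (1 / 2 - 1 / (p - 1)) \<noteq> 0" using b by (rule ennreal_powr_neq_0)
  have "ennreal_powr ?A (1 / (p - 1)) * ennreal_powr ?B (1 / 2 - 1 / (p - 1)) < \<infinity>"
    using finite_mixed Q unfolding mixed_Ap_Ar_def by (meson SUP_upper le_less_trans)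
  then have "ennreal_powr ?A (1 / (p - 1)) \<noteq> \<infinity>" using B by (auto simp: ennreal_mult_eq_top_iff)
  then have "?A \<noteq> \<infinity>" using p3 ennreal_powr_infinity[of "1 / (p - 1)"] by force
  then have "ennreal_powr ?S (p - 1) \<noteq> \<infinity>" unfolding Ap_cube_def using W by (auto simp: ennreal_mult_eq_top_iff)
  then have "?S \<noteq> \<infinity>" using p3 ennreal_powr_infinity[of "p - 1"] by force
  then show ?thesis using eQ unfolding nn_average_def by (auto simp: ennreal_top_divide)
qed

lemma w_pos_on_cube:
  assumes Q: "Q \<in> cubes" and nz: "(\<integral>\<^sup>+x\<in>Q. ennreal (w x) \<partial>lebesgue) \<noteq> 0"
  shows "AE x in lebesgue. x \<in> Q \<longrightarrow> w x \<noteq> 0"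
proof -
  have [measurable]: "(\<lambda>x. ennreal_powr (ennreal (w x)) (- 1 / (p - 1))) \<in> borel_measurable lebesgue"
    by (rule ennreal_powr_neg_measurable) (use p3 w_nonneg in \<open>auto intro: divide_neg_pos\<close>)
  note [measurable] = cubes_sets[OF Q]
  have "AE x in lebesgue. ennreal_powr (ennreal (w x)) (- 1 / (p - 1)) * indicator Q x \<noteq> \<infinity>"
    by (rule nn_integral_PInf_AE, measurable) (rule dual_integral_finite[OF assms])
  then show ?thesis
    by eventually_elim (use p3 in \<open>auto simp: ennreal_powr_def indicator_def\<close>)
qed

text \<open>
  A cube that is large enough to see where \<open>w\<close> is not zero has a finite dual average,
  which forces \<open>w\<close> to be non-zero almost everywhere on it. Such cubes exhaust the
  space.
\<close>

lemma w_pos: "AE x in lebesgue. 0 < w x"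
proof -
  obtain m0 where m0: "(\<integral>\<^sup>+x\<in>big_cube m0. ennreal (w x) \<partial>lebesgue) \<noteq> 0"
  proof (rule ccontr)
    assume "\<not> thesis"
    then have z: "(\<integral>\<^sup>+x\<in>big_cube m. ennreal (w x) \<partial>lebesgue) = 0" for m using that by blast
    have "AE x in lebesgue. x \<in> big_cube m \<longrightarrow> w x = 0" for m
    proof -
      note [measurable] = cubes_sets[OF big_cube_in_cubes[of m]]
      have "AE x in lebesgue. ennreal (w x) * indicator (big_cube m) x = 0"
        using z[of m] by (subst (asm) nn_integral_0_iff_AE) auto
      then show ?thesis by eventually_elim (use w_nonneg in \<open>auto simp: antisym\<close>)
    qed
    then have "AE x in lebesgue. \<forall>m. x \<in> big_cube m \<longrightarrow> w x = 0" by (subst AE_all_countable) blast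
    then have "AE x in lebesgue. w x = 0" by eventually_elim (use big_cube_cover in blast)
    then show False using nontrivial by blast
  qed
  have "AE x in lebesgue. x \<in> big_cube (max m m0) \<longrightarrow> w x \<noteq> 0" for m
  proof (rule w_pos_on_cube[OF big_cube_in_cubes])
    have "(\<integral>\<^sup>+x\<in>big_cube m0. ennreal (w x) \<partial>lebesgue) \<le> (\<integral>\<^sup>+x\<in>big_cube (max m m0). ennreal (w x) \<partial>lebesgue)"
      by (rule nn_set_integral_set_mono) (rule big_cube_mono, simp)
    then show "(\<integral>\<^sup>+x\<in>big_cube (max m m0). ennreal (w x) \<partial>lebesgue) \<noteq> 0" using m0 by auto
  qed
  then have "AE x in lebesgue. \<forall>m. x \<in> big_cube (max m m0) \<longrightarrow> w x \<noteq> 0" by (subst AE_all_countable) blast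
  then show ?thesis
  proof eventually_elim
    case (elim x)
    obtain m where "x \<in> big_cube m" using big_cube_cover by blast
    then have "x \<in> big_cube (max m m0)" using big_cube_mono[of m "max m m0"] by auto
    then have "w x \<noteq> 0" using elim by blast
    then show ?case using w_nonneg[of x] by simp
  qed
qed

lemma dual_eq:
  "AE x in lebesgue. ennreal_powr (ennreal (w x)) (- 1 / (p - 1)) = ennreal (\<sigma> x)"
  "AE x in lebesgue. ennreal_powr (ennreal (w x)) (- 1 / (r - 1)) = ennreal (\<rho> x)"
  using w_pos p3 pr by (auto simp: ennreal_powr_def \<sigma>_def \<rho>_def elim!: eventually_mono)

lemma \<sigma>_integrable:
  assumes Q: "Q \<in> cubes"
  shows "set_integrable lebesgue Q \<sigma>"
proof -
  note [measurable] = cubes_sets[OF Q]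
  have "average w Q \<noteq> 0"
    using average_positive[OF cubes_sets[OF Q] cubes_measure_pos[OF Q] w_integrable[OF Q] w_nonneg w_pos] by simp
  then have "(LINT x:Q|lebesgue. w x) \<noteq> 0" by (auto simp: average_def)
  moreover have "0 \<le> (LINT x:Q|lebesgue. w x)"
    unfolding set_lebesgue_integral_def using w_nonneg by (auto intro!: integral_nonneg_AE)
  ultimately have "(\<integral>\<^sup>+x\<in>Q. ennreal (w x) \<partial>lebesgue) \<noteq> 0"
    unfolding nn_set_integral_eq_LINT[OF w_integrable[OF Q] w_nonneg] by simp
  note fin = dual_integral_finite[OF Q this]
  have "(\<integral>\<^sup>+x. ennreal (norm (indicator Q x *\<^sub>R \<sigma> x)) \<partial>lebesgue)
      = (\<integral>\<^sup>+x\<in>Q. ennreal_powr (ennreal (w x)) (- 1 / (p - 1)) \<partial>lebesgue)"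
    by (rule nn_integral_cong_AE)
       (use dual_eq(1) in \<open>eventually_elim, auto simp: indicator_def \<sigma>_def\<close>)
  then show ?thesis
    unfolding set_integrable_def using fin by (intro integrableI_bounded) (auto simp: less_top)
qed

text \<open>
  Since \<open>r \<ge> p\<close>, the exponent of \<open>\<rho>\<close> is closer to zero than that
  of \<open>\<sigma>\<close>, so \<open>\<rho> \<le> \<sigma>\<close> where \<open>w \<le> 1\<close>
  and \<open>\<rho> \<le> 1\<close> elsewhere.
\<close>

lemma \<rho>_integrable:
  assumes Q: "Q \<in> cubes"
  shows "set_integrable lebesgue Q \<rho>"
proof (rule set_integrable_bound)
  note [measurable] = cubes_sets[OF Q]
  show "set_integrable lebesgue Q (\<lambda>x. 1 + \<sigma> x)"
    by (rule set_integral_add(1))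
       (use \<sigma>_integrable[OF Q] set_integrable_bounded[OF cubes_lmeasurable[OF Q], of "\<lambda>_. 1" 1] in auto)
  show "set_borel_measurable lebesgue Q \<rho>" by (simp add: set_borel_measurable_def)
  show "AE x in lebesgue. x \<in> Q \<longrightarrow> norm (\<rho> x) \<le> norm (1 + \<sigma> x)"
  proof (rule AE_I2, rule impI)
    fix x
    show "norm (\<rho> x) \<le> norm (1 + \<sigma> x)"
    proof (cases "w x = 0")
      case False
      then have w: "0 < w x" using w_nonneg[of x] by simp
      show ?thesis
      proof (cases "w x \<le> 1")
        case True
        have "- 1 / (p - 1) \<le> - 1 / (r - 1)" using p3 pr by (simp add: frac_le)
        then have "\<rho> x \<le> \<sigma> x" unfolding \<rho>_def \<sigma>_def using w True by (intro powr_mono') auto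
        then show ?thesis by (simp add: \<rho>_def \<sigma>_def)
      next
        case False
        then have "\<rho> x \<le> w x powr 0" unfolding \<rho>_def using p3 pr by (intro powr_mono) auto
        then have "\<rho> x \<le> 1" using w by simp
        moreover have "0 \<le> \<sigma> x" "0 \<le> \<rho> x" by (auto simp: \<sigma>_def \<rho>_def)
        ultimately show ?thesis by simp
      qed
    qed (simp add: \<rho>_def)
  qed
qed

lemma averages_pos:
  assumes "Q \<in> cubes"
  shows "0 < average w Q" "0 < average \<sigma> Q" "0 < average \<rho> Q"
proof -
  note A = average_positive[OF cubes_sets[OF assms] cubes_measure_pos[OF assms]]
  show "0 < average w Q" by (rule A[OF w_integrable[OF assms] w_nonneg w_pos])
  show "0 < average \<sigma> Q"
    by (rule A[OF \<sigma>_integrable[OF assms]]) (use w_pos in \<open>auto simp: \<sigma>_def elim!: eventually_mono\<close>)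
  show "0 < average \<rho> Q"
    by (rule A[OF \<rho>_integrable[OF assms]]) (use w_pos in \<open>auto simp: \<rho>_def elim!: eventually_mono\<close>)
qed

lemma \<delta>_nonneg: "0 \<le> \<delta>" using p3 by (simp add: \<delta>_def)

text \<open>
  With \<open>a = 1/(p-1)\<close> and \<open>b = 1/2 - a\<close>, the two factors of the
  characteristic multiply to
  \<open>w\<^sub>Q^(1/2) \<sigma>\<^sub>Q \<rho>\<^sub>Q^((r-1)b)\<close>, and
  \<open>2b = \<delta>\<close>.
\<close>

lemma mixed_bound:
  assumes Q: "Q \<in> cubes"
  shows "average w Q * (average \<sigma> Q)\<^sup>2 * average \<rho> Q powr ((r - 1) * \<delta>) \<le> K\<^sup>2"
proof -
  let ?W = "average w Q" and ?S = "average \<sigma> Q" and ?R = "average \<rho> Q"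
  note pos = averages_pos[OF Q]
  define a b where "a = 1 / (p - 1)" and "b = 1 / 2 - 1 / (p - 1)"
  have ab: "0 < a" "0 \<le> b" "a + b = 1 / 2" "(p - 1) * a = 1" "2 * b = \<delta>"
  proof -
    have "\<delta> = ((p - 1) - 2) / (p - 1)" by (simp add: \<delta>_def)
    also have "\<dots> = 1 - 2 / (p - 1)" using p3 by (subst diff_divide_distrib[of "p - 1" 2 "p - 1"]) simp
    finally show "2 * b = \<delta>" by (simp add: b_def)
  qed (use p3 in \<open>simp_all add: a_def b_def divide_le_eq\<close>)
  have nonneg: "0 \<le> \<sigma> x" "0 \<le> \<rho> x" for x by (auto simp: \<sigma>_def \<rho>_def)
  have A: "Ap_cube p w Q = ennreal (?W * ?S powr (p - 1))" "Ap_cube r w Q = ennreal (?W * ?R powr (r - 1))"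
    unfolding Ap_cube_def
      nn_average_eq_average[OF Q w_integrable[OF Q] w_nonneg AE_I2[OF refl]]
      nn_average_eq_average[OF Q \<sigma>_integrable[OF Q] nonneg(1) dual_eq(1)]
      nn_average_eq_average[OF Q \<rho>_integrable[OF Q] nonneg(2) dual_eq(2)]
    using pos p3 pr by (auto simp: ennreal_powr_ennreal ennreal_mult')
  have pw: "ennreal_powr (ennreal x) c = ennreal (x powr c)" if "0 < x" "0 \<le> c" for x c
    using that by (auto simp: ennreal_powr_def)
  have "ennreal ((?W * ?S powr (p - 1)) powr a * (?W * ?R powr (r - 1)) powr b)
     = ennreal_powr (Ap_cube p w Q) a * ennreal_powr (Ap_cube r w Q) b"
    unfolding A using pos ab by (subst (1 2) pw) (auto simp: ennreal_mult')
  also have "\<dots> \<le> mixed_Ap_Ar p a r b w" unfolding mixed_Ap_Ar_def by (rule SUP_upper[OF Q])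
  also have "\<dots> = ennreal K" unfolding K_def a_def b_def using finite_mixed by simp
  finally have "(?W * ?S powr (p - 1)) powr a * (?W * ?R powr (r - 1)) powr b \<le> K"
    by (subst (asm) ennreal_le_iff) (auto simp: K_def)
  also have "(?W * ?S powr (p - 1)) powr a * (?W * ?R powr (r - 1)) powr b
     = (?W powr a * ?W powr b) * ?S * ?R powr ((r - 1) * b)"
    using pos ab by (simp add: powr_mult powr_powr mult_ac)
  also have "?W powr a * ?W powr b = sqrt ?W"
    using pos powr_half_sqrt[of ?W] by (simp add: ab(3) flip: powr_add)
  finally have "sqrt ?W * ?S * ?R powr ((r - 1) * b) \<le> K" .
  then have "(sqrt ?W * ?S * ?R powr ((r - 1) * b))\<^sup>2 \<le> K\<^sup>2"
    by (rule power_mono) (use pos in auto)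
  moreover have "(?R powr ((r - 1) * b))\<^sup>2 = ?R powr ((r - 1) * \<delta>)"
  proof -
    have "(?R powr ((r - 1) * b))\<^sup>2 = ?R powr ((r - 1) * b + (r - 1) * b)"
      by (simp only: power2_eq_square powr_add)
    also have "(r - 1) * b + (r - 1) * b = (r - 1) * \<delta>" unfolding ab(5)[symmetric] by simp
    finally show ?thesis .
  qed
  ultimately show ?thesis using pos by (simp add: power_mult_distrib)
qed


text \<open>
  Almost everywhere \<open>v = w^\<delta>\<close>. The product form makes the Hoelder factorisation
  in the grid bound hold at every point.
\<close>

definition "v x = \<sigma> x powr (2 / p) * w x powr (1 - 2 / p)"
definition "L = 2 powr (1 + (r - 1) * \<delta>) * K\<^sup>2"

lemma v_eq_power: "AE x in lebesgue. v x = w x powr \<delta>"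
  using w_pos
proof eventually_elim
  case (elim x)
  have "- 1 / (p - 1) * (2 / p) + (1 - 2 / p) = \<delta>"
    using p3 by (simp add: \<delta>_def divide_simps) (simp add: algebra_simps)
  then show ?case using elim by (simp add: v_def \<sigma>_def powr_powr flip: powr_add)
qed

lemma Lp_integrand: "ennreal_powr (ennreal \<bar>f x\<bar>) p * ennreal (w x) = ennreal (\<bar>f x\<bar> powr p * w x)"
  using p3 w_nonneg[of x] by (simp add: ennreal_powr_ennreal ennreal_mult')

lemma Lp_integral_finite:
  assumes "f \<in> Lp_space p w"
  shows "(\<integral>\<^sup>+x. ennreal (\<bar>f x\<bar> powr p * w x) \<partial>lebesgue) < \<infinity>"
proof (rule ccontr)
  assume "\<not> ?thesis"
  then have "(\<integral>\<^sup>+x. ennreal (\<bar>f x\<bar> powr p * w x) \<partial>lebesgue) = \<infinity>" by (simp add: not_less top_unique)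
  then have "Lp_norm p w (\<lambda>x. ennreal \<bar>f x\<bar>) = \<infinity>"
    unfolding Lp_norm_def Lp_integrand using p3 ennreal_powr_infinity[of "1 / p"] by simp
  then show False using assms by (simp add: Lp_space_def)
qed

lemma weighted_grid_instance:
  assumes g: "dyadic_grid s" and f: "f \<in> Lp_space p w" and \<theta>: "0 \<le> \<theta>" "\<theta> < 1"
  shows "weighted_grid s w \<sigma> v f \<theta> p L"
proof -
  interpret dyadic_grid s by (rule g)
  have f_meas [measurable]: "f \<in> borel_measurable lebesgue" using f by (simp add: Lp_space_def)
  have on_cube: "set_integrable lebesgue (cube k x) h" if "\<And>Q. Q \<in> cubes \<Longrightarrow> set_integrable lebesgue Q h" for h :: "real ^ 'n \<Rightarrow> real" and k x
    by (rule set_integrable_subset[OF that[OF closed_cube_in_cubes] cube_sets cube_subset_closed])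
  have average_cube: "average h (cube k x) = average h (closed_cube k x)"
    if "h \<in> borel_measurable lebesgue" for h :: "real ^ 'n \<Rightarrow> real" and k x
  proof -
    have n: "AE y in lebesgue. y \<notin> closed_cube k x - cube k x"
      by (rule AE_not_in) (simp only: negligible_closed_cube_diff flip: negligible_iff_null_sets)
    have "(LINT y:cube k x|lebesgue. h y) = (LINT y:closed_cube k x|lebesgue. h y)"
      unfolding set_lebesgue_integral_def
    proof (rule integral_cong_AE)
      show "AE y in lebesgue. indicator (cube k x) y *\<^sub>R h y = indicator (closed_cube k x) y *\<^sub>R h y"
        using n by eventually_elim (use cube_subset_closed in \<open>auto simp: indicator_def\<close>)
    qed (intro borel_measurable_scaleR borel_measurable_indicator that cube_sets
        lmeasurable_cbox[THEN fmeasurableD])+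
    moreover have "measure lebesgue (cube k x) = measure lebesgue (closed_cube k x)"
      by (rule measure_negligible_symdiff)
         (use negligible_closed_cube_diff cube_subset_closed in \<open>auto intro: negligible_subset\<close>)
    ultimately show ?thesis by (simp add: average_def)
  qed
  have avg: "average w (cube k x) = average w (closed_cube k x)"
    "average \<sigma> (cube k x) = average \<sigma> (closed_cube k x)"
    "average \<rho> (cube k x) = average \<rho> (closed_cube k x)" for k x
    by (rule average_cube; measurable)+
  have v_meas [measurable]: "v \<in> borel_measurable lebesgue" unfolding v_def by measurable
  have v0: "0 \<le> v x" and \<sigma>0: "0 \<le> \<sigma> x" and \<rho>0: "0 \<le> \<rho> x" for x by (auto simp: v_def \<sigma>_def \<rho>_def)
  have v_int: "set_integrable lebesgue (cube k x) v" for k x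
    unfolding v_def
    by (rule set_Hoelder(1)[OF on_cube[OF \<sigma>_integrable] on_cube[OF w_integrable] \<sigma>0 w_nonneg]) (use p3 in auto)
  show ?thesis
  proof
    show "0 \<le> \<theta>" "\<theta> < 1" "2 < p" using \<theta> p3 by auto
    show "0 \<le> w y" "0 \<le> \<sigma> y" "0 \<le> v y" for y by (rule w_nonneg \<sigma>0 v0)+
    show "set_integrable lebesgue (cube k x) w" "set_integrable lebesgue (cube k x) \<sigma>" for k x
      by (rule on_cube, erule w_integrable, rule on_cube, erule \<sigma>_integrable)
    show "0 < average w (cube k x)" "0 < average \<sigma> (cube k x)" for k x
      unfolding avg by (rule averages_pos[OF closed_cube_in_cubes])+
    show "v y = \<sigma> y powr (2 / p) * w y powr (1 - 2 / p)" for y by (simp add: v_def)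
    show "f \<in> borel_measurable lebesgue" by (rule f_meas)
    show "set_integrable lebesgue (cube k x) (\<lambda>y. \<bar>f y\<bar> powr p * w y)" for k x
    proof -
      have "integrable lebesgue (\<lambda>y. \<bar>f y\<bar> powr p * w y)"
        by (rule integrableI_nonneg) (use Lp_integral_finite[OF f] w_nonneg in auto)
      then show ?thesis unfolding set_integrable_def by (rule integrable_mult_indicator[OF cube_sets])
    qed
    show "AE y in lebesgue. \<bar>f y\<bar> = (\<bar>f y\<bar> powr p * w y) powr (1 / p) * \<sigma> y powr (1 - 1 / p)"
      using w_pos
    proof eventually_elim
      case (elim y)
      have e: "1 / p + - 1 / (p - 1) * (1 - 1 / p) = 0" using p3 by (simp add: divide_simps) 
      have "(\<bar>f y\<bar> powr p * w y) powr (1 / p) * \<sigma> y powr (1 - 1 / p)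
          = \<bar>f y\<bar> * (w y powr (1 / p) * w y powr (- 1 / (p - 1) * (1 - 1 / p)))"
        using elim p3 by (simp add: \<sigma>_def powr_mult powr_powr)
      also have "w y powr (1 / p) * w y powr (- 1 / (p - 1) * (1 - 1 / p)) = w y powr 0"
        unfolding powr_add[symmetric] e ..
      finally show ?case using elim by simp
    qed
    show "0 \<le> L" by (simp add: L_def)
    fix k x E
    assume E: "E \<in> sets lebesgue" "E \<subseteq> cube k x" "measure lebesgue (cube k x) \<le> 2 * measure lebesgue E"
    let ?W = "average w (cube k x)" and ?S = "average \<sigma> (cube k x)" and ?R = "average \<rho> (cube k x)"
    define t where "t = (r - 1) * \<delta>"
    have t0: "0 \<le> t" using p3 pr \<delta>_nonneg by (simp add: t_def)
    have El: "E \<in> lmeasurable" by (rule fmeasurableI2[OF cube_lmeasurable E(2,1)])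
    have ER: "0 < ?R" unfolding avg by (rule averages_pos[OF closed_cube_in_cubes])
    have one: "AE x in lebesgue. \<rho> x powr (t / (1 + t)) * v x powr (1 / (1 + t)) = 1"
      using v_eq_power w_pos
    proof eventually_elim
      case (elim x)
      have "- 1 / (r - 1) * (t / (1 + t)) + \<delta> * (1 / (1 + t)) = 0"
        using p3 pr by (simp add: t_def)
      then show ?case using elim by (simp add: \<rho>_def powr_powr flip: powr_add)
    qed
    have "measure lebesgue (cube k x) \<le> 2 powr (1 + t) * ?R powr t * (LINT y:E|lebesgue. v y)"
      by (rule half_measure_bound[OF cube_sets measure_cube_pos El E(2,3) on_cube[OF \<rho>_integrable] \<rho>0 v_int v0 \<rho>_meas v_meas ER t0 one])
    then have "?S\<^sup>2 * ?W * measure lebesgue (cube k x) \<le> ?S\<^sup>2 * ?W * (2 powr (1 + t) * ?R powr t * (LINT y:E|lebesgue. v y))"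
      by (rule mult_left_mono)
         (simp add: avg less_imp_le[OF averages_pos(1)[OF closed_cube_in_cubes]])
    also have "\<dots> = (?W * ?S\<^sup>2 * ?R powr t) * (2 powr (1 + t) * (LINT y:E|lebesgue. v y))" by (simp add: mult_ac)
    also have "\<dots> \<le> K\<^sup>2 * (2 powr (1 + t) * (LINT y:E|lebesgue. v y))"
    proof (rule mult_right_mono)
      show "?W * ?S\<^sup>2 * ?R powr t \<le> K\<^sup>2" unfolding avg t_def by (rule mixed_bound[OF closed_cube_in_cubes])
      have "0 \<le> (LINT y:E|lebesgue. v y)"
        unfolding set_lebesgue_integral_def using v0 by (auto intro!: integral_nonneg_AE)
      then show "0 \<le> 2 powr (1 + t) * (LINT y:E|lebesgue. v y)" by simp
    qed
    finally show "?S\<^sup>2 * ?W * measure lebesgue (cube k x) \<le> L * (LINT y:E|lebesgue. v y)"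
      by (simp add: L_def t_def mult_ac)
  qed
qed

end

section \<open>Operators dominated by coefficients\<close>

text \<open>
  The constant of the grid bound is a constant times \<open>K^p\<close>, with \<open>K\<close> the
  mixed characteristic, so its \<open>p\<close>-th root is linear in \<open>K\<close>. Several grids
  cost only a power of their number (\<open>powr_sum_le\<close>).
\<close>

theorem op_norm_bound_of_coef_domination:
  fixes S :: "(real ^ 'n \<Rightarrow> real) \<Rightarrow> real ^ 'n \<Rightarrow> ennreal" and sh :: "'u \<Rightarrow> int \<Rightarrow> real ^ 'n"
  assumes U: "finite U" and grid: "\<And>u. u \<in> U \<Longrightarrow> dyadic_grid (sh u)"
    and \<theta>: "0 \<le> \<theta>" "\<theta> < 1" and B: "0 \<le> B" and p3: "3 \<le> p" and pr: "p \<le> r"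
    and dom: "\<And>f x. f \<in> borel_measurable lebesgue \<Longrightarrow>
        (\<And>u k z. u \<in> U \<Longrightarrow> set_integrable lebesgue (dyadic_grid.cube (sh u) k z) f) \<Longrightarrow>
        \<exists>I. S f x = ennreal_powr I (1 / 2) \<and>
          I \<le> (SUP m. ennreal (B * (\<Sum>u\<in>U. dyadic_grid.coef_sum (sh u) \<theta> f m x)))"
  shows "\<exists>c::real. 0 < c \<and> (\<forall>w. weight w \<longrightarrow>
      op_norm S p w \<le> ennreal c * mixed_Ap_Ar p (1 / (p - 1)) r (1 / 2 - 1 / (p - 1)) w)"
proof -
  define B0 where "B0 = 768 * (1 / (1 - \<theta>))\<^sup>2 * (2 ^ CARD('n))\<^sup>2 * (p / (p - 1))\<^sup>2 * (p / 2)
      * 2 powr (1 + (r - 1) * ((p - 3) / (p - 1)))"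
  define A where "A = B powr (p / 2) * real (card U) powr (p / 2)"
  define c0 where "c0 = (A * real (card U) * B0 powr (p / 2)) powr (1 / p)"
  have B0: "0 \<le> B0" using p3 by (simp add: B0_def)
  have A0: "0 \<le> A" by (simp add: A_def)
  have c0: "0 \<le> c0" by (simp add: c0_def)
  have main: "op_norm S p w \<le> ennreal (c0 + 1) * mixed_Ap_Ar p (1 / (p - 1)) r (1 / 2 - 1 / (p - 1)) w"
    if w: "weight w" for w
  proof -
    let ?M = "mixed_Ap_Ar p (1 / (p - 1)) r (1 / 2 - 1 / (p - 1)) w"
    consider "?M = \<infinity>" | "AE x in lebesgue. w x = 0" | "?M < \<infinity>" "\<not> (AE x in lebesgue. w x = 0)"
      by (cases "?M = \<infinity>") (auto simp: top.not_eq_extremum)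
    then show ?thesis
    proof cases
      case 1
      then show ?thesis using c0 by (simp add: ennreal_mult_eq_top_iff)
    next
      case 2
      have "Lp_norm p w g = 0" for g
      proof -
        have "(\<integral>\<^sup>+x. ennreal_powr (g x) p * ennreal (w x) \<partial>lebesgue) = (\<integral>\<^sup>+x. 0 \<partial>(lebesgue :: (real ^ 'n) measure))"
          by (rule nn_integral_cong_AE) (use 2 in \<open>eventually_elim, simp\<close>)
        then show ?thesis unfolding Lp_norm_def using p3 by (simp add: ennreal_powr_def)
      qed
      then have "op_norm S p w \<le> 0" unfolding op_norm_def by (intro Inf_lower) simp
      then show ?thesis by simp
    next
      case 3
      interpret finite_mixed_weight w p r by standard (use w p3 pr 3 in auto)
      have M: "?M = ennreal K" using 3 by (simp add: K_def)
      have K0: "0 \<le> K" by (simp add: K_def)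
      have bc: "bound_const CARD('n) \<theta> p L = B0 powr (p / 2) * K powr p"
      proof -
        have "bound_const CARD('n) \<theta> p L = (B0 * K\<^sup>2) powr (p / 2)"
          by (simp add: bound_const_def B0_def L_def \<delta>_def mult_ac)
        also have "\<dots> = B0 powr (p / 2) * (K powr 2) powr (p / 2)"
          using B0 K0 by (simp add: powr_mult powr_numeral)
        finally show ?thesis by (simp add: powr_powr)
      qed
      have "Lp_norm p w (S f) \<le> ennreal (c0 * K) * Lp_norm p w (\<lambda>x. ennreal \<bar>f x\<bar>)" if f: "f \<in> Lp_space p w" for f
      proof -
        have f_meas: "f \<in> borel_measurable lebesgue" using f by (simp add: Lp_space_def)
        note wg = weighted_grid_instance[OF grid f \<theta>]
        define N where "N = (\<integral>\<^sup>+x. ennreal (\<bar>f x\<bar> powr p * w x) \<partial>lebesgue)"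
        obtain n where n: "N = ennreal n" "0 \<le> n" using Lp_integral_finite[OF f] unfolding N_def[symmetric] by (cases N) auto
        let ?cs = "\<lambda>u m x. dyadic_grid.coef_sum (sh u) \<theta> f m x"
        let ?V = "\<lambda>u x. (SUP m. ennreal (?cs u m x powr (p / 2) * w x))"
        have cs0: "0 \<le> ?cs u m x" if "u \<in> U" for u m x
          by (rule dyadic_grid.coef_sum_nonneg[OF grid[OF that]])
        have V_meas: "?V u \<in> borel_measurable lebesgue" if "u \<in> U" for u
        proof -
          note [measurable] = dyadic_grid.coef_sum_measurable[OF grid[OF that]]
          show ?thesis by measurable
        qed
        have pointwise: "ennreal_powr (S f x) p * ennreal (w x) \<le> ennreal A * (\<Sum>u\<in>U. ?V u x)" for x
        proof -
          obtain I where I: "S f x = ennreal_powr I (1 / 2)" "I \<le> (SUP m. ennreal (B * (\<Sum>u\<in>U. ?cs u m x)))"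
            using dom[OF f_meas weighted_grid.f_int[OF wg], of x] by blast
          have "ennreal_powr (S f x) p = ennreal_powr I (p / 2)" using p3 by (simp add: I(1) ennreal_powr_powr)
          also have "\<dots> \<le> ennreal A * (\<Sum>u\<in>U. SUP m. ennreal (?cs u m x powr (p / 2)))"
          proof (rule ennreal_powr_SUP_le[OF _ I(2)])
            fix m
            show "0 \<le> B * (\<Sum>u\<in>U. ?cs u m x)" using B cs0 by (simp add: sum_nonneg)
            have "(B * (\<Sum>u\<in>U. ?cs u m x)) powr (p / 2) = B powr (p / 2) * (\<Sum>u\<in>U. ?cs u m x) powr (p / 2)"
              by (rule powr_mult) 
            also have "\<dots> \<le> B powr (p / 2) * (real (card U) powr (p / 2) * (\<Sum>u\<in>U. ?cs u m x powr (p / 2)))"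
              by (rule mult_left_mono[OF powr_sum_le[OF U]]) (use cs0 p3 in auto)
            also have "\<dots> = A * (\<Sum>u\<in>U. ?cs u m x powr (p / 2))" by (simp add: A_def mult.assoc)
            finally have "ennreal ((B * (\<Sum>u\<in>U. ?cs u m x)) powr (p / 2)) \<le> ennreal (A * (\<Sum>u\<in>U. ?cs u m x powr (p / 2)))"
              by (rule ennreal_leI)
            also have "\<dots> = ennreal A * (\<Sum>u\<in>U. ennreal (?cs u m x powr (p / 2)))"
              using A0 by (simp add: ennreal_mult' sum_ennreal)
            also have "\<dots> \<le> ennreal A * (\<Sum>u\<in>U. SUP m. ennreal (?cs u m x powr (p / 2)))"
              by (intro mult_left_mono sum_mono SUP_upper) auto
            finally show "ennreal ((B * (\<Sum>u\<in>U. ?cs u m x)) powr (p / 2)) \<le> ennreal A * (\<Sum>u\<in>U. SUP m. ennreal (?cs u m x powr (p / 2)))" .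
          qed (use p3 in simp)
          finally have "ennreal_powr (S f x) p * ennreal (w x)
              \<le> ennreal A * (\<Sum>u\<in>U. SUP m. ennreal (?cs u m x powr (p / 2))) * ennreal (w x)"
            by (rule mult_right_mono) simp
          also have "\<dots> = ennreal A * (\<Sum>u\<in>U. ?V u x)"
            using w_nonneg[of x] by (simp add: mult.assoc sum_distrib_right SUP_mult_right_ennreal ennreal_mult')
          finally show ?thesis .
        qed
        have "(\<integral>\<^sup>+x. ennreal_powr (S f x) p * ennreal (w x) \<partial>lebesgue) \<le> (\<integral>\<^sup>+x. ennreal A * (\<Sum>u\<in>U. ?V u x) \<partial>lebesgue)"
          by (rule nn_integral_mono) (rule pointwise)
        also have "\<dots> = ennreal A * (\<Sum>u\<in>U. \<integral>\<^sup>+x. ?V u x \<partial>lebesgue)"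
          using V_meas by (simp add: nn_integral_cmult nn_integral_sum)
        also have "\<dots> \<le> ennreal A * (\<Sum>u\<in>U. ennreal (bound_const CARD('n) \<theta> p L) * N)"
          unfolding N_def by (intro mult_left_mono sum_mono weighted_grid.global_bound[OF wg w_meas]) auto
        also have "\<dots> = ennreal (A * real (card U) * B0 powr (p / 2) * K powr p * n)"
          using n A0 by (simp add: bc ennreal_mult' ennreal_of_nat_eq_real_of_nat mult_ac)
        finally have "Lp_norm p w (S f) \<le> ennreal_powr (ennreal (A * real (card U) * B0 powr (p / 2) * K powr p * n)) (1 / p)"
          unfolding Lp_norm_def by (rule ennreal_powr_mono) (use p3 in simp)
        also have "\<dots> = ennreal ((A * real (card U) * B0 powr (p / 2) * K powr p * n) powr (1 / p))"
          using A0 n p3 by (intro ennreal_powr_ennreal) auto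
        also have "(A * real (card U) * B0 powr (p / 2) * K powr p * n) powr (1 / p) = (c0 * K) * n powr (1 / p)"
          using K0 p3 by (simp add: c0_def powr_mult powr_powr)
        also have "ennreal ((c0 * K) * n powr (1 / p)) = ennreal (c0 * K) * Lp_norm p w (\<lambda>x. ennreal \<bar>f x\<bar>)"
          unfolding Lp_norm_def Lp_integrand N_def[symmetric] n(1) using n p3 K0 c0
          by (simp add: ennreal_powr_ennreal ennreal_mult')
        finally show ?thesis .
      qed
      then have "op_norm S p w \<le> ennreal (c0 * K)" unfolding op_norm_def by (intro Inf_lower) blast
      also have "\<dots> \<le> ennreal ((c0 + 1) * K)" using K0 by (intro ennreal_leI mult_right_mono) auto
      also have "\<dots> = ennreal (c0 + 1) * ?M" using c0 K0 by (simp add: M ennreal_mult')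
      finally show ?thesis .
    qed
  qed
  show ?thesis by (rule exI[of _ "c0 + 1"]) (use main c0 in auto)
qed

section \<open>The dyadic square function\<close>

lemma dyadic_grid_standard: "dyadic_grid (\<lambda>_. 0 :: real ^ 'n)"
  by unfold_locales (rule exI[of _ 0], simp)

context dyadic_grid
begin

text \<open>
  The difference of the two averages is a multiple of the pairing of \<open>f\<close> with
  \<open>\<psi> = 2^(-n) (\<chi>\<^sub>Q/|Q| - \<chi>\<^sub>P/|P|)\<close>, where \<open>Q\<close>
  is a child of \<open>P\<close>. It is constant on the children of \<open>P\<close>, and the factor
  \<open>2^(-n)\<close> bounds its oscillation on \<open>P\<close> by \<open>1/|P|\<close>.
\<close>

lemma average_child_diff_le:
  assumes f: "f \<in> borel_measurable lebesgue" "\<And>k z. set_integrable lebesgue (cube k z) f"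
  shows "\<bar>average f (cube k x) - average f (cube (k + 1) x)\<bar> \<le> 2 ^ CARD('n) * coef (1 / 2) f (k + 1) x"
proof -
  let ?Q = "cube k x" and ?P = "cube (k + 1) x" and ?D = "2 ^ CARD('n) :: real"
  let ?q = "measure lebesgue ?Q" and ?p = "measure lebesgue ?P"
  define \<psi> where "\<psi> y = (indicator ?Q y / ?q - 1 / ?p) / ?D" for y
  have q: "0 < ?q" "?p = ?D * ?q" "0 < ?p"
    using measure_cube_pos[of k x] measure_cube_pos[of "k + 1" x] measure_cube_add[of k 1 x x] by auto
  have QP: "?Q \<subseteq> ?P" by (rule cube_Suc)
  have ind: "set_integrable lebesgue ?P (\<lambda>y. f y * indicator ?Q y)"
    by (rule set_integrable_mult_bounded[OF f(2) f(1) _ cube_sets, where B=1])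
       (use cube_sets in \<open>auto simp: indicator_def\<close>)
  have int_Q: "(LINT y:?P|lebesgue. g y * indicator ?Q y) = (LINT y:?Q|lebesgue. g y)" for g :: "real ^ 'n \<Rightarrow> real"
    unfolding set_lebesgue_integral_def
    by (rule Bochner_Integration.integral_cong) (use QP in \<open>auto simp: indicator_def\<close>)
  have int_1: "(LINT y:cube j x|lebesgue. 1) = measure lebesgue (cube j x)" for j
    using cube_lmeasurable[of j x] cube_sets[of j x] by (simp add: set_lebesgue_integral_def)
  have pair: "(LINT y:?P|lebesgue. g y * \<psi> y) = ((LINT y:?Q|lebesgue. g y) / ?q - (LINT y:?P|lebesgue. g y) / ?p) / ?D"
    if "set_integrable lebesgue ?P g" "set_integrable lebesgue ?P (\<lambda>y. g y * indicator ?Q y)" for g :: "real ^ 'n \<Rightarrow> real"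
  proof -
    have "(LINT y:?P|lebesgue. g y * \<psi> y) = (LINT y:?P|lebesgue. (1 / (?q * ?D)) * (g y * indicator ?Q y) - (1 / (?p * ?D)) * g y)"
      by (intro set_lebesgue_integral_cong cube_sets allI impI) (simp add: \<psi>_def field_simps diff_divide_distrib)
    also have "\<dots> = (1 / (?q * ?D)) * (LINT y:?Q|lebesgue. g y) - (1 / (?p * ?D)) * (LINT y:?P|lebesgue. g y)"
      using that by (subst set_integral_diff(2)) (auto simp: int_Q)
    finally show ?thesis by (simp add: diff_divide_distrib)
  qed
  have one: "set_integrable lebesgue ?P (\<lambda>y. 1 :: real)" "set_integrable lebesgue ?P (\<lambda>y. 1 * indicator ?Q y :: real)"
    by (rule set_integrable_bounded[OF cube_lmeasurable, where B=1]; use cube_sets in \<open>auto simp: indicator_def\<close>)+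
  have t: "test_function (1 / 2) (k + 1) x \<psi>"
    unfolding test_function_def
  proof (intro conjI allI impI ballI)
    show "\<psi> \<in> borel_measurable lebesgue" unfolding \<psi>_def using cube_sets by measurable
    show "(LINT y:?P|lebesgue. \<psi> y) = 0" using pair[OF one] q by (simp add: int_1)
    fix j y z assume j: "j \<le> k + 1" and y: "y \<in> ?P" and z: "z \<in> cube j y"
    show "\<bar>\<psi> z - \<psi> y\<bar> \<le> (1 / 2) ^ nat (k + 1 - j) / ?p"
    proof (cases "j = k + 1")
      case True
      have "\<psi> z - \<psi> y = (indicator ?Q z - indicator ?Q y) / ?p"
        using q by (simp add: \<psi>_def diff_divide_distrib mult.commute)
      also have "\<bar>\<dots>\<bar> \<le> 1 / ?p" using q by (auto simp: indicator_def)
      finally show ?thesis using True by simp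
    next
      case False
      then have "z \<in> cube k y" using cube_mono[of j k y] z j by auto
      then have "z \<in> ?Q \<longleftrightarrow> y \<in> ?Q" by (auto simp: cube_def)
      then show ?thesis by (simp add: \<psi>_def indicator_def)
    qed
  qed
  have "?D * \<bar>LINT y:?P|lebesgue. f y * \<psi> y\<bar> \<le> ?D * coef (1 / 2) f (k + 1) x"
    by (intro mult_left_mono coef_upper[OF t f(1) f(2)]) simp
  moreover have "?D * \<bar>LINT y:?P|lebesgue. f y * \<psi> y\<bar> = \<bar>average f ?Q - average f ?P\<bar>"
    unfolding pair[OF f(2) ind] by (simp add: average_def abs_divide)
  ultimately show ?thesis by simp
qed

end

context
begin

interpretation std: dyadic_grid "\<lambda>_. 0 :: real ^ 'n" by (rule dyadic_grid_standard)

lemma dyadic_cubes_eq: "(dyadic_cubes :: (real ^ 'n) set set) = (\<Union>j. range (std.cube j))"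
proof (intro equalityI subsetI)
  fix Q :: "(real ^ 'n) set" assume "Q \<in> dyadic_cubes"
  then obtain k :: "'n \<Rightarrow> int" and j :: int where
    Q: "Q = {x. \<forall>i. of_int (k i) * 2 powi j \<le> x $ i \<and> x $ i < (of_int (k i) + 1) * 2 powi j}"
    unfolding dyadic_cubes_def by blast
  have "Q = std.cube j (\<chi> i. of_int (k i) * 2 powi j)"
    unfolding Q by (auto simp: std.mem_cube std.corner_def std.coord_def algebra_simps)
  then show "Q \<in> (\<Union>j. range (std.cube j))" by blast
next
  fix Q :: "(real ^ 'n) set" assume "Q \<in> (\<Union>j. range (std.cube j))"
  then obtain j z where Q: "Q = std.cube j z" by blast
  have "Q = {x. \<forall>i. of_int (std.coord j z i) * 2 powi j \<le> x $ i \<and> x $ i < (of_int (std.coord j z i) + 1) * 2 powi j}"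
    unfolding Q by (auto simp: std.mem_cube std.corner_def algebra_simps)
  then show "Q \<in> dyadic_cubes" unfolding dyadic_cubes_def by blast
qed

lemma dyadic_parent_cube: "dyadic_parent (std.cube k (x :: real ^ 'n)) = std.cube (k + 1) x"
  unfolding dyadic_parent_def
proof (rule the_equality)
  show "std.cube (k + 1) x \<in> dyadic_cubes \<and> std.cube k x \<subseteq> std.cube (k + 1) x \<and>
      measure lebesgue (std.cube (k + 1) x) = 2 ^ CARD('n) * measure lebesgue (std.cube k x)"
    using std.cube_Suc std.measure_cube_add[of k 1 x x] by (auto simp: dyadic_cubes_eq)
  fix R assume R: "R \<in> dyadic_cubes \<and> std.cube k x \<subseteq> R \<and> measure lebesgue R = 2 ^ CARD('n) * measure lebesgue (std.cube k x)"
  then obtain j z where j: "R = std.cube j z" by (auto simp: dyadic_cubes_eq)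
  have "x \<in> std.cube j z" using R j std.cube_self by auto
  then have Rx: "R = std.cube j x" using j std.cube_eq[of x j z] by simp
  have "(2 powi j :: real) ^ CARD('n) = (2 powi (k + 1)) ^ CARD('n)"
    using R unfolding Rx by (simp add: std.measure_cube power_int_add power_mult_distrib)
  then have "(2 powi j :: real) = 2 powi (k + 1)"
    by (subst (asm) power_eq_iff_eq_base) auto
  then have "j = k + 1"
    using power_int_strict_increasing[of j "k + 1" "2 :: real"] power_int_strict_increasing[of "k + 1" j "2 :: real"]
    by (cases j "k + 1" rule: linorder_cases) auto
  then show "R = std.cube (k + 1) x" using Rx by simp
qed

lemma dyadic_square_dominated:
  fixes f :: "real ^ 'n \<Rightarrow> real"
  assumes f: "f \<in> borel_measurable lebesgue" "\<And>k z. set_integrable lebesgue (std.cube k z) f"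
  shows "\<exists>I. dyadic_square f x = ennreal_powr I (1 / 2) \<and>
    I \<le> (SUP m. ennreal ((2 ^ CARD('n))\<^sup>2 * std.coef_sum (1 / 2) f m x))"
proof (intro exI conjI)
  let ?t = "\<lambda>Q. ennreal ((average f Q - average f (dyadic_parent Q))\<^sup>2) * indicator Q x"
  let ?D = "2 ^ CARD('n) :: real"
  show "dyadic_square f x = ennreal_powr (\<Sum>\<^sub>\<infinity>Q\<in>dyadic_cubes. ?t Q) (1 / 2)"
    by (simp add: dyadic_square_def)
  have "(\<Sum>\<^sub>\<infinity>Q\<in>dyadic_cubes. ?t Q) = (SUP F\<in>{F. finite F \<and> F \<subseteq> dyadic_cubes}. sum ?t F)"
    by (rule nonneg_infsum_complete) simp
  also have "\<dots> \<le> (SUP m. ennreal (?D\<^sup>2 * std.coef_sum (1 / 2) f m x))"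
  proof (rule SUP_least)
    fix F :: "(real ^ 'n) set set" assume "F \<in> {F. finite F \<and> F \<subseteq> dyadic_cubes}"
    then have F: "finite F" "F \<subseteq> dyadic_cubes" by auto
    define F' where "F' = {Q \<in> F. x \<in> Q}"
    have F': "finite F'" using F by (simp add: F'_def)
    have "\<forall>Q\<in>F'. \<exists>k. Q = std.cube k x"
      using F unfolding F'_def dyadic_cubes_eq by (auto dest!: subsetD) (metis std.cube_eq)
    then obtain lev where lev: "\<And>Q. Q \<in> F' \<Longrightarrow> Q = std.cube (lev Q) x" by metis
    have inj: "inj_on (\<lambda>Q. lev Q + 1) F'"
    proof (rule inj_onI)
      fix Q R assume "Q \<in> F'" "R \<in> F'" "lev Q + 1 = lev R + 1"
      then show "Q = R" using lev[of Q] lev[of R] by simp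
    qed
    obtain m :: nat where m: "\<And>Q. Q \<in> F' \<Longrightarrow> \<bar>lev Q + 1\<bar> \<le> int m"
    proof
      fix Q assume "Q \<in> F'"
      then have "nat \<bar>lev Q + 1\<bar> \<le> Max ((\<lambda>Q. nat \<bar>lev Q + 1\<bar>) ` F')" by (intro Max_ge) (use F' in auto)
      then show "\<bar>lev Q + 1\<bar> \<le> int (Max ((\<lambda>Q. nat \<bar>lev Q + 1\<bar>) ` F'))" by linarith
    qed
    have "sum ?t F = sum ?t F'"
      unfolding F'_def by (rule sum.mono_neutral_right) (use F in \<open>auto simp: indicator_def\<close>)
    also have "\<dots> \<le> (\<Sum>Q\<in>F'. ennreal (?D\<^sup>2 * (std.coef (1 / 2) f (lev Q + 1) x)\<^sup>2))"
    proof (rule sum_mono)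
      fix Q assume Q: "Q \<in> F'"
      have "average f Q - average f (dyadic_parent Q)
          = average f (std.cube (lev Q) x) - average f (std.cube (lev Q + 1) x)"
        using lev[OF Q] dyadic_parent_cube[of "lev Q" x] by metis
      then have "\<bar>average f Q - average f (dyadic_parent Q)\<bar> \<le> ?D * std.coef (1 / 2) f (lev Q + 1) x"
        using std.average_child_diff_le[OF f, of "lev Q" x] by simp
      then have "\<bar>average f Q - average f (dyadic_parent Q)\<bar>\<^sup>2 \<le> (?D * std.coef (1 / 2) f (lev Q + 1) x)\<^sup>2"
        by (rule power_mono) simp
      then have "ennreal ((average f Q - average f (dyadic_parent Q))\<^sup>2)
          \<le> ennreal (?D\<^sup>2 * (std.coef (1 / 2) f (lev Q + 1) x)\<^sup>2)"
        by (intro ennreal_leI) (simp add: power_mult_distrib)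
      then show "?t Q \<le> ennreal (?D\<^sup>2 * (std.coef (1 / 2) f (lev Q + 1) x)\<^sup>2)"
        by (simp add: indicator_def)
    qed
    also have "\<dots> = ennreal (?D\<^sup>2 * (\<Sum>Q\<in>F'. (std.coef (1 / 2) f (lev Q + 1) x)\<^sup>2))"
      by (subst sum_ennreal) (auto simp: sum_distrib_left)
    also have "(\<Sum>Q\<in>F'. (std.coef (1 / 2) f (lev Q + 1) x)\<^sup>2)
        = (\<Sum>k\<in>(\<lambda>Q. lev Q + 1) ` F'. (std.coef (1 / 2) f k x)\<^sup>2)"
      by (simp add: sum.reindex[OF inj])
    also have "ennreal (?D\<^sup>2 * \<dots>) \<le> ennreal (?D\<^sup>2 * std.coef_sum (1 / 2) f m x)"
      unfolding std.coef_sum_def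
      by (intro ennreal_leI mult_left_mono sum_mono2) (use m in \<open>force simp: abs_le_iff\<close>)+
    also have "\<dots> \<le> (SUP m. ennreal (?D\<^sup>2 * std.coef_sum (1 / 2) f m x))" by (rule SUP_upper) simp
    finally show "sum ?t F \<le> (SUP m. ennreal (?D\<^sup>2 * std.coef_sum (1 / 2) f m x))" .
  qed
  finally show "(\<Sum>\<^sub>\<infinity>Q\<in>dyadic_cubes. ?t Q) \<le> (SUP m. ennreal (?D\<^sup>2 * std.coef_sum (1 / 2) f m x))" .
qed

end

theorem dyadic_square_bound:
  fixes p r :: real
  assumes "3 \<le> p" "p \<le> r"
  shows "\<exists>c::real. 0 < c \<and> (\<forall>w :: real ^ 'n \<Rightarrow> real. weight w \<longrightarrow>
      op_norm dyadic_square p w \<le> ennreal c * mixed_Ap_Ar p (1 / (p - 1)) r (1 / 2 - 1 / (p - 1)) w)"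
proof (rule op_norm_bound_of_coef_domination[where U="{()}" and sh="\<lambda>_ _. 0 :: real ^ 'n" and \<theta>="1 / 2" and B="(2 ^ CARD('n))\<^sup>2"])
  show "\<exists>I. dyadic_square f x = ennreal_powr I (1 / 2) \<and>
      I \<le> (SUP m. ennreal ((2 ^ CARD('n))\<^sup>2 * (\<Sum>u\<in>{()}. dyadic_grid.coef_sum (\<lambda>_. 0) (1 / 2) f m x)))"
    if "f \<in> borel_measurable lebesgue"
      "\<And>u k z. u \<in> {()} \<Longrightarrow> set_integrable lebesgue (dyadic_grid.cube (\<lambda>_. 0) k z) f"
    for f and x :: "real ^ 'n"
    using dyadic_square_dominated[OF that(1) that(2)[OF singletonI], of x] by simp
qed (use assms dyadic_grid_standard in auto)

section \<open>The intrinsic square function\<close>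

text \<open>
  The shift by a third of the side length, in the coordinates of \<open>u\<close>. Its sign
  alternates with the scale because \<open>2/3 + 1/3\<close> is an integer: with this choice the
  grids are nested.
\<close>

definition third_shift :: "'n set \<Rightarrow> int \<Rightarrow> real ^ 'n" where
  "third_shift u k = (\<chi> i. if i \<in> u then (if even k then 1 else - 1) * 2 powi k / 3 else 0)"

lemma dyadic_grid_third_shift: "dyadic_grid (third_shift u)"
proof
  fix k and i :: 'a
  have p: "(2::real) powi (k + 1) = 2 * 2 powi k" by (simp add: power_int_add)
  show "\<exists>m::int. third_shift u (k + 1) $ i - third_shift u k $ i = of_int m * 2 powi k"
  proof (cases "i \<in> u")
    case True
    then have "third_shift u (k + 1) $ i - third_shift u k $ i = of_int (if even k then - 1 else 1) * 2 powi k"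
      by (simp add: third_shift_def p)
    then show ?thesis by blast
  qed (rule exI[of _ 0], simp add: third_shift_def)
qed

lemma floor_stable:
  fixes a b :: real
  assumes "of_int m + 1 / 8 \<le> a" "a < of_int m + 7 / 8" "\<bar>a - b\<bar> \<le> 1 / 8"
  shows "\<lfloor>b\<rfloor> = m" "\<lfloor>a\<rfloor> = m"
  by (rule floor_unique; use assms in linarith)+

text \<open>
  In each coordinate, either \<open>x\<close> is not within an eighth of the side length of the
  hyperplanes of the unshifted grid, or it becomes so after a shift by a third in either direction.
  The set \<open>u\<close> collects the coordinates of the second kind.
\<close>

lemma ball_in_shifted_cube:
  fixes x :: "real ^ 'n"
  shows "\<exists>u. \<forall>y. norm (y - x) \<le> 2 powi k / 8 \<longrightarrow> y \<in> dyadic_grid.cube (third_shift u) k x"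
proof -
  let ?l = "2 powi k :: real"
  let ?a = "\<lambda>i. x $ i / ?l"
  define central where "central i \<longleftrightarrow> of_int \<lfloor>?a i\<rfloor> + 1 / 8 \<le> ?a i \<and> ?a i < of_int \<lfloor>?a i\<rfloor> + 7 / 8" for i
  define u where "u = {i. \<not> central i}"
  interpret dyadic_grid "third_shift u" by (rule dyadic_grid_third_shift)
  have "y \<in> cube k x" if y: "norm (y - x) \<le> ?l / 8" for y
    unfolding cube_def
  proof (intro CollectI ext)
    fix i
    have "\<bar>x $ i - y $ i\<bar> \<le> ?l / 8"
      using component_le_norm_cart[of "y - x" i] y unfolding vector_minus_component by linarith
    then have d: "\<bar>?a i - y $ i / ?l\<bar> \<le> 1 / 8"
      by (simp add: diff_divide_distrib[symmetric] abs_divide divide_le_eq abs_minus_commute)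
    show "coord k y i = coord k x i"
    proof (cases "central i")
      case True
      then have "i \<notin> u" by (simp add: u_def)
      then have "coord k z i = \<lfloor>z $ i / ?l\<rfloor>" for z by (simp add: coord_def third_shift_def)
      then show ?thesis
        using floor_stable[of "\<lfloor>?a i\<rfloor>" "?a i" "y $ i / ?l"] True d by (simp add: central_def)
    next
      case False
      then have iu: "i \<in> u" by (simp add: u_def)
      define e :: real where "e = (if even k then 1 else - 1)"
      have c: "coord k z i = \<lfloor>z $ i / ?l - e / 3\<rfloor>" for z
        using iu by (simp add: coord_def third_shift_def e_def diff_divide_distrib)
      (* The coordinate of x lies within an eighth of an integer m or m + 1, so after a shift by a third
         it lies between 1/8 and 7/8 of an interval of length one. *)
      define m where "m = \<lfloor>?a i\<rfloor>"
      have m: "of_int m \<le> ?a i" "?a i < of_int m + 1" unfolding m_def by linarith+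
      have far: "?a i < of_int m + 1 / 8 \<or> of_int m + 7 / 8 \<le> ?a i"
        using False by (auto simp: central_def m_def)
      have d': "\<bar>(?a i - e / 3) - (y $ i / ?l - e / 3)\<bar> \<le> 1 / 8" using d by simp
      obtain m' :: int where "of_int m' + 1 / 8 \<le> ?a i - e / 3" "?a i - e / 3 < of_int m' + 7 / 8"
      proof (cases "e = 1")
        case True
        show ?thesis
        proof (cases "?a i < of_int m + 1 / 8")
          case True
          show ?thesis by (rule that[of "m - 1"]) (use True \<open>e = 1\<close> m in simp_all)
        next
          case False
          show ?thesis by (rule that[of m]) (use False far \<open>e = 1\<close> m in simp_all)
        qed
      next
        case False
        then have e: "e = - 1" by (simp add: e_def split: if_splits)
        show ?thesis
        proof (cases "?a i < of_int m + 1 / 8")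
          case True
          show ?thesis by (rule that[of m]) (use True e m in simp_all)
        next
          case False
          show ?thesis by (rule that[of "m + 1"]) (use False far e m in simp_all)
        qed
      qed
      from floor_stable[OF this d'] show ?thesis by (simp add: c)
    qed
  qed
  then show ?thesis by blast
qed

lemma C_alpha_continuous:
  assumes "\<phi> \<in> C_alpha \<alpha>" "0 < \<alpha>"
  shows "continuous_on UNIV \<phi>"
proof -
  have "(\<phi> \<longlongrightarrow> \<phi> x) (at x)" for x
  proof (rule LIM_zero_cancel, rule Lim_null_comparison)
    show "\<forall>\<^sub>F y in at x. norm (\<phi> y - \<phi> x) \<le> norm (y - x) powr \<alpha>"
      using assms by (intro always_eventually) (auto simp: C_alpha_def)
    have "((\<lambda>y. norm (y - x)) \<longlongrightarrow> norm (x - x)) (at x)" by (intro tendsto_intros)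
    then show "((\<lambda>y. norm (y - x) powr \<alpha>) \<longlongrightarrow> 0) (at x)"
      using tendsto_powr2[of "\<lambda>y. norm (y - x)" 0 "at x" "\<lambda>_. \<alpha>" \<alpha>] assms(2) by simp
  qed
  then show ?thesis by (simp add: continuous_on_def)
qed

lemma integral_dilate_reflected:
  fixes \<phi> :: "real ^ 'n \<Rightarrow> real"
  assumes \<phi>: "continuous_on UNIV \<phi>" and t: "0 < t" and z: "(LINT x|lebesgue. \<phi> x) = 0"
  shows "(LINT x|lebesgue. dilate \<phi> t (y - x)) = 0"
proof -
  have [measurable]: "\<phi> \<in> borel_measurable borel" using \<phi> by (rule borel_measurable_continuous_onI)
  have c: "- (1 / t) \<noteq> 0" using t by simp
  let ?T = "\<lambda>x. (1 / t) *\<^sub>R y + (- (1 / t)) *\<^sub>R x"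
  have "0 = (LINT x|lborel. \<phi> x)" using z by (simp add: integral_completion)
  also have "\<dots> = (LINT x|density (distr lborel borel ?T) (\<lambda>_. ennreal (\<bar>- (1 / t)\<bar> ^ DIM(real ^ 'n))). \<phi> x)"
    using lborel_affine[OF c, of "(1 / t) *\<^sub>R y"] by (simp add: ennreal_power)
  also have "\<dots> = (LINT x|distr lborel borel ?T. \<bar>- (1 / t)\<bar> ^ DIM(real ^ 'n) *\<^sub>R \<phi> x)"
    by (rule integral_density) auto
  also have "\<dots> = (LINT x|lborel. \<bar>- (1 / t)\<bar> ^ DIM(real ^ 'n) *\<^sub>R \<phi> (?T x))"
    by (rule integral_distr) auto
  also have "\<dots> = (LINT x|lborel. dilate \<phi> t (y - x))"
  proof (rule Bochner_Integration.integral_cong[OF refl])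
    fix x
    have "?T x = (y - x) /\<^sub>R t" by (simp add: algebra_simps divide_inverse)
    then show "\<bar>- (1 / t)\<bar> ^ DIM(real ^ 'n) *\<^sub>R \<phi> (?T x) = dilate \<phi> t (y - x)"
      using t by (simp add: dilate_def power_divide)
  qed
  also have "\<dots> = (LINT x|lebesgue. dilate \<phi> t (y - x))"
    by (rule integral_completion[symmetric]) (simp add: dilate_def)
  finally show ?thesis by simp
qed

context dyadic_grid
begin

lemma cube_diameter:
  assumes "z \<in> cube j y"
  shows "norm (z - y) \<le> CARD('n) * 2 powi j"
proof -
  have "\<bar>(z - y) $ i\<bar> \<le> 2 powi j" for i
    using mem_cube[of z j y] mem_cube[of y j y] assms cube_self[of y j] by (simp add: abs_le_iff) (smt (verit))
  then have "(\<Sum>i\<in>UNIV. \<bar>(z - y) $ i\<bar>) \<le> (\<Sum>i\<in>(UNIV :: 'n set). 2 powi j)" by (intro sum_mono) 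
  then show ?thesis using norm_le_l1_cart[of "z - y"] by simp
qed

text \<open>
  If \<open>|y - x| < t < 2^k\<close>, the kernel centred at \<open>y\<close> is supported in the
  ball of radius \<open>2^(k+1)\<close> around \<open>x\<close>, which is an eighth of the side
  \<open>2^(k+4)\<close>. As \<open>t \<ge> 2^(k+4)/32\<close>, its Hoelder condition becomes the
  oscillation condition on the grid with \<open>\<theta> = 2^(-\<alpha>)\<close> and the factors
  \<open>32^n\<close> from \<open>t^(-n)\<close> and \<open>(32 n)^\<alpha>\<close> from
  \<open>|z - z'|/t\<close>.
\<close>

lemma A_alpha_le_coef:
  fixes f :: "real ^ 'n \<Rightarrow> real"
  assumes \<alpha>: "0 < \<alpha>" and f: "f \<in> borel_measurable lebesgue" "set_integrable lebesgue (cube (k + 4) x) f"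
    and ball: "\<And>z. norm (z - x) \<le> 2 powi (k + 4) / 8 \<Longrightarrow> z \<in> cube (k + 4) x"
    and y: "norm (y - x) < t" and t: "2 powi (k - 1) \<le> t" "t < 2 powi k"
  shows "A_alpha \<alpha> f y t \<le> ennreal (32 ^ CARD('n) * (32 * CARD('n)) powr \<alpha> * coef (2 powr - \<alpha>) f (k + 4) x)"
  unfolding A_alpha_def
proof (rule SUP_least)
  let ?n = "CARD('n)" and ?Q = "cube (k + 4) x" and ?\<theta> = "2 powr - \<alpha>"
  define B where "B = 32 ^ ?n * (32 * ?n) powr \<alpha>"
  have B: "0 < B" by (simp add: B_def)
  have t0: "0 < t" using t(1) by (rule less_le_trans[rotated]) simp
  fix \<phi> :: "real ^ 'n \<Rightarrow> real" assume \<phi>: "\<phi> \<in> C_alpha \<alpha>"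
  define g where "g z = dilate \<phi> t (y - z)" for z
  define \<psi> where "\<psi> z = g z / B" for z
  have cont: "continuous_on UNIV \<phi>" by (rule C_alpha_continuous[OF \<phi> \<alpha>])
  have "continuous_on UNIV g"
    unfolding g_def dilate_def
    by (intro continuous_intros continuous_on_compose2[OF cont]) (use t0 in auto)
  then have "g \<in> borel_measurable borel" by (rule borel_measurable_continuous_onI)
  then have g_meas: "g \<in> borel_measurable lebesgue" by (intro measurable_completion) simp
  have out: "g z = 0" if "z \<notin> ?Q" for z
  proof -
    have "2 powi (k + 4) / 8 < norm (z - x)" using ball[of z] that by force
    moreover have "(2 powi (k + 4) / 8 :: real) = 2 * 2 powi k" by (simp add: power_int_add)
    moreover have "norm (z - x) \<le> norm (y - z) + norm (y - x)" using norm_triangle_ineq4[of "y - x" "y - z"] by simp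
    ultimately have "t < norm (y - z)" using y t by linarith
    then have "1 < norm ((y - z) /\<^sub>R t)" using t0 by (simp add: divide_simps)
    then show ?thesis using \<phi> by (simp add: g_def dilate_def C_alpha_def)
  qed
  have on_Q: "(LINT z|lebesgue. h z * g z) = (LINT z:?Q|lebesgue. h z * g z)" for h :: "real ^ 'n \<Rightarrow> real"
    unfolding set_lebesgue_integral_def
    by (rule Bochner_Integration.integral_cong) (use out in \<open>auto simp: indicator_def\<close>)
  have osc: "\<bar>g z - g z'\<bar> \<le> B * (?\<theta> ^ nat (k + 4 - j) / measure lebesgue ?Q)" if "j \<le> k + 4" "z \<in> cube j z'" for j z z'
  proof -
    (* tn compares the normalisation of the kernel with the measure of the cube, nz compares distances
       in units of t with the generation of a subcube. *)
    have tn: "1 / t ^ ?n \<le> 32 ^ ?n / measure lebesgue ?Q"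
    proof -
      have "(2 powi (k - 1) :: real) = 2 powi (k + 4) / 32"
        using power_int_add[of "2 :: real" "k - 1" 5] by (simp add: add.commute)
      then have "2 powi (k + 4) / 32 \<le> t" using t(1) by simp
      then have "(2 powi (k + 4) / 32) ^ ?n \<le> t ^ ?n" by (intro power_mono) auto
      then have "1 / t ^ ?n \<le> 1 / (2 powi (k + 4) / 32) ^ ?n" by (intro divide_left_mono) (use t0 in auto)
      then show ?thesis by (simp add: measure_cube power_divide)
    qed
    have nz: "norm ((y - z) /\<^sub>R t - (y - z') /\<^sub>R t) \<le> (32 * ?n) * 2 powr (of_int (j - (k + 4)))"
    proof -
      have "norm ((y - z) /\<^sub>R t - (y - z') /\<^sub>R t) = norm (z - z') / t"
        using t0 by (simp add: norm_minus_commute divide_inverse_commute flip: scaleR_diff_right)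
      also have "\<dots> \<le> (?n * 2 powi j) / t"
        using cube_diameter[OF that(2)] t0 by (intro divide_right_mono) auto
      also have "\<dots> \<le> (?n * 2 powi j) / 2 powi (k - 1)" using t by (intro divide_left_mono) (use t0 in auto)
      also have "\<dots> = ?n * 2 powr (of_int (j - (k - 1)))"
      proof -
        have "(2::real) powi j / 2 powi (k - 1) = 2 powi (j - (k - 1))" by (rule power_int_diff[symmetric]) simp
        also have "\<dots> = 2 powr (of_int (j - (k - 1)))" by (rule powr_real_of_int'[symmetric]) auto
        finally show ?thesis by (simp only: times_divide_eq_right[symmetric])
      qed
      also have "(2::real) powr (of_int (j - (k - 1))) = 32 * 2 powr (of_int (j - (k + 4)))"
      proof -
        have "(2::real) powr (of_int (j - (k - 1))) = 2 powr (5 + of_int (j - (k + 4)))"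
          by (rule arg_cong[where f="(powr) 2"]) simp
        also have "\<dots> = 2 powr 5 * 2 powr (of_int (j - (k + 4)))" by (rule powr_add)
        finally show ?thesis by (simp add: powr_numeral)
      qed
      finally show ?thesis by (simp add: mult_ac)
    qed
    have "\<bar>g z - g z'\<bar> = \<bar>\<phi> ((y - z) /\<^sub>R t) - \<phi> ((y - z') /\<^sub>R t)\<bar> * (1 / t ^ ?n)"
      using t0 by (simp add: g_def dilate_def abs_divide flip: diff_divide_distrib)
    also have "\<dots> \<le> ((32 * ?n) * 2 powr (of_int (j - (k + 4)))) powr \<alpha> * (32 ^ ?n / measure lebesgue ?Q)"
    proof (rule mult_mono)
      have "\<bar>\<phi> ((y - z) /\<^sub>R t) - \<phi> ((y - z') /\<^sub>R t)\<bar> \<le> norm ((y - z) /\<^sub>R t - (y - z') /\<^sub>R t) powr \<alpha>"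
        using \<phi> unfolding C_alpha_def by blast
      also have "\<dots> \<le> ((32 * ?n) * 2 powr (of_int (j - (k + 4)))) powr \<alpha>"
        by (rule powr_mono2) (use nz \<alpha> in auto)
      finally show "\<bar>\<phi> ((y - z) /\<^sub>R t) - \<phi> ((y - z') /\<^sub>R t)\<bar> \<le> ((32 * ?n) * 2 powr (of_int (j - (k + 4)))) powr \<alpha>" .
    qed (use tn t0 in auto)
    also have "((32 * ?n) * 2 powr (of_int (j - (k + 4)))) powr \<alpha> = (32 * ?n) powr \<alpha> * ?\<theta> ^ nat (k + 4 - j)"
    proof -
      have "(2 powr (of_int (j - (k + 4)))) powr \<alpha> = ?\<theta> powr real (nat (k + 4 - j))"
        using that(1) by (simp add: powr_powr algebra_simps)
      also have "\<dots> = ?\<theta> ^ nat (k + 4 - j)" by (simp add: powr_realpow)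
      finally show ?thesis by (simp add: powr_mult)
    qed
    finally show ?thesis by (simp add: B_def mult_ac)
  qed
  have test: "test_function ?\<theta> (k + 4) x \<psi>"
    unfolding test_function_def
  proof (intro conjI allI impI ballI)
    show "\<psi> \<in> borel_measurable lebesgue" unfolding \<psi>_def using g_meas by measurable
    have "(LINT z:?Q|lebesgue. 1 * g z) = 0"
      unfolding on_Q[symmetric] using integral_dilate_reflected[OF cont t0] \<phi> by (simp add: g_def C_alpha_def)
    then show "(LINT z:?Q|lebesgue. \<psi> z) = 0" by (simp add: \<psi>_def)
    fix j z' z assume "j \<le> k + 4" "z' \<in> ?Q" "z \<in> cube j z'"
    then have "\<bar>g z - g z'\<bar> / B \<le> ?\<theta> ^ nat (k + 4 - j) / measure lebesgue ?Q"
      using osc[of j z z'] B by (simp add: pos_divide_le_eq mult.commute)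
    then show "\<bar>\<psi> z - \<psi> z'\<bar> \<le> ?\<theta> ^ nat (k + 4 - j) / measure lebesgue ?Q"
      using B by (simp add: \<psi>_def abs_divide flip: diff_divide_distrib)
  qed
  have "\<bar>convolve f (dilate \<phi> t) y\<bar> = \<bar>LINT z:?Q|lebesgue. f z * g z\<bar>"
    unfolding convolve_def g_def[symmetric] on_Q ..
  also have "\<dots> = B * \<bar>LINT z:?Q|lebesgue. f z * \<psi> z\<bar>"
    using B by (simp add: \<psi>_def abs_divide)
  also have "\<dots> \<le> B * coef ?\<theta> f (k + 4) x"
    using coef_upper[OF test f] B by (intro mult_left_mono) auto
  finally show "ennreal \<bar>convolve f (dilate \<phi> t) y\<bar> \<le> ennreal (32 ^ ?n * (32 * ?n) powr \<alpha> * coef ?\<theta> f (k + 4) x)"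
    unfolding B_def by (rule ennreal_leI)
qed

end

lemma dyadic_scale:
  fixes t :: real
  assumes "0 < t"
  obtains k :: int where "2 powi (k - 1) \<le> t" "t < 2 powi k"
proof -
  let ?k = "\<lfloor>log 2 t\<rfloor> + 1"
  have e: "(2::real) powi j = 2 powr of_int j" for j by (simp add: powr_real_of_int')
  have "2 powr of_int \<lfloor>log 2 t\<rfloor> \<le> 2 powr log 2 t" by (intro powr_mono) auto
  moreover have "2 powr log 2 t < 2 powr of_int ?k" by (intro powr_less_mono) linarith+
  ultimately show thesis using that[of ?k] assms by (simp add: e)
qed

text \<open>
  The cone is cut into the slabs in which \<open>t\<close> is between \<open>2^(k-1)\<close> and
  \<open>2^k\<close>. On each of them the integrand is below a constant, and the sum of these
  constants over boxes containing the slabs is a measurable majorant that can be integrated term by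
  term.
\<close>

lemma intrinsic_square_dominated:
  fixes f :: "real ^ 'n \<Rightarrow> real"
  assumes \<alpha>: "0 < \<alpha>" and f: "f \<in> borel_measurable lebesgue"
    "\<And>u k z. set_integrable lebesgue (dyadic_grid.cube (third_shift u) k z) f"
  defines "B \<equiv> (32 ^ CARD('n) * (32 * CARD('n)) powr \<alpha>)\<^sup>2 * (4 ^ CARD('n) * 2)"
  shows "\<exists>I. intrinsic_square \<alpha> f x = ennreal_powr I (1 / 2) \<and>
    I \<le> (SUP m. ennreal (B * (\<Sum>u\<in>UNIV. dyadic_grid.coef_sum (third_shift u) (2 powr - \<alpha>) f m x)))"
proof (intro exI conjI)
  let ?n = "CARD('n)" and ?\<theta> = "2 powr - \<alpha>"
  let ?F = "\<lambda>z. (A_alpha \<alpha> f (fst z) (snd z))\<^sup>2 * ennreal (1 / snd z ^ (?n + 1))"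
  let ?cs = "\<lambda>u m. dyadic_grid.coef_sum (third_shift u) ?\<theta> f m x"
  define b where "b = 32 ^ ?n * (32 * ?n) powr \<alpha>"
  show "intrinsic_square \<alpha> f x = ennreal_powr (\<integral>\<^sup>+z\<in>cone x. ?F z \<partial>lebesgue) (1 / 2)"
    by (simp add: intrinsic_square_def)
  obtain u where u: "\<And>k y. norm (y - x) \<le> 2 powi k / 8 \<Longrightarrow> y \<in> dyadic_grid.cube (third_shift (u k)) k x"
    using ball_in_shifted_cube[of x] by metis
  define co where "co k = dyadic_grid.coef (third_shift (u (k + 4))) ?\<theta> f (k + 4) x" for k
  define slab where "slab k = cbox (x - (\<chi> i. 2 powi k), 0) (x + (\<chi> i. 2 powi k), 2 powi k :: real)" for k
  define c where "c k = b\<^sup>2 * (co k)\<^sup>2 * (1 / (2 powi (k - 1)) ^ (?n + 1))" for k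
  define h where "h k z = ennreal (c k) * indicator (slab k) z" for k z
  have c0: "0 \<le> c k" for k by (simp add: c_def)
  have slab_meas [measurable]: "slab k \<in> sets lebesgue" for k unfolding slab_def by simp
  have h_meas [measurable]: "h k \<in> borel_measurable lebesgue" for k unfolding h_def by measurable
  have pointwise: "?F z * indicator (cone x) z \<le> (SUP m. \<Sum>k\<in>{- int m..int m}. h k z)" for z
  proof (cases "z \<in> cone x")
    case True
    obtain y t where z: "z = (y, t)" by (cases z)
    then have t: "0 < t" "norm (y - x) < t" using True by (auto simp: cone_def)
    obtain k where k: "2 powi (k - 1) \<le> t" "t < 2 powi k" using dyadic_scale[OF t(1)] .
    interpret dyadic_grid "third_shift (u (k + 4))" by (rule dyadic_grid_third_shift)
    have "A_alpha \<alpha> f y t \<le> ennreal (b * co k)"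
      unfolding b_def co_def by (rule A_alpha_le_coef[OF \<alpha> f u t(2) k])
    then have "(A_alpha \<alpha> f y t)\<^sup>2 \<le> (ennreal (b * co k))\<^sup>2" by (rule power_mono) simp
    also have "\<dots> = ennreal ((b * co k)\<^sup>2)"
      by (rule ennreal_power) (use coef_nonneg[OF _ f] in \<open>simp add: b_def co_def\<close>)
    finally have A: "(A_alpha \<alpha> f y t)\<^sup>2 \<le> ennreal ((b * co k)\<^sup>2)" .
    have "(2 powi (k - 1)) ^ (?n + 1) \<le> t ^ (?n + 1)" using k by (intro power_mono) auto
    then have "1 / t ^ (?n + 1) \<le> 1 / (2 powi (k - 1)) ^ (?n + 1)"
      using t by (intro divide_left_mono) auto
    then have "?F z \<le> ennreal ((b * co k)\<^sup>2) * ennreal (1 / (2 powi (k - 1)) ^ (?n + 1))"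
      unfolding z fst_conv snd_conv by (intro mult_mono A ennreal_leI) auto
    also have "\<dots> = ennreal (c k)" by (simp add: c_def power_mult_distrib flip: ennreal_mult')
    finally have F: "?F z \<le> ennreal (c k)" .
    have "z \<in> slab k"
    proof -
      have "\<bar>(y - x) $ i\<bar> \<le> 2 powi k" for i
        using component_le_norm_cart[of "y - x" i] t k by linarith
      then have "x $ i - 2 powi k \<le> y $ i \<and> y $ i \<le> x $ i + 2 powi k" for i
        unfolding vector_minus_component by (smt (verit, best))
      then show ?thesis
        using t k unfolding slab_def z cbox_Pair_eq by (auto simp: mem_box_cart)
    qed
    then have "?F z * indicator (cone x) z \<le> h k z" using F True by (simp add: h_def)
    also have "\<dots> \<le> (\<Sum>k\<in>{- int (nat \<bar>k\<bar>)..int (nat \<bar>k\<bar>)}. h k z)" by (rule member_le_sum) auto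
    also have "\<dots> \<le> (SUP m. \<Sum>k\<in>{- int m..int m}. h k z)" by (rule SUP_upper) simp
    finally show ?thesis .
  qed simp
  have slab_size: "emeasure lebesgue (slab k) = ennreal ((2 * 2 powi k) ^ ?n * 2 powi k)" for k
  proof -
    have ne: "cbox (x - (\<chi> i. 2 powi k)) (x + (\<chi> i. 2 powi k)) \<noteq> {}" by (auto simp: interval_ne_empty_cart)
    have "measure lebesgue (slab k) = measure lborel (slab k)" by (simp add: slab_def measure_completion)
    then have "measure lebesgue (slab k) = (2 * 2 powi k) ^ ?n * 2 powi k"
      unfolding slab_def content_Pair by (simp add: content_cbox_cart[OF ne])
    moreover have "emeasure lebesgue (slab k) = ennreal (measure lebesgue (slab k))"
      unfolding slab_def by (rule emeasure_eq_measure2) simp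
    ultimately show ?thesis by simp
  qed
  have mass: "(\<integral>\<^sup>+z. h k z \<partial>lebesgue) = ennreal (B * (co k)\<^sup>2)" for k
  proof -
    have two: "(2 powi k :: real) = 2 * 2 powi (k - 1)" using power_int_add[of "2 :: real" "k - 1" 1] by simp
    have "c k * ((2 * 2 powi k) ^ ?n * 2 powi k) = B * (co k)\<^sup>2"
      unfolding two c_def B_def b_def by (simp add: power_mult_distrib)
    then show ?thesis
      unfolding h_def using c0 by (simp add: nn_integral_cmult_indicator slab_size flip: ennreal_mult')
  qed
  have "(\<integral>\<^sup>+z\<in>cone x. ?F z \<partial>lebesgue) \<le> (\<integral>\<^sup>+z. (SUP m. \<Sum>k\<in>{- int m..int m}. h k z) \<partial>lebesgue)"
    by (rule nn_integral_mono) (rule pointwise)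
  also have "\<dots> = (SUP m. \<integral>\<^sup>+z. (\<Sum>k\<in>{- int m..int m}. h k z) \<partial>lebesgue)"
  proof (rule nn_integral_monotone_convergence_SUP)
    show "incseq (\<lambda>m z. \<Sum>k\<in>{- int m..int m}. h k z)"
      unfolding incseq_def le_fun_def by (intro allI impI sum_mono2) auto
  qed measurable
  also have "\<dots> = (SUP m. \<Sum>k\<in>{- int m..int m}. ennreal (B * (co k)\<^sup>2))"
    by (subst nn_integral_sum) (auto simp: mass)
  also have "\<dots> \<le> (SUP m. ennreal (B * (\<Sum>u\<in>UNIV. ?cs u m)))"
  proof (rule SUP_least)
    fix m :: nat
    have B0: "0 \<le> B" by (simp add: B_def)
    have "(\<Sum>k\<in>{- int m..int m}. (co k)\<^sup>2)
        \<le> (\<Sum>k\<in>{- int m..int m}. \<Sum>v\<in>UNIV. (dyadic_grid.coef (third_shift v) ?\<theta> f (k + 4) x)\<^sup>2)"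
      unfolding co_def by (intro sum_mono member_le_sum) auto
    also have "\<dots> = (\<Sum>v\<in>UNIV. \<Sum>k\<in>{- int m..int m}. (dyadic_grid.coef (third_shift v) ?\<theta> f (k + 4) x)\<^sup>2)"
      by (rule sum.swap)
    also have "\<dots> \<le> (\<Sum>v\<in>UNIV. ?cs v (m + 4))"
    proof (rule sum_mono)
      fix v
      have "(\<Sum>k\<in>{- int m..int m}. (dyadic_grid.coef (third_shift v) ?\<theta> f (k + 4) x)\<^sup>2)
          = (\<Sum>k\<in>(\<lambda>k. k + 4) ` {- int m..int m}. (dyadic_grid.coef (third_shift v) ?\<theta> f k x)\<^sup>2)"
        by (subst sum.reindex) (auto simp: inj_on_def)
      also have "\<dots> \<le> ?cs v (m + 4)"
        unfolding dyadic_grid.coef_sum_def[OF dyadic_grid_third_shift] by (rule sum_mono2) auto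
      finally show "(\<Sum>k\<in>{- int m..int m}. (dyadic_grid.coef (third_shift v) ?\<theta> f (k + 4) x)\<^sup>2) \<le> ?cs v (m + 4)" .
    qed
    finally have "B * (\<Sum>k\<in>{- int m..int m}. (co k)\<^sup>2) \<le> B * (\<Sum>v\<in>UNIV. ?cs v (m + 4))"
      using B0 by (rule mult_left_mono)
    then have "(\<Sum>k\<in>{- int m..int m}. ennreal (B * (co k)\<^sup>2)) \<le> ennreal (B * (\<Sum>v\<in>UNIV. ?cs v (m + 4)))"
      using B0 by (simp add: sum_ennreal sum_distrib_left ennreal_leI)
    also have "\<dots> \<le> (SUP m. ennreal (B * (\<Sum>u\<in>UNIV. ?cs u m)))" by (rule SUP_upper) simp
    finally show "(\<Sum>k\<in>{- int m..int m}. ennreal (B * (co k)\<^sup>2)) \<le> (SUP m. ennreal (B * (\<Sum>u\<in>UNIV. ?cs u m)))" .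
  qed
  finally show "(\<integral>\<^sup>+z\<in>cone x. ?F z \<partial>lebesgue) \<le> (SUP m. ennreal (B * (\<Sum>u\<in>UNIV. ?cs u m)))" .
qed

theorem intrinsic_square_bound:
  fixes p r \<alpha> :: real
  assumes "3 \<le> p" "p \<le> r" "0 < \<alpha>"
  shows "\<exists>c::real. 0 < c \<and> (\<forall>w :: real ^ 'n \<Rightarrow> real. weight w \<longrightarrow>
      op_norm (intrinsic_square \<alpha>) p w \<le> ennreal c * mixed_Ap_Ar p (1 / (p - 1)) r (1 / 2 - 1 / (p - 1)) w)"
proof (rule op_norm_bound_of_coef_domination[where U=UNIV and sh=third_shift and \<theta>="2 powr - \<alpha>"])
  show "2 powr - \<alpha> < 1" using assms by (simp add: powr_less_one)
  show "\<exists>I. intrinsic_square \<alpha> f x = ennreal_powr I (1 / 2) \<and>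
      I \<le> (SUP m. ennreal ((32 ^ CARD('n) * (32 * CARD('n)) powr \<alpha>)\<^sup>2 * (4 ^ CARD('n) * 2)
        * (\<Sum>u\<in>UNIV. dyadic_grid.coef_sum (third_shift u) (2 powr - \<alpha>) f m x)))"
    if "f \<in> borel_measurable lebesgue"
      "\<And>u k z. u \<in> UNIV \<Longrightarrow> set_integrable lebesgue (dyadic_grid.cube (third_shift u) k z) f"
    for f and x :: "real ^ 'n"
    by (rule intrinsic_square_dominated[OF assms(3) that(1) that(2)[OF UNIV_I]])
qed (use assms dyadic_grid_third_shift in auto)

section \<open>The mixed bound for both square functions\<close>

theorem theorem1p2:
  fixes S :: "(real ^ 'n \<Rightarrow> real) \<Rightarrow> real ^ 'n \<Rightarrow> ennreal" and p r :: real
  assumes "S = dyadic_square \<or> (\<exists>\<alpha>. 0 < \<alpha> \<and> \<alpha> \<le> 1 \<and> S = intrinsic_square \<alpha>)"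
    and "3 \<le> p" and "p \<le> r"
  shows "\<exists>c::real. 0 < c \<and>
    (\<forall>w. weight w \<longrightarrow>
      op_norm S p w \<le> ennreal c * mixed_Ap_Ar p (1 / (p - 1)) r (1 / 2 - 1 / (p - 1)) w)"
  using assms(1)
proof (elim disjE exE conjE)
  assume "S = dyadic_square"
  then show ?thesis using dyadic_square_bound[OF assms(2,3)] by simp
next
  fix \<alpha> :: real assume "0 < \<alpha>" "S = intrinsic_square \<alpha>"
  then show ?thesis using intrinsic_square_bound[OF assms(2,3)] by simp
qed

end
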